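(* Let $\mathbb{K}$ be a field, $S=\mathbb{K}[x_1,\ldots,x_\ell]$, and let $\mathcal{A}$ be a free arrangement in $\mathbb{K}^\ell$ with $\exp(\mathcal{A})=(d_1,d_2,\ldots,d_\ell)$, $d_1=1$. Let $H_1=\ker\alpha_1$, $H_2=\ker\alpha_2$ be two distinct hyperplanes of $\mathcal{A}$, put $\mathcal{A}_1=\mathcal{A}\setminus\{H_1\}$, $\mathcal{A}_2=\mathcal{A}\setminus\{H_2\}$, $\mathcal{A}_{1,2}=\mathcal{A}\setminus\{H_1,H_2\}$, and assume that $\mathcal{A}_j$ is SPOG with $\mathrm{POexp}(\mathcal{A}_j)=(d_1,\ldots,d_\ell)$ and level $c_j$ for $j=1,2$, with $c_1\le c_2$. Let $\rho_1^2:D(\mathcal{A}_1)\to D((\mathcal{A}_1)^{H_2})$ and $\rho_2^1:D(\mathcal{A}_2)\to D((\mathcal{A}_2)^{H_1})$ be the Euler restriction maps. If $|\mathrm{DS}(\mathcal{A}_{1,2})|\le\ell+2$, then $D(\mathcal{A}_{1,2})$ has a minimal free resolution of one of the following forms: (1) If $D(\mathcal{A})+\ker\rho_1^2=D(\mathcal{A}_1)$, there exist $f_1,\ldots,f_\ell\in S$ such that $$0\to S[-c_1-1]\xrightarrow{(\alpha_1\alpha_2,f_1,\ldots,f_\ell)}S[-c_1+1]\oplus\Big(\bigoplus_{i=1}^\ell S[-d_i]\Big)\to D(\mathcal{A}_{1,2})\to0.$$ (2) If $D(\mathcal{A})+\ker\rho_1^2\subsetneq D(\mathcal{A}_1)$,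 $D(\mathcal{A})+\ker\rho_2^1=D(\mathcal{A}_2)$ and $|\mathrm{DS}(\mathcal{A}_{1,2})|=\ell+2$, there exist $f_i,g_i,g\in S$ with $g\ne0$ such that $$0\to S[-c_1-1]\oplus S[-c_2]\xrightarrow{\begin{array}{c}(\alpha_1,0,f_1,\ldots,f_\ell)\\(g,\alpha_2,g_1,\ldots,g_\ell)\end{array}}S[-c_1]\oplus S[-c_2+1]\oplus\Big(\bigoplus_{i=1}^\ell S[-d_i]\Big)\to D(\mathcal{A}_{1,2})\to0.$$ (3) If $D(\mathcal{A})+\ker\rho_1^2\subsetneq D(\mathcal{A}_1)$, $D(\mathcal{A})+\ker\rho_2^1=D(\mathcal{A}_2)$ and $|\mathrm{DS}(\mathcal{A}_{1,2})|=\ell+1$, then, after a suitable renumbering of the exponents $d_2,\ldots,d_\ell$, there exist $f_1,\ldots,f_{\ell-1}\in S$ such that $$0\to S[-c_1-1]\xrightarrow{(\alpha_1,0,f_1,\ldots,f_{\ell-1})}S[-c_1]\oplus S[-c_2+1]\oplus\Big(\bigoplus_{i=1}^{\ell-1}S[-d_i]\Big)\to D(\mathcal{A}_{1,2})\to0.$$ Moreover, in this case $\mathcal{A}_{1,2}$ is SPOG. (4) If $D(\mathcal{A})+\ker\rho_2^1\subsetneq D(\mathcal{A}_2)$, there exist $f_i,g_i\in S$ such that $$0\to S[-c_1-1]\oplus S[-c_2-1]\xrightarrow{\begin{array}{c}(\alpha_1,0,f_1,\ldots,f_\ell)\\(0,\alpha_2,g_1,\ldots,g_\ell)\end{array}}S[-c_1]\oplus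 S[-c_2]\oplus\Big(\bigoplus_{i=1}^\ell S[-d_i]\Big)\to D(\mathcal{A}_{1,2})\to0.$$
   Context: Let $V=\mathbb{K}^\ell$ and $S=\mathbb{K}[x_1,\ldots,x_\ell]$ with the usual grading, $S[-d]$ the graded free module with generator in degree $d$. A (central) hyperplane arrangement $\mathcal{A}$ is a finite set of linear hyperplanes in $V$; $\alpha_H\in S_1$ is a linear form with $H=\ker\alpha_H$. $D(\mathcal{A})=\{\theta\in\mathrm{Der}\,S\mid\theta(\alpha_H)\in S\alpha_H\ \forall H\in\mathcal{A}\}$, $\mathrm{Der}\,S=\bigoplus_iS\partial_{x_i}$; $\sum f_i\partial_{x_i}$ is homogeneous of degree $d$ if all $f_i\in S_d$. $\mathcal{A}$ is free with $\exp(\mathcal{A})=(d_1,\ldots,d_\ell)$ if $D(\mathcal{A})$ is free over $S$ with a homogeneous basis of degrees $d_1,\ldots,d_\ell$. $\mathrm{DS}(\mathcal{B})$ is the unordered sequence of degrees of a minimal set of homogeneous generators of $D(\mathcal{B})$ and $|\mathrm{DS}(\mathcal{B})|$ is the number of these generators. $\mathcal{B}$ is SPOG (strictly plus-one generated) with exponents $\mathrm{POexp}(\mathcal{B})=(p_1,\ldots,p_\ell)$ and level $d$ if there exist $f_1,\ldots,f_\ell,\alpha\in S$, $\alpha\ne0$, such that $D(\mathcal{B})$ has a minimal free resolution $0\to S[-d-1]\xrightarrow{(\alpha,f_1,\ldots,f_\ell)}S[-d]\oplus\bigoplus_{i=1}^\ell S[-p_i]\to D(\mathcal{B})\to0$.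 For an arrangement $\mathcal{B}$ and a hyperplane $H\in\mathcal{B}$, the restriction is $\mathcal{B}^H=\{L\cap H\mid L\in\mathcal{B}\setminus\{H\}\}$, an arrangement in $H$ (with coordinate ring $S/\alpha_HS$), and the Euler restriction map $\rho:D(\mathcal{B})\to D(\mathcal{B}^H)$ is reduction of derivations modulo $\alpha_H$. In the displayed resolutions, each row of the matrix is the image of the corresponding generator of the left-hand free module, i.e. a relation among the minimal generators. *)

theory Defs
  imports
    "HOL-Analysis.Finite_Cartesian_Product"
    "HOL-Library.Poly_Mapping"
    "HOL-Library.Multiset"
    "HOL-Library.Set_Algebras"
begin

section \<open>Polynomials\<close>

text \<open>
  The finite type \<open>'n\<close> indexes the coordinates, so that \<open>\<ell> = CARD('n)\<close>.
  The ring \<open>S\<close> is the monoid algebra of the exponent vectors \<open>'n \<Rightarrow>\<^sub>0 nat\<close>, and a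
  derivation \<open>\<Sum>i. f i \<partial>/\<partial>x\<^sub>i\<close> is represented by its coefficient vector, i.e.\ \<open>Der S\<close> is
  the free module \<open>S ^ 'n\<close> (with scalar multiplication \<open>*s\<close>).
\<close>

type_synonym ('k, 'n) mpoly = "('n \<Rightarrow>\<^sub>0 nat) \<Rightarrow>\<^sub>0 'k"
type_synonym ('k, 'n) der = "(('n \<Rightarrow>\<^sub>0 nat) \<Rightarrow>\<^sub>0 'k) ^ 'n"

definition mon_deg :: "('n::finite \<Rightarrow>\<^sub>0 nat) \<Rightarrow> nat" where
  "mon_deg m = (\<Sum>i\<in>UNIV. Poly_Mapping.lookup m i)"

text \<open>
  Degrees are integers, so that shifts such as \<open>c - 1\<close> do not truncate.
  The component of a negative degree is \<open>0\<close>, and \<open>0\<close> is homogeneous of every degree.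
\<close>

definition homogeneous :: "int \<Rightarrow> ('k::field, 'n::finite) mpoly \<Rightarrow> bool" where
  "homogeneous d p \<longleftrightarrow> (\<forall>m\<in>Poly_Mapping.keys p. int (mon_deg m) = d)"

definition poly_eval :: "('k::field, 'n::finite) mpoly \<Rightarrow> 'k ^ 'n \<Rightarrow> 'k" where
  "poly_eval p v = (\<Sum>m\<in>Poly_Mapping.keys p. Poly_Mapping.lookup p m * (\<Prod>i\<in>UNIV. (v $ i) ^ Poly_Mapping.lookup m i))"

definition partial :: "'n::finite \<Rightarrow> ('k::field, 'n) mpoly \<Rightarrow> ('k, 'n) mpoly" where
  "partial i p = (\<Sum>m\<in>Poly_Mapping.keys p.
     Poly_Mapping.single (m - Poly_Mapping.single i 1) (of_nat (Poly_Mapping.lookup m i) * Poly_Mapping.lookup p m))"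

definition der_apply :: "('k::field, 'n::finite) der \<Rightarrow> ('k, 'n) mpoly \<Rightarrow> ('k, 'n) mpoly" where
  "der_apply \<theta> f = (\<Sum>i\<in>UNIV. \<theta> $ i * partial i f)"

definition hom_der :: "int \<Rightarrow> ('k::field, 'n::finite) der \<Rightarrow> bool" where
  "hom_der d \<theta> \<longleftrightarrow> (\<forall>i. homogeneous d (\<theta> $ i))"


section \<open>Arrangements and logarithmic derivations\<close>

definition linear_form :: "('k::field, 'n::finite) mpoly \<Rightarrow> bool" where
  "linear_form \<alpha> \<longleftrightarrow> \<alpha> \<noteq> 0 \<and> homogeneous 1 \<alpha>"

definition ker_form :: "('k::field, 'n::finite) mpoly \<Rightarrow> ('k ^ 'n) set" where
  "ker_form \<alpha> = {v. poly_eval \<alpha> v = 0}"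

definition arrangement :: "('k::field ^ 'n::finite) set set \<Rightarrow> bool" where
  "arrangement A \<longleftrightarrow> finite A \<and> (\<forall>H\<in>A. \<exists>\<alpha>. linear_form \<alpha> \<and> H = ker_form \<alpha>)"

text \<open>
  The form \<open>\<alpha>\<^sub>H\<close> is unique up to a nonzero scalar, so quantifying over all
  forms that define \<open>H\<close> is the same as fixing one of them.
\<close>

definition log_der :: "('k::field ^ 'n::finite) set set \<Rightarrow> ('k, 'n) der set" where
  "log_der A = {\<theta>. \<forall>H\<in>A. \<forall>\<alpha>. linear_form \<alpha> \<and> H = ker_form \<alpha> \<longrightarrow> \<alpha> dvd der_apply \<theta> \<alpha>}"


section \<open>Generators, free arrangements, resolutions\<close>

text \<open>Elements of the free module \<open>S\<^sup>r\<close> are lists of length \<open>r\<close>.\<close>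

definition lin_comb ::
    "('k::field, 'n::finite) der list \<Rightarrow> ('k, 'n) mpoly list \<Rightarrow> ('k, 'n) der" where
  "lin_comb \<theta>s us = (\<Sum>j<length \<theta>s. (us ! j) *s (\<theta>s ! j))"

definition generated :: "('k::field, 'n::finite) der list \<Rightarrow> ('k, 'n) der set" where
  "generated \<theta>s = {lin_comb \<theta>s us | us. length us = length \<theta>s}"

definition free_with_exp :: "('k::field ^ 'n::finite) set set \<Rightarrow> int list \<Rightarrow> bool" where
  "free_with_exp A ds \<longleftrightarrow> length ds = CARD('n) \<and>
     (\<exists>\<theta>s. list_all2 hom_der ds \<theta>s \<and> generated \<theta>s = log_der A \<and>
        (\<forall>us. length us = length \<theta>s \<and> lin_comb \<theta>s us = 0 \<longrightarrow> (\<forall>u\<in>set us. u = 0)))"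

text \<open>
  \<open>DS B M\<close> says that \<open>M\<close> is the multiset of degrees of a minimal (no generator can be dropped)
  system of homogeneous generators of \<open>D(B)\<close>.  Such a system exists and \<open>M\<close> is determined
  by \<open>B\<close>, so \<open>size M\<close> is the number \<open>|DS(B)|\<close>.
\<close>

definition DS :: "('k::field ^ 'n::finite) set set \<Rightarrow> int multiset \<Rightarrow> bool" where
  "DS B M \<longleftrightarrow> (\<exists>\<theta>s ds. M = mset ds \<and> list_all2 hom_der ds \<theta>s \<and> generated \<theta>s = log_der B \<and>
     (\<forall>j<length \<theta>s. generated (take j \<theta>s @ drop (Suc j) \<theta>s) \<noteq> log_der B))"

text \<open>
  Matrices are lists of rows and act on row vectors: row \<open>i\<close> is the image of the
  \<open>i\<close>-th generator.
\<close>

definition row_mult ::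
    "nat \<Rightarrow> ('k::field, 'n::finite) mpoly list \<Rightarrow> ('k, 'n) mpoly list list \<Rightarrow> ('k, 'n) mpoly list"
  where "row_mult q vs M = map (\<lambda>j. \<Sum>i<length M. vs ! i * (M ! i ! j)) [0..<q]"

text \<open>
  \<open>min_free_res as M bs D\<close>: there is a minimal graded free resolution of \<open>D\<close>
  \[0 \to \bigoplus_i S[-as_i] \xrightarrow{M} \bigoplus_j S[-bs_j] \to D \to 0,\]
  where the map onto \<open>D\<close> sends the \<open>j\<close>-th generator to \<open>\<theta>s ! j\<close>. The conditions are, in
  order: \<open>M\<close> has the right shape and is homogeneous of degree \<open>0\<close>; it is minimal, i.e.\ its
  image lies in \<open>(x\<^sub>1, \<dots>, x\<^sub>\<ell>)\<close> times the target; \<open>M\<close> is injective; the map onto \<open>D\<close> is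
  homogeneous of degree \<open>0\<close>; it is surjective; the sequence is exact in the middle.
\<close>

definition min_free_res ::
    "int list \<Rightarrow> ('k::field, 'n::finite) mpoly list list \<Rightarrow> int list \<Rightarrow> ('k, 'n) der set \<Rightarrow> bool"
  where
  "min_free_res as M bs D \<longleftrightarrow>
     length M = length as \<and>
     (\<forall>i<length as. length (M ! i) = length bs \<and>
        (\<forall>j<length bs. homogeneous (as ! i - bs ! j) (M ! i ! j))) \<and>
     (\<forall>i<length as. \<forall>j<length bs. Poly_Mapping.lookup (M ! i ! j) 0 = 0) \<and>
     (\<forall>vs. length vs = length as \<and> (\<forall>u\<in>set (row_mult (length bs) vs M). u = 0)
        \<longrightarrow> (\<forall>v\<in>set vs. v = 0)) \<and>
     (\<exists>\<theta>s. list_all2 hom_der bs \<theta>s \<and>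
        generated \<theta>s = D \<and>
        {us. length us = length bs \<and> lin_comb \<theta>s us = 0}
          = {row_mult (length bs) vs M | vs. length vs = length as})"

definition SPOG_with :: "('k::field ^ 'n::finite) set set \<Rightarrow> int list \<Rightarrow> int \<Rightarrow> bool" where
  "SPOG_with B ps d \<longleftrightarrow> length ps = CARD('n) \<and>
     (\<exists>\<alpha> fs. \<alpha> \<noteq> 0 \<and> length fs = CARD('n) \<and>
        min_free_res [d + 1] [\<alpha> # fs] (d # ps) (log_der B))"

definition SPOG :: "('k::field ^ 'n::finite) set set \<Rightarrow> bool" where
  "SPOG B \<longleftrightarrow> (\<exists>ps d. SPOG_with B ps d)"


section \<open>Euler restriction\<close>

definition residue :: "('k::field, 'n::finite) mpoly \<Rightarrow> ('k, 'n) mpoly \<Rightarrow> ('k, 'n) mpoly set" where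
  "residue \<alpha> f = {f + \<alpha> * g | g. True}"

text \<open>
  For \<open>H = ker \<alpha> \<in> B\<close> and \<open>\<theta> \<in> D(B)\<close> we have \<open>\<theta>(\<alpha>) \<in> S\<alpha>\<close>, so \<open>\<theta>\<close> induces the derivation
  \<open>residue \<alpha> f \<mapsto> residue \<alpha> (\<theta> f)\<close> of \<open>S/\<alpha>S\<close>; this derivation, as a map on cosets,
  is \<open>euler_restriction \<alpha> \<theta>\<close>.  The kernel of \<open>\<rho> : D(B) \<rightarrow> D(B\<^sup>H)\<close> consists
  of the \<open>\<theta>\<close> that induce the zero derivation.
\<close>

definition euler_restriction ::
    "('k::field, 'n::finite) mpoly \<Rightarrow> ('k, 'n) der \<Rightarrow> ('k, 'n) mpoly set \<Rightarrow> ('k, 'n) mpoly set" where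
  "euler_restriction \<alpha> \<theta> C = (\<Union>f\<in>C. residue \<alpha> (der_apply \<theta> f))"

definition ker_euler_restriction ::
    "('k::field ^ 'n::finite) set set \<Rightarrow> ('k, 'n) mpoly \<Rightarrow> ('k, 'n) der set" where
  "ker_euler_restriction B \<alpha> =
     {\<theta> \<in> log_der B. \<forall>f. euler_restriction \<alpha> \<theta> (residue \<alpha> f) = residue \<alpha> 0}"

end

theory Submission
  imports Defs
begin

text \<open>
  Write \<open>D\<close>, \<open>D1\<close>, \<open>D2\<close>, \<open>D12\<close> for the logarithmic derivations of \<open>\<A>\<close>, of the two deletions and
  of the double deletion. Linear forms are prime in \<open>S\<close> (\<open>linear_form_prime\<close>). Therefore
  a derivation is in \<open>D1\<close> if and only if \<open>\<alpha>1\<close> times it is in \<open>D\<close>, and \<open>D1/D\<close> is torsion-free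
  over \<open>S/\<alpha>1 S\<close>; likewise for every other deletion of one hyperplane
  (\<open>log_der_remove_iff\<close>, \<open>log_der_remove_torsion_free\<close>).

  By a comparison of Hilbert functions, the SPOG hypothesis gives \<open>D1 = D + S\<phi>1\<close> with \<open>\<phi>1\<close>
  of degree \<open>c1\<close>. The basis \<open>\<theta>\<close> of \<open>D\<close> and \<open>\<phi>1\<close> are minimal generators, and their only relation
  expresses \<open>\<alpha>1 \<phi>1\<close> by \<open>\<theta>\<close> with coefficients in the ideal \<open>\<mm>\<close> of the polynomials without
  constant term (\<open>SPOG_deletion\<close>). In the same way \<open>D2 = D + S\<phi>2\<close>.

  The kernel of the Euler restriction of \<open>D1\<close> is \<open>\<alpha>2 D12\<close> (\<open>ker_euler_restriction_eq\<close>), so the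
  cases ask whether \<open>\<phi>1\<close> is congruent modulo \<open>D\<close> to some \<open>\<alpha>2 \<psi>\<close>, and \<open>\<phi>2\<close> to some \<open>\<alpha>1 \<psi>\<close>, with
  \<open>\<psi>\<close> in \<open>D12\<close>. If such a \<open>\<psi>\<close> exists, multiplying an element of \<open>D12\<close> with the linear form,
  expanding it and dividing again shows that \<open>\<psi>\<close> generates \<open>D12\<close> over the other deletion
  (\<open>D12_generated_over_D2\<close>).

  \<^item> If \<open>\<phi>1\<close> is congruent to \<open>\<alpha>2 \<psi>\<close>, then \<open>\<alpha>1 \<psi>\<close> has degree \<open>c1 \<le> c2\<close>, which makes it congruent to
    a constant times \<open>\<phi>2\<close>. Thus \<open>D12 = D + S\<psi>\<close>, with one relation for \<open>\<alpha>1 \<alpha>2 \<psi>\<close>.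
  \<^item> If only \<open>\<phi>2\<close> is congruent to some \<open>\<alpha>1 \<psi>\<close>, then \<open>D12 = D + S\<phi>1 + S\<psi>\<close>, and besides the
    relation of \<open>\<phi>1\<close> there is an expansion of \<open>\<alpha>2 \<psi>\<close> by \<open>\<phi>1\<close> and \<open>\<theta>\<close>. If its coefficients are
    in \<open>\<mm>\<close>, the resolution is minimal with \<open>\<ell> + 2\<close> generators. Otherwise one element of \<open>\<theta>\<close>
    is superfluous. Its degree is \<open>c2\<close>, for which the relation of \<open>\<phi>1\<close> has no room, so that
    this relation remains as it is and \<open>\<ell> + 1\<close> generators are left.
  \<^item> If neither is, then \<open>\<theta>\<close>, \<open>\<phi>1\<close>, \<open>\<phi>2\<close> are linearly independent in \<open>D12/\<mm>D12\<close>
    (\<open>independent_mod\<close>): for \<open>x\<close> in \<open>D12\<close> the coefficients of \<open>\<alpha>2 x\<close> with respect to \<open>\<phi>1\<close>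
    and \<open>\<theta>\<close> are in \<open>\<mm>\<close>, so those of elements of \<open>\<mm>D12\<close> are in \<open>\<mm>\<^sup>2\<close>, whereas the multiples of
    \<open>\<theta>\<close> and \<open>\<phi>1\<close> with \<open>\<alpha>2\<close> have linear coefficients. By Nakayama's lemma, the bound \<open>\<ell> + 2\<close> on
    the number of generators leaves no room for anything beyond \<open>\<theta>\<close>, \<open>\<phi>1\<close>, \<open>\<phi>2\<close>, and
    \<open>D1 \<inter> D2 = D\<close> yields the relations.
\<close>

section \<open>The polynomial ring\<close>

abbreviation coef :: "('k::field, 'n::finite) mpoly \<Rightarrow> ('n \<Rightarrow>\<^sub>0 nat) \<Rightarrow> 'k" where
  "coef \<equiv> Poly_Mapping.lookup"

abbreviation const :: "'k::field \<Rightarrow> ('k, 'n::finite) mpoly" where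
  "const c \<equiv> Poly_Mapping.single 0 c"

definition var_exp :: "'n::finite \<Rightarrow> ('n \<Rightarrow>\<^sub>0 nat)" where
  "var_exp i = Poly_Mapping.single i 1"

abbreviation var :: "'n::finite \<Rightarrow> ('k::field, 'n) mpoly" where
  "var i \<equiv> Poly_Mapping.single (var_exp i) 1"

lemma lookup_var_exp [simp]: "Poly_Mapping.lookup (var_exp i) j = (if j = i then 1 else 0)"
  by (simp add: var_exp_def lookup_single when_def)

lemma var_exp_ne_0 [simp]: "var_exp i \<noteq> 0"
  by (metis lookup_var_exp lookup_zero one_neq_zero)

lemma var_exp_inject [simp]: "var_exp i = var_exp j \<longleftrightarrow> i = j"
  by (metis lookup_var_exp one_neq_zero)

lemma poly_eq_sum_monomials:
  "p = (\<Sum>m\<in>Poly_Mapping.keys p. Poly_Mapping.single m (Poly_Mapping.lookup p m))"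
  by (rule poly_mapping_eqI) (auto simp: lookup_sum lookup_single when_def in_keys_iff)

lemma poly_induct [case_names zero monomial add]:
  fixes p :: "('k::field, 'n::finite) mpoly"
  assumes "P 0" "\<And>m a. P (Poly_Mapping.single m a)" "\<And>p q. P p \<Longrightarrow> P q \<Longrightarrow> P (p + q)"
  shows "P p"
proof -
  have "P (\<Sum>m\<in>M. Poly_Mapping.single m (coef p m))" if "finite M" for M
    using that by (induction M) (auto intro: assms)
  then show ?thesis by (subst poly_eq_sum_monomials) simp
qed

lemma keys_ne: "p \<noteq> 0 \<Longrightarrow> Poly_Mapping.keys p \<noteq> {}"
  by (metis empty_iff lookup_zero not_in_keys_iff_lookup_eq_zero poly_mapping_eqI)

lemma coef_mult_keys:
  fixes p q :: "('k::field, 'n::finite) mpoly"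
  shows "coef (p * q) k =
    (\<Sum>m\<in>Poly_Mapping.keys p. \<Sum>n\<in>Poly_Mapping.keys q. (coef p m * coef q n when m + n = k))"
proof -
  have "p * q = (\<Sum>m\<in>Poly_Mapping.keys p. \<Sum>n\<in>Poly_Mapping.keys q.
          Poly_Mapping.single (m + n) (coef p m * coef q n))"
    by (subst poly_eq_sum_monomials[of p], subst poly_eq_sum_monomials[of q])
      (simp only: sum_product mult_single)
  then show ?thesis
    by (simp add: lookup_sum lookup_single)
qed

lemma coef_mult_unique:
  fixes p q :: "('k::field, 'n::finite) mpoly"
  assumes "\<And>m n. m \<in> Poly_Mapping.keys p \<Longrightarrow> n \<in> Poly_Mapping.keys q \<Longrightarrow> m + n = m0 + n0 \<Longrightarrow> m = m0 \<and> n = n0"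
  shows "coef (p * q) (m0 + n0) = coef p m0 * coef q n0"
proof -
  have "coef (p * q) (m0 + n0) =
    (\<Sum>m\<in>Poly_Mapping.keys p. \<Sum>n\<in>Poly_Mapping.keys q.
       if n = n0 then (if m = m0 then coef p m0 * coef q n0 else 0) else 0)"
    unfolding coef_mult_keys by (intro sum.cong refl) (use assms in \<open>auto simp: when_def\<close>)
  also have "\<dots> = coef p m0 * coef q n0"
  proof -
    have "(\<Sum>n\<in>Poly_Mapping.keys q. if n = n0 then (if m = m0 then coef p m0 * coef q n0 else 0) else 0)
        = (if m = m0 then coef p m0 * coef q n0 else 0)" for m
      by (simp add: in_keys_iff)
    then show ?thesis by (simp add: in_keys_iff)
  qed
  finally show ?thesis .
qed

text \<open>This sum plays the part of the leading monomial of a product. The two vectors are found by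
  restricting both sets to the vectors with the largest \<open>i\<close>-th coordinate, for one coordinate
  after the other, so that the index type \<open>'n\<close> can do without an order.\<close>

lemma exists_unique_sum:
  fixes P Q :: "('n::finite \<Rightarrow>\<^sub>0 nat) set"
  assumes "finite P" "P \<noteq> {}" "finite Q" "Q \<noteq> {}"
  shows "\<exists>p0\<in>P. \<exists>q0\<in>Q. \<forall>p\<in>P. \<forall>q\<in>Q. p + q = p0 + q0 \<longrightarrow> p = p0 \<and> q = q0"
proof -
  have "\<lbrakk>P \<noteq> {}; Q \<noteq> {}; finite P; finite Q;
      \<forall>p\<in>P. \<forall>p'\<in>P. \<forall>i. i \<notin> I \<longrightarrow> Poly_Mapping.lookup p i = Poly_Mapping.lookup p' i;
      \<forall>p\<in>Q. \<forall>p'\<in>Q. \<forall>i. i \<notin> I \<longrightarrow> Poly_Mapping.lookup p i = Poly_Mapping.lookup p' i\<rbrakk> \<Longrightarrow>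
      \<exists>p0\<in>P. \<exists>q0\<in>Q. \<forall>p\<in>P. \<forall>q\<in>Q. p + q = p0 + q0 \<longrightarrow> p = p0 \<and> q = q0"
    if "finite I" for I :: "'n set" and P Q :: "('n \<Rightarrow>\<^sub>0 nat) set"
    using that
  proof (induction I arbitrary: P Q)
    case empty
    have "p = p'" if "p \<in> P" "p' \<in> P" for p p'
      by (rule poly_mapping_eqI) (use empty.prems(5) that in blast)
    moreover have "p = p'" if "p \<in> Q" "p' \<in> Q" for p p'
      by (rule poly_mapping_eqI) (use empty.prems(6) that in blast)
    ultimately show ?case
      using empty.prems(1,2) by (metis all_not_in_conv)
  next
    case (insert i I)
    define top where "top P = {p \<in> P. \<forall>p'\<in>P. Poly_Mapping.lookup p' i \<le> Poly_Mapping.lookup p i}"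
      for P :: "('n \<Rightarrow>\<^sub>0 nat) set"
    have top_ne: "top P \<noteq> {}" if "finite P" "P \<noteq> {}" for P
    proof -
      let ?e = "Max ((\<lambda>p. Poly_Mapping.lookup p i) ` P)"
      have "?e \<in> (\<lambda>p. Poly_Mapping.lookup p i) ` P" using that by (intro Max_in) auto
      then obtain p where p: "p \<in> P" "Poly_Mapping.lookup p i = ?e" by auto
      have "p \<in> top P" unfolding top_def using p that by auto
      then show ?thesis by auto
    qed
    have agree: "\<forall>p\<in>top P. \<forall>p'\<in>top P. \<forall>j. j \<notin> I \<longrightarrow> Poly_Mapping.lookup p j = Poly_Mapping.lookup p' j"
      if "\<forall>p\<in>P. \<forall>p'\<in>P. \<forall>j. j \<notin> insert i I \<longrightarrow> Poly_Mapping.lookup p j = Poly_Mapping.lookup p' j" for P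
    proof (intro ballI allI impI)
      fix p p' j assume p: "p \<in> top P" "p' \<in> top P" and j: "j \<notin> I"
      show "Poly_Mapping.lookup p j = Poly_Mapping.lookup p' j"
      proof (cases "j = i")
        case True
        show ?thesis using p unfolding True top_def by (intro le_antisym) auto
      next
        case False
        then show ?thesis using that p j unfolding top_def by blast
      qed
    qed
    have fin: "finite (top P)" if "finite P" for P
      using that unfolding top_def by auto
    obtain p0 q0 where pq: "p0 \<in> top P" "q0 \<in> top Q"
      and uniq: "\<forall>p\<in>top P. \<forall>q\<in>top Q. p + q = p0 + q0 \<longrightarrow> p = p0 \<and> q = q0"
      using insert.IH[OF top_ne[OF insert.prems(3,1)] top_ne[OF insert.prems(4,2)] fin[OF insert.prems(3)]
          fin[OF insert.prems(4)] agree[OF insert.prems(5)] agree[OF insert.prems(6)]] by blast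
    have "p = p0 \<and> q = q0" if "p \<in> P" "q \<in> Q" "p + q = p0 + q0" for p q
    proof -
      have "Poly_Mapping.lookup p i + Poly_Mapping.lookup q i
          = Poly_Mapping.lookup p0 i + Poly_Mapping.lookup q0 i"
        using that(3) by (metis lookup_add)
      moreover have "Poly_Mapping.lookup p i \<le> Poly_Mapping.lookup p0 i" "Poly_Mapping.lookup q i \<le> Poly_Mapping.lookup q0 i"
        using pq that unfolding top_def by auto
      ultimately have "Poly_Mapping.lookup p i = Poly_Mapping.lookup p0 i" "Poly_Mapping.lookup q i = Poly_Mapping.lookup q0 i"
        by auto
      then have "p \<in> top P" "q \<in> top Q" using pq that unfolding top_def by auto
      then show ?thesis using uniq that by blast
    qed
    then show ?case using pq unfolding top_def by blast
  qed
  from this[of UNIV P Q] show ?thesis using assms by simp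
qed

lemma poly_mult_eq_0_iff:
  fixes p q :: "('k::field, 'n::finite) mpoly"
  shows "p * q = 0 \<longleftrightarrow> p = 0 \<or> q = 0"
proof (rule iffI, rule ccontr)
  assume pq: "p * q = 0" and "\<not> (p = 0 \<or> q = 0)"
  then have "Poly_Mapping.keys p \<noteq> {}" "Poly_Mapping.keys q \<noteq> {}"
    by (auto dest: keys_ne)
  then obtain m0 n0 where mn: "m0 \<in> Poly_Mapping.keys p" "n0 \<in> Poly_Mapping.keys q"
    and "\<forall>m\<in>Poly_Mapping.keys p. \<forall>n\<in>Poly_Mapping.keys q. m + n = m0 + n0 \<longrightarrow> m = m0 \<and> n = n0"
    using exists_unique_sum[of "Poly_Mapping.keys p" "Poly_Mapping.keys q"] by auto
  then have "coef (p * q) (m0 + n0) = coef p m0 * coef q n0" by (intro coef_mult_unique) auto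
  then show False using pq mn by (simp add: in_keys_iff)
qed auto

lemma exponent_sum_eq_0:
  fixes m n :: "'n::finite \<Rightarrow>\<^sub>0 nat"
  shows "m + n = 0 \<longleftrightarrow> m = 0 \<and> n = 0"
proof
  assume "m + n = 0"
  then have "Poly_Mapping.lookup (m + n) i = 0" for i by simp
  then have "Poly_Mapping.lookup m i + Poly_Mapping.lookup n i = 0" for i
    unfolding lookup_add .
  then show "m = 0 \<and> n = 0" by (auto intro!: poly_mapping_eqI)
qed auto

lemma exponent_sum_eq_var_exp:
  fixes m n :: "'n::finite \<Rightarrow>\<^sub>0 nat"
  assumes "m + n = var_exp i"
  shows "m = 0 \<and> n = var_exp i \<or> m = var_exp i \<and> n = 0"
proof -
  have *: "Poly_Mapping.lookup m j + Poly_Mapping.lookup n j = (if j = i then 1 else 0)" for j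
    using arg_cong[OF assms, of "\<lambda>e. Poly_Mapping.lookup e j"]
    by (auto simp: lookup_add lookup_single when_def)
  show ?thesis
  proof (cases "Poly_Mapping.lookup m i = 0")
    case True
    have "m = 0"
    proof (rule poly_mapping_eqI)
      fix j show "Poly_Mapping.lookup m j = Poly_Mapping.lookup 0 j"
        using *[of j] True by (auto split: if_splits)
    qed
    then show ?thesis using assms by simp
  next
    case False
    have "n = 0"
    proof (rule poly_mapping_eqI)
      fix j show "Poly_Mapping.lookup n j = Poly_Mapping.lookup 0 j"
        using *[of j] *[of i] False by (auto split: if_splits)
    qed
    then show ?thesis using assms by simp
  qed
qed

lemma coef_0_mult [simp]:
  fixes p q :: "('k::field, 'n::finite) mpoly"
  shows "coef (p * q) 0 = coef p 0 * coef q 0"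
  using coef_mult_unique[of p q 0 0] by (simp add: exponent_sum_eq_0)

lemma coef_const_mult [simp]:
  fixes p :: "('k::field, 'n::finite) mpoly"
  shows "coef (const a * p) m = a * coef p m"
proof -
  have "coef (const a * p) (0 + m) = coef (const a :: ('k, 'n) mpoly) 0 * coef p m"
    by (intro coef_mult_unique) (auto split: if_splits)
  then show ?thesis by simp
qed

lemma coef_var_exp_mult:
  fixes p q :: "('k::field, 'n::finite) mpoly"
  shows "coef (p * q) (var_exp i) = coef p 0 * coef q (var_exp i) + coef p (var_exp i) * coef q 0"
proof -
  define p' where "p' = p - const (coef p 0)"
  define q' where "q' = q - const (coef q 0)"
  have c: "coef p' 0 = 0" "coef q' 0 = 0" by (auto simp: p'_def q'_def lookup_minus)
  have "(coef p' m * coef q' n when m + n = var_exp i) = 0" for m n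
    using exponent_sum_eq_var_exp[of m n i] c by (auto simp: when_def)
  then have 0: "coef (p' * q') (var_exp i) = 0"
    by (simp add: coef_mult_keys)
  have "p * q = p' * q' + const (coef p 0) * q' + const (coef q 0) * p' + const (coef p 0) * const (coef q 0)"
    by (simp add: p'_def q'_def algebra_simps)
  also have "coef \<dots> (var_exp i) = coef p 0 * coef q' (var_exp i) + coef q 0 * coef p' (var_exp i)"
    by (simp add: lookup_add 0 mult_single lookup_single when_def)
  also have "\<dots> = coef p 0 * coef q (var_exp i) + coef q 0 * coef p (var_exp i)"
    by (simp add: p'_def q'_def lookup_minus lookup_single when_def)
  finally show ?thesis by (simp add: algebra_simps)
qed


subsection \<open>Homogeneous components\<close>

lemma mon_deg_add: "mon_deg (m + n) = mon_deg m + mon_deg n"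
  by (simp add: mon_deg_def lookup_add sum.distrib)

lemma mon_deg_0 [simp]: "mon_deg 0 = 0"
  by (simp add: mon_deg_def)

lemma mon_deg_var_exp [simp]: "mon_deg (var_exp i) = 1"
  by (simp add: mon_deg_def)

lemma mon_deg_eq_0_iff: "mon_deg m = 0 \<longleftrightarrow> m = 0"
  unfolding mon_deg_def by (auto intro!: poly_mapping_eqI)

lemma mon_deg_eq_1:
  assumes "mon_deg m = 1"
  shows "\<exists>i. m = var_exp i"
proof -
  obtain i where "Poly_Mapping.lookup m i = 1" "\<forall>j. j \<noteq> i \<longrightarrow> Poly_Mapping.lookup m j = 0"
    using assms unfolding mon_deg_def by (metis UNIV_I finite_class.finite_UNIV sum_eq_1_iff)
  then have "m = var_exp i"
    by (intro poly_mapping_eqI) (auto simp: lookup_single when_def)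
  then show ?thesis by blast
qed

lemma homogeneous_coef: "homogeneous d p \<Longrightarrow> int (mon_deg m) \<noteq> d \<Longrightarrow> coef p m = 0"
  unfolding homogeneous_def by (meson not_in_keys_iff_lookup_eq_zero)

lemma homogeneousI: "(\<And>m. int (mon_deg m) \<noteq> d \<Longrightarrow> coef p m = 0) \<Longrightarrow> homogeneous d p"
  unfolding homogeneous_def by (auto simp: in_keys_iff)

lemma homogeneous_0 [simp]: "homogeneous d 0"
  by (simp add: homogeneous_def)

lemma homogeneous_uminus: "homogeneous d p \<Longrightarrow> homogeneous d (- p)"
  by (rule homogeneousI) (simp add: homogeneous_coef)

lemma homogeneous_diff: "homogeneous d p \<Longrightarrow> homogeneous d q \<Longrightarrow> homogeneous d (p - q)"
  by (rule homogeneousI) (simp add: lookup_minus homogeneous_coef)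

lemma homogeneous_single: "homogeneous (int (mon_deg m)) (Poly_Mapping.single m a)"
  by (simp add: homogeneous_def)

lemma homogeneous_const: "homogeneous 0 (const a)"
  by (simp add: homogeneous_def)

lemma homogeneous_mult:
  fixes p q :: "('k::field, 'n::finite) mpoly"
  assumes "homogeneous d p" "homogeneous e q"
  shows "homogeneous (d + e) (p * q)"
  unfolding homogeneous_def
proof
  fix m assume "m \<in> Poly_Mapping.keys (p * q)"
  then obtain a b where "m = a + b" "a \<in> Poly_Mapping.keys p" "b \<in> Poly_Mapping.keys q"
    using keys_mult[of p q] by auto
  then show "int (mon_deg m) = d + e" using assms by (auto simp: homogeneous_def mon_deg_add)
qed

lemma homogeneous_negative: "homogeneous d p \<Longrightarrow> d < 0 \<Longrightarrow> p = 0"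
  by (rule poly_mapping_eqI) (simp add: homogeneous_coef)

lemma homogeneous_deg_0: "homogeneous 0 p \<Longrightarrow> p = const (coef p 0)"
  by (rule poly_mapping_eqI) (auto simp: lookup_single when_def homogeneous_coef mon_deg_eq_0_iff)

lemma homogeneous_coef_0: "homogeneous d p \<Longrightarrow> d \<noteq> 0 \<Longrightarrow> coef p 0 = 0"
  by (simp add: homogeneous_coef)

lemma homogeneous_nonpositive:
  assumes "homogeneous d p" "d \<le> 0" "coef p 0 = 0"
  shows "p = 0"
proof (cases "d = 0")
  case True then show ?thesis using homogeneous_deg_0 assms by fastforce
next
  case False then show ?thesis using homogeneous_negative assms by force
qed

definition hcomp :: "int \<Rightarrow> ('k::field, 'n::finite) mpoly \<Rightarrow> ('k, 'n) mpoly" where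
  "hcomp d p = (\<Sum>m\<in>{m \<in> Poly_Mapping.keys p. int (mon_deg m) = d}. Poly_Mapping.single m (coef p m))"

lemma coef_hcomp [simp]: "coef (hcomp d p) m = (if int (mon_deg m) = d then coef p m else 0)"
  unfolding hcomp_def by (auto simp: lookup_sum lookup_single when_def in_keys_iff)

lemma homogeneous_hcomp: "homogeneous d (hcomp d p)"
  by (rule homogeneousI) simp

lemma hcomp_add: "hcomp d (p + q) = hcomp d p + hcomp d q"
  by (rule poly_mapping_eqI) (simp add: lookup_add)

lemma hcomp_0 [simp]: "hcomp d 0 = 0"
  by (rule poly_mapping_eqI) simp

lemma hcomp_sum: "hcomp d (sum f I) = (\<Sum>i\<in>I. hcomp d (f i))"
  by (induction I rule: infinite_finite_induct) (auto simp: hcomp_add)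

lemma hcomp_homogeneous: "homogeneous d p \<Longrightarrow> hcomp e p = (if e = d then p else 0)"
  by (rule poly_mapping_eqI) (auto simp: homogeneous_coef)

lemma hcomp_mult_homogeneous:
  fixes p q :: "('k::field, 'n::finite) mpoly"
  assumes "homogeneous a p"
  shows "hcomp d (p * q) = p * hcomp (d - a) q"
proof (induction q rule: poly_induct)
  case (monomial m b)
  have "homogeneous (a + int (mon_deg m)) (p * Poly_Mapping.single m b)"
    by (intro homogeneous_mult assms homogeneous_single)
  then show ?case
    by (auto simp: hcomp_homogeneous[OF homogeneous_single] hcomp_homogeneous)
qed (auto simp: hcomp_add algebra_simps)

lemma sum_hcomp: "p = (\<Sum>d\<in>(\<lambda>m. int (mon_deg m)) ` Poly_Mapping.keys p. hcomp d p)"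
proof (rule poly_mapping_eqI)
  fix m
  show "coef p m = coef (\<Sum>d\<in>(\<lambda>m. int (mon_deg m)) ` Poly_Mapping.keys p. hcomp d p) m"
    by (auto simp: lookup_sum in_keys_iff)
qed


subsection \<open>Linear forms are prime\<close>

lemma homogeneous_1_expansion:
  fixes \<alpha> :: "('k::field, 'n::finite) mpoly"
  assumes "homogeneous 1 \<alpha>"
  shows "\<alpha> = (\<Sum>i\<in>UNIV. const (coef \<alpha> (var_exp i)) * var i)"
proof (rule poly_mapping_eqI)
  fix m
  show "coef \<alpha> m = coef (\<Sum>i\<in>UNIV. const (coef \<alpha> (var_exp i)) * var i) m"
  proof (cases "mon_deg m = 1")
    case True
    then obtain j where m: "m = var_exp j" using mon_deg_eq_1 by blast
    have "(\<Sum>i\<in>UNIV. coef (Poly_Mapping.single (var_exp i) (coef \<alpha> (var_exp i))) (var_exp j))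
        = (\<Sum>i\<in>UNIV. if i = j then coef \<alpha> (var_exp i) else 0)"
      by (intro sum.cong refl) (auto simp: lookup_single when_def)
    then show ?thesis by (simp add: lookup_sum mult_single m)
  next
    case False
    then have "m \<noteq> var_exp i" for i by auto
    then have "var_exp i \<noteq> m" for i by metis
    then show ?thesis using False assms
      by (simp add: lookup_sum mult_single lookup_single when_def homogeneous_coef)
  qed
qed

lemma linear_form_coef: "linear_form \<alpha> \<Longrightarrow> \<exists>k. coef \<alpha> (var_exp k) \<noteq> 0"
proof (rule ccontr)
  assume \<alpha>: "linear_form \<alpha>" and "\<not> (\<exists>k. coef \<alpha> (var_exp k) \<noteq> 0)"
  then have "(\<Sum>i\<in>UNIV. const (coef \<alpha> (var_exp i)) * var i) = 0" by simp
  then show False using \<alpha> homogeneous_1_expansion[of \<alpha>] unfolding linear_form_def by metis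
qed

definition free_of :: "'n::finite \<Rightarrow> ('k::field, 'n) mpoly \<Rightarrow> bool" where
  "free_of k p \<longleftrightarrow> (\<forall>m. Poly_Mapping.lookup m k \<noteq> 0 \<longrightarrow> coef p m = 0)"

lemma free_of_add: "free_of k p \<Longrightarrow> free_of k q \<Longrightarrow> free_of k (p + q)"
  by (simp add: free_of_def lookup_add)

lemma free_of_hcomp: "free_of k p \<Longrightarrow> free_of k (hcomp d p)"
  by (simp add: free_of_def)

lemma free_of_mult:
  fixes p q :: "('k::field, 'n::finite) mpoly"
  assumes "free_of k p" "free_of k q"
  shows "free_of k (p * q)"
proof -
  have "m \<notin> Poly_Mapping.keys (p * q)" if m: "Poly_Mapping.lookup m k \<noteq> 0" for m
  proof
    assume "m \<in> Poly_Mapping.keys (p * q)"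
    then obtain a b where "m = a + b" "a \<in> Poly_Mapping.keys p" "b \<in> Poly_Mapping.keys q"
      using keys_mult[of p q] by auto
    then show False using assms m by (auto simp: free_of_def in_keys_iff lookup_add)
  qed
  then show ?thesis by (simp add: free_of_def in_keys_iff)
qed

lemma free_of_single: "Poly_Mapping.lookup m k = 0 \<Longrightarrow> free_of k (Poly_Mapping.single m a)"
  by (auto simp: free_of_def lookup_single when_def)

lemma free_of_sum: "(\<And>i. i \<in> I \<Longrightarrow> free_of k (f i)) \<Longrightarrow> free_of k (sum f I)"
proof (induction I rule: infinite_finite_induct)
  case (insert i I)
  then show ?case using free_of_add[of k "f i" "sum f I"] by simp
qed (auto simp: free_of_def)

lemma monomial_eq_prod:
  fixes m :: "'n::finite \<Rightarrow>\<^sub>0 nat"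
  assumes "m \<noteq> 0"
  obtains i m' where "m = var_exp i + m'"
proof -
  obtain i where i: "Poly_Mapping.lookup m i \<noteq> 0"
    using assms by (metis lookup_zero poly_mapping_eqI)
  have "m = var_exp i + (m - var_exp i)"
    by (rule poly_mapping_eqI) (use i in \<open>auto simp: lookup_add lookup_minus lookup_single when_def\<close>)
  then show ?thesis using that by blast
qed

text \<open>If the variable \<open>k\<close> occurs in \<open>\<alpha>\<close>, the monomials without it represent a basis of
  \<open>S/\<alpha>S\<close>. They span, since \<open>\<alpha> = 0\<close> can be solved for this variable; they are independent,
  since a multiple of \<open>\<alpha>\<close> involves one more power of it than the cofactor. So \<open>S/\<alpha>S\<close> is a
  polynomial ring in the remaining variables and \<open>\<alpha>\<close> is prime.\<close>

lemma division_by_linear_form: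
  fixes \<alpha> f :: "('k::field, 'n::finite) mpoly"
  assumes "homogeneous 1 \<alpha>" and k: "coef \<alpha> (var_exp k) \<noteq> 0"
  shows "\<exists>r t. free_of k r \<and> f = r + \<alpha> * t"
proof (induction f rule: poly_induct)
  case zero
  show ?case by (rule exI[of _ 0], rule exI[of _ 0]) (simp add: free_of_def)
next
  case (add p q)
  then obtain r t r' t' where "free_of k r" "p = r + \<alpha> * t" "free_of k r'" "q = r' + \<alpha> * t'" by auto
  then have "free_of k (r + r')" "p + q = (r + r') + \<alpha> * (t + t')"
    by (auto intro: free_of_add simp: algebra_simps)
  then show ?case by blast
next
  case (monomial m a)
  let ?a = "\<lambda>i. coef \<alpha> (var_exp i)"
  have var: "\<exists>r t. free_of k r \<and> (var i :: ('k, 'n) mpoly) = r + \<alpha> * t" for i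
  proof (cases "i = k")
    case False
    then have "free_of k (var i)" "(var i :: ('k, 'n) mpoly) = var i + \<alpha> * 0"
      by (auto intro!: free_of_single simp: lookup_single)
    then show ?thesis by blast
  next
    case True
    let ?R = "\<Sum>j\<in>UNIV - {k}. const (?a j) * (var j :: ('k, 'n) mpoly)"
    let ?r = "- ?R"
    have "(\<Sum>j\<in>UNIV. const (?a j) * var j) = const (?a k) * (var k :: ('k, 'n) mpoly) + ?R"
      by (rule sum.remove) auto
    with homogeneous_1_expansion[OF assms(1)] have "\<alpha> = const (?a k) * var k + ?R"
      by (rule trans)
    then have "\<alpha> - ?R = const (?a k) * var k"
      by (rule iffD2[OF diff_eq_eq])
    then have "const (inverse (?a k)) * (\<alpha> - ?R) = (const (inverse (?a k)) * const (?a k)) * var k"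
      by (simp only: mult.assoc)
    then have "const (inverse (?a k)) * (\<alpha> - ?R) = var k"
      using k by (simp add: mult_single)
    then have eq: "var k = const (inverse (?a k)) * ?r + \<alpha> * const (inverse (?a k))"
      by (simp add: algebra_simps)
    have "free_of k (\<Sum>j\<in>UNIV - {k}. const (?a j) * var j)"
      by (intro free_of_sum free_of_mult free_of_single) (auto simp: lookup_single)
    then have "free_of k ?r" by (simp add: free_of_def)
    then have "free_of k (const (inverse (?a k)) * ?r)"
      by (intro free_of_mult free_of_single) auto
    then show ?thesis using eq True by blast
  qed
  show ?case
  proof (induction "mon_deg m" arbitrary: m a)
    case 0
    then have "m = 0" by (metis mon_deg_eq_0_iff)
    then have "free_of k (Poly_Mapping.single m a)" "Poly_Mapping.single m a = Poly_Mapping.single m a + \<alpha> * 0"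
      by (auto intro!: free_of_single)
    then show ?case by blast
  next
    case (Suc d)
    then have "m \<noteq> 0" by (metis mon_deg_0 nat.distinct(1))
    then obtain i m' where m: "m = var_exp i + m'" by (rule monomial_eq_prod)
    then have "mon_deg m' = d" using Suc.hyps(2) by (simp add: mon_deg_add)
    then obtain r t where r: "free_of k r" "Poly_Mapping.single m' a = r + \<alpha> * t"
      using Suc.hyps(1) by blast
    obtain r' t' where r': "free_of k r'" "(var i :: ('k, 'n) mpoly) = r' + \<alpha> * t'"
      using var by blast
    have "Poly_Mapping.single m a = var i * Poly_Mapping.single m' a"
      by (simp add: mult_single m)
    also have "\<dots> = r' * r + \<alpha> * (t' * r + r' * t + \<alpha> * t * t')"
      by (simp add: r r' algebra_simps)
    finally show ?case using free_of_mult[OF r'(1) r(1)] by blast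
  qed
qed

lemma linear_form_dvd_free_of:
  fixes \<alpha> s :: "('k::field, 'n::finite) mpoly"
  assumes "homogeneous 1 \<alpha>" and k: "coef \<alpha> (var_exp k) \<noteq> 0" and fr: "free_of k (\<alpha> * s)"
  shows "s = 0"
proof (rule ccontr)
  assume "s \<noteq> 0"
  then have ne: "Poly_Mapping.keys s \<noteq> {}" by (rule keys_ne)
  let ?e = "Max ((\<lambda>p. Poly_Mapping.lookup p k) ` Poly_Mapping.keys s)"
  have "?e \<in> (\<lambda>p. Poly_Mapping.lookup p k) ` Poly_Mapping.keys s" using ne by (intro Max_in) auto
  then obtain m where m: "m \<in> Poly_Mapping.keys s" "Poly_Mapping.lookup m k = ?e" by auto
  have max: "Poly_Mapping.lookup n k \<le> Poly_Mapping.lookup m k" if "n \<in> Poly_Mapping.keys s" for n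
    unfolding m(2) using that by (intro Max_ge) auto
  have "coef (\<alpha> * s) (var_exp k + m) = coef \<alpha> (var_exp k) * coef s m"
  proof (rule coef_mult_unique)
    fix n n' assume n: "n \<in> Poly_Mapping.keys \<alpha>" "n' \<in> Poly_Mapping.keys s" "n + n' = var_exp k + m"
    then have "mon_deg n = 1" using assms(1) by (auto simp: homogeneous_def)
    then obtain i where i: "n = var_exp i" using mon_deg_eq_1 by blast
    have "Poly_Mapping.lookup n k + Poly_Mapping.lookup n' k = 1 + Poly_Mapping.lookup m k"
      using n(3) using arg_cong[OF n(3), of "\<lambda>e. Poly_Mapping.lookup e k"] unfolding lookup_add by simp
    then have "i = k" using max[OF n(2)] i by (cases "i = k") auto
    then show "n = var_exp k \<and> n' = m" using n(3) i by auto
  qed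
  then have "coef (\<alpha> * s) (var_exp k + m) \<noteq> 0" using k m by (auto simp: in_keys_iff)
  moreover have "Poly_Mapping.lookup (var_exp k + m) k \<noteq> 0" by (simp add: lookup_add)
  ultimately show False using fr unfolding free_of_def by blast
qed

lemma linear_form_dvd_free_of_eq_0:
  assumes "homogeneous 1 \<alpha>" "coef \<alpha> (var_exp k) \<noteq> 0" "free_of k r" "\<alpha> dvd r"
  shows "r = 0"
proof -
  obtain s where "r = \<alpha> * s" using assms(4) by (rule dvdE)
  then show ?thesis using linear_form_dvd_free_of[OF assms(1,2), of s] assms(3) by simp
qed

lemma linear_form_prime:
  fixes \<alpha> f g :: "('k::field, 'n::finite) mpoly"
  assumes "linear_form \<alpha>" "\<alpha> dvd f * g"
  shows "\<alpha> dvd f \<or> \<alpha> dvd g"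
proof -
  obtain k where k: "homogeneous 1 \<alpha>" "coef \<alpha> (var_exp k) \<noteq> 0"
    using assms(1) linear_form_coef unfolding linear_form_def by blast
  obtain r t where r: "free_of k r" "f = r + \<alpha> * t" using division_by_linear_form[OF k] by blast
  obtain r' t' where r': "free_of k r'" "g = r' + \<alpha> * t'" using division_by_linear_form[OF k] by blast
  have "r * r' = f * g - \<alpha> * (t * r' + r * t' + \<alpha> * t * t')" by (simp add: r r' algebra_simps)
  then have "\<alpha> dvd r * r'" using assms(2) by (metis dvd_diff dvd_triv_left)
  then have "r * r' = 0" using linear_form_dvd_free_of_eq_0[OF k free_of_mult] r r' by blast
  then have "r = 0 \<or> r' = 0" by (simp add: poly_mult_eq_0_iff)
  then show ?thesis using r r' by auto
qed


section \<open>Logarithmic derivations\<close>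

lemma smult_smult_commute:
  fixes a b :: "('k::field, 'n::finite) mpoly" and x :: "('k, 'n) der"
  shows "a *s (b *s x) = b *s (a *s x)"
  by (simp add: vector_smult_assoc mult.commute)

definition dcomp :: "int \<Rightarrow> ('k::field, 'n::finite) der \<Rightarrow> ('k, 'n) der" where
  "dcomp d x = (\<chi> i. hcomp d (x $ i))"

lemma dcomp_component [simp]: "dcomp d x $ i = hcomp d (x $ i)"
  by (simp add: dcomp_def)

lemma dcomp_0 [simp]: "dcomp d 0 = 0"
  by (simp add: vec_eq_iff)

lemma dcomp_add: "dcomp d (x + y) = dcomp d x + dcomp d y"
  by (simp add: vec_eq_iff hcomp_add)

lemma dcomp_sum: "dcomp d (sum f I) = (\<Sum>i\<in>I. dcomp d (f i))"
  by (induction I rule: infinite_finite_induct) (auto simp: dcomp_add)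

lemma hom_der_dcomp: "hom_der d (dcomp d x)"
  by (simp add: hom_der_def homogeneous_hcomp)

lemma hom_der_negative: "hom_der d x \<Longrightarrow> d < 0 \<Longrightarrow> x = 0"
  by (auto simp: hom_der_def vec_eq_iff intro: homogeneous_negative)

lemma hom_der_smult: "homogeneous a p \<Longrightarrow> hom_der d x \<Longrightarrow> hom_der (a + d) (p *s x)"
  by (simp add: hom_der_def homogeneous_mult)

lemma dcomp_hom_der: "hom_der d x \<Longrightarrow> dcomp e x = (if e = d then x else 0)"
  by (auto simp: hom_der_def vec_eq_iff simp del: if_split intro: hcomp_homogeneous[THEN trans])

lemma dcomp_smult_homogeneous: "homogeneous a p \<Longrightarrow> dcomp d (p *s x) = p *s dcomp (d - a) x"
  by (simp add: vec_eq_iff hcomp_mult_homogeneous)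

lemma dcomp_smult_hom_der: "hom_der a x \<Longrightarrow> dcomp d (p *s x) = hcomp (d - a) p *s x"
  by (simp add: vec_eq_iff hom_der_def hcomp_mult_homogeneous mult.commute[of _ "x $ _"])

lemma mem_of_dcomp_mem:
  fixes x :: "('k::field, 'n::finite) der"
  assumes "\<And>d. dcomp d x \<in> M" "0 \<in> M" "\<And>y z. y \<in> M \<Longrightarrow> z \<in> M \<Longrightarrow> y + z \<in> M"
  shows "x \<in> M"
proof -
  define E where "E = (\<Union>i. (\<lambda>m. int (mon_deg m)) ` Poly_Mapping.keys (x $ i))"
  have fin: "finite E" by (simp add: E_def)
  have "x = (\<Sum>d\<in>E. dcomp d x)"
  proof (subst vec_eq_iff, rule allI)
    fix i
    have "x $ i = (\<Sum>d\<in>(\<lambda>m. int (mon_deg m)) ` Poly_Mapping.keys (x $ i). hcomp d (x $ i))"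
      by (rule sum_hcomp)
    also have "\<dots> = (\<Sum>d\<in>E. hcomp d (x $ i))"
    proof (rule sum.mono_neutral_left[OF fin])
      show "\<forall>d\<in>E - (\<lambda>m. int (mon_deg m)) ` Poly_Mapping.keys (x $ i). hcomp d (x $ i) = 0"
        by (auto intro!: poly_mapping_eqI) (metis image_eqI in_keys_iff)
    qed (auto simp: E_def)
    finally show "x $ i = (\<Sum>d\<in>E. dcomp d x) $ i" by (simp add: sum_component)
  qed
  moreover have "(\<Sum>d\<in>E. dcomp d x) \<in> M"
    using fin by (induction E) (auto intro: assms)
  ultimately show ?thesis by (rule ssubst)
qed


subsection \<open>Values on linear forms\<close>

lemma der_apply_0 [simp]: "der_apply 0 f = 0"
  by (simp add: der_apply_def)

lemma der_apply_add: "der_apply (x + y) f = der_apply x f + der_apply y f"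
  by (simp add: der_apply_def sum.distrib algebra_simps)

lemma der_apply_smult: "der_apply (a *s x) f = a * der_apply x f"
  by (simp add: der_apply_def sum_distrib_left mult.assoc)

lemma partial_linear:
  fixes \<alpha> :: "('k::field, 'n::finite) mpoly"
  assumes "homogeneous 1 \<alpha>"
  shows "partial i \<alpha> = const (coef \<alpha> (var_exp i))"
proof -
  have "partial i \<alpha> = (\<Sum>m\<in>Poly_Mapping.keys \<alpha>. if m = var_exp i then const (coef \<alpha> (var_exp i)) else 0)"
    unfolding partial_def
  proof (rule sum.cong[OF refl])
    fix m assume "m \<in> Poly_Mapping.keys \<alpha>"
    then have "mon_deg m = 1" using assms by (auto simp: homogeneous_def)
    then obtain j where j: "m = var_exp j" using mon_deg_eq_1 by blast
    show "Poly_Mapping.single (m - Poly_Mapping.single i 1) (of_nat (Poly_Mapping.lookup m i) * coef \<alpha> m)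
      = (if m = var_exp i then const (coef \<alpha> (var_exp i)) else 0)"
      unfolding j var_exp_def[symmetric] by simp
  qed
  also have "\<dots> = const (coef \<alpha> (var_exp i))"
    by (simp add: in_keys_iff)
  finally show ?thesis .
qed

lemma der_apply_linear:
  "homogeneous 1 \<alpha> \<Longrightarrow> der_apply x \<alpha> = (\<Sum>i\<in>UNIV. x $ i * const (coef \<alpha> (var_exp i)))"
  by (simp add: der_apply_def partial_linear)

lemma der_apply_var:
  fixes x :: "('k::field, 'n::finite) der"
  shows "der_apply x (var i) = x $ i"
proof -
  have h: "homogeneous 1 (var i :: ('k, 'n) mpoly)"
    by (metis homogeneous_single mon_deg_var_exp of_nat_1)
  have "der_apply x (var i) = (\<Sum>j\<in>UNIV. if j = i then x $ i else 0)"
    unfolding der_apply_linear[OF h]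
    by (intro sum.cong refl) (auto simp: lookup_single when_def)
  then show ?thesis by simp
qed

lemma hcomp_der_apply:
  fixes x :: "('k::field, 'n::finite) der"
  assumes "homogeneous 1 \<alpha>"
  shows "hcomp d (der_apply x \<alpha>) = der_apply (dcomp d x) \<alpha>"
proof -
  have "hcomp d (p * const c) = hcomp d p * const c" for p :: "('k, 'n) mpoly" and c
    using hcomp_mult_homogeneous[OF homogeneous_const, of d c p] by (simp add: mult.commute)
  then show ?thesis by (simp add: der_apply_linear[OF assms] hcomp_sum)
qed


subsection \<open>Hyperplanes and their linear forms\<close>

lemma linear_eqI:
  assumes "homogeneous 1 \<alpha>" "homogeneous 1 \<beta>" "\<And>i. coef \<alpha> (var_exp i) = coef \<beta> (var_exp i)"
  shows "\<alpha> = \<beta>"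
proof (rule poly_mapping_eqI)
  fix m show "coef \<alpha> m = coef \<beta> m"
  proof (cases "mon_deg m = 1")
    case True
    then obtain i where "m = var_exp i" using mon_deg_eq_1 by blast
    then show ?thesis using assms(3) by simp
  next
    case False then show ?thesis using assms(1,2) homogeneous_coef by (metis of_nat_eq_1_iff)
  qed
qed

lemma homogeneous_const_mult: "homogeneous d p \<Longrightarrow> homogeneous d (const c * p)"
  by (rule homogeneousI) (simp add: homogeneous_coef)

lemma poly_eval_linear:
  fixes \<alpha> :: "('k::field, 'n::finite) mpoly"
  assumes "homogeneous 1 \<alpha>"
  shows "poly_eval \<alpha> v = (\<Sum>i\<in>UNIV. coef \<alpha> (var_exp i) * v $ i)"
proof -
  let ?g = "\<lambda>m. coef \<alpha> m * (\<Prod>i\<in>UNIV. (v $ i) ^ Poly_Mapping.lookup m i)"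
  have "poly_eval \<alpha> v = (\<Sum>m\<in>range var_exp. ?g m)"
    unfolding poly_eval_def
  proof (rule sum.mono_neutral_left)
    show "Poly_Mapping.keys \<alpha> \<subseteq> range var_exp"
    proof
      fix m assume "m \<in> Poly_Mapping.keys \<alpha>"
      then have "mon_deg m = 1" using assms by (auto simp: homogeneous_def)
      then show "m \<in> range var_exp" using mon_deg_eq_1 by blast
    qed
  qed (auto simp: in_keys_iff)
  also have "\<dots> = (\<Sum>i\<in>UNIV. ?g (var_exp i))"
    by (rule sum.reindex_cong[of var_exp]) (auto simp: inj_on_def)
  also have "\<dots> = (\<Sum>i\<in>UNIV. coef \<alpha> (var_exp i) * v $ i)"
  proof (rule sum.cong[OF refl])
    fix i
    have "(\<Prod>j\<in>UNIV. (v $ j) ^ Poly_Mapping.lookup (var_exp i) j) = (\<Prod>j\<in>UNIV. if j = i then v $ i else 1)"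
      by (intro prod.cong) auto
    then show "?g (var_exp i) = coef \<alpha> (var_exp i) * v $ i" by simp
  qed
  finally show ?thesis .
qed

lemma same_kernel_proportional:
  fixes \<alpha> \<beta> :: "('k::field, 'n::finite) mpoly"
  assumes "linear_form \<alpha>" "linear_form \<beta>" "ker_form \<alpha> = ker_form \<beta>"
  obtains c where "c \<noteq> 0" "\<beta> = const c * \<alpha>"
proof -
  let ?a = "\<lambda>i. coef \<alpha> (var_exp i)" and ?b = "\<lambda>i. coef \<beta> (var_exp i)"
  have h: "homogeneous 1 \<alpha>" "homogeneous 1 \<beta>" using assms by (auto simp: linear_form_def)
  obtain k where k: "?a k \<noteq> 0" using linear_form_coef assms(1) by blast
  have "?b j * ?a k = ?b k * ?a j" for j
  proof (cases "j = k")
    case False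
    define v :: "'k ^ 'n" where "v = (\<chi> i. if i = j then ?a k else if i = k then - ?a j else 0)"
    have ev: "poly_eval \<gamma> v = coef \<gamma> (var_exp j) * ?a k - coef \<gamma> (var_exp k) * ?a j"
      if "homogeneous 1 \<gamma>" for \<gamma> :: "('k, 'n) mpoly"
    proof -
      have "poly_eval \<gamma> v = (\<Sum>i\<in>UNIV. (if i = j then coef \<gamma> (var_exp j) * ?a k else 0)
           + (if i = k then - (coef \<gamma> (var_exp k) * ?a j) else 0))"
        unfolding poly_eval_linear[OF that] using False by (intro sum.cong refl) (auto simp: v_def)
      then show ?thesis by (simp add: sum.distrib)
    qed
    have "v \<in> ker_form \<alpha>" by (simp add: ker_form_def ev[OF h(1)] mult.commute)
    then have "v \<in> ker_form \<beta>" using assms(3) by simp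
    then show ?thesis by (simp add: ker_form_def ev[OF h(2)])
  qed auto
  then have "?b j = ?b k / ?a k * ?a j" for j using k by (simp add: field_simps)
  then obtain c where c: "\<And>j. ?b j = c * ?a j" by blast
  have eq: "\<beta> = const c * \<alpha>"
    by (intro linear_eqI h homogeneous_const_mult) (simp add: c)
  moreover have "c \<noteq> 0" using c linear_form_coef[OF assms(2)] by auto
  ultimately show ?thesis by (intro that)
qed

lemma same_kernel_dvd:
  fixes \<alpha> \<beta> :: "('k::field, 'n::finite) mpoly"
  assumes "linear_form \<alpha>" "linear_form \<beta>" "ker_form \<alpha> = ker_form \<beta>"
  shows "\<alpha> dvd \<beta>"
  using same_kernel_proportional[OF assms] by (metis dvd_triv_right)

lemma ker_form_const_mult:
  fixes \<alpha> \<beta> :: "('k::field, 'n::finite) mpoly"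
  assumes "homogeneous 1 \<alpha>" "homogeneous 1 \<beta>" "c \<noteq> 0" "\<And>i. coef \<beta> (var_exp i) = c * coef \<alpha> (var_exp i)"
  shows "ker_form \<beta> = ker_form \<alpha>"
proof -
  have "poly_eval \<beta> v = c * poly_eval \<alpha> v" for v
    by (simp add: poly_eval_linear assms sum_distrib_left mult.assoc)
  then show ?thesis using assms(3) by (simp add: ker_form_def)
qed

lemma linear_form_dvd_ker_eq:
  fixes \<alpha> \<beta> :: "('k::field, 'n::finite) mpoly"
  assumes "linear_form \<alpha>" "linear_form \<beta>" "\<alpha> dvd \<beta>"
  shows "ker_form \<alpha> = ker_form \<beta>"
proof -
  obtain t where t: "\<beta> = \<alpha> * t" using assms(3) by blast
  have h: "homogeneous 1 \<alpha>" "homogeneous 1 \<beta>" using assms by (auto simp: linear_form_def)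
  have c: "coef \<beta> (var_exp i) = coef t 0 * coef \<alpha> (var_exp i)" for i
    using homogeneous_coef_0[OF h(1)] by (simp add: t coef_var_exp_mult)
  moreover have "coef t 0 \<noteq> 0" using c linear_form_coef[OF assms(2)] by auto
  ultimately show ?thesis using ker_form_const_mult[OF h] by simp
qed

lemma linear_forms_independent:
  fixes \<alpha> \<beta> :: "('k::field, 'n::finite) mpoly"
  assumes "linear_form \<alpha>" "linear_form \<beta>" "ker_form \<alpha> \<noteq> ker_form \<beta>"
    and eq: "\<And>i. a * coef \<alpha> (var_exp i) = b * coef \<beta> (var_exp i)"
  shows "a = 0 \<and> b = 0"
proof -
  have h: "homogeneous 1 \<alpha>" "homogeneous 1 \<beta>" using assms by (auto simp: linear_form_def)
  have "b = 0"
  proof (rule ccontr)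
    assume b: "b \<noteq> 0"
    then have c: "coef \<beta> (var_exp i) = a / b * coef \<alpha> (var_exp i)" for i
      using eq[of i] by (simp add: field_simps)
    moreover have "a / b \<noteq> 0" using c linear_form_coef[OF assms(2)] by auto
    ultimately show False using ker_form_const_mult[OF h] assms(3) by metis
  qed
  moreover have "a = 0" using eq linear_form_coef[OF assms(1)] \<open>b = 0\<close> by auto
  ultimately show ?thesis by simp
qed


subsection \<open>The module of logarithmic derivations\<close>

lemma log_derD: "x \<in> log_der B \<Longrightarrow> linear_form \<alpha> \<Longrightarrow> ker_form \<alpha> \<in> B \<Longrightarrow> \<alpha> dvd der_apply x \<alpha>"
  by (auto simp: log_der_def)

lemma log_derI: "(\<And>\<alpha>. linear_form \<alpha> \<Longrightarrow> ker_form \<alpha> \<in> B \<Longrightarrow> \<alpha> dvd der_apply x \<alpha>) \<Longrightarrow> x \<in> log_der B"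
  by (auto simp: log_der_def)

lemma log_der_0 [simp]: "0 \<in> log_der B"
  by (rule log_derI) simp

lemma log_der_add: "x \<in> log_der B \<Longrightarrow> y \<in> log_der B \<Longrightarrow> x + y \<in> log_der B"
  by (rule log_derI) (simp add: der_apply_add log_derD)

lemma log_der_smult: "x \<in> log_der B \<Longrightarrow> a *s x \<in> log_der B"
  by (rule log_derI) (simp add: der_apply_smult log_derD)

lemma log_der_uminus: "x \<in> log_der B \<Longrightarrow> - x \<in> log_der B"
  by (metis log_der_smult vector_sneg_minus1)

lemma log_der_mono: "B \<subseteq> B' \<Longrightarrow> log_der B' \<subseteq> log_der B"
  by (auto simp: log_der_def)

lemma log_der_dcomp:
  fixes x :: "('k::field, 'n::finite) der"
  assumes "x \<in> log_der B"
  shows "dcomp d x \<in> log_der B"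
proof (rule log_derI)
  fix \<alpha> :: "('k, 'n) mpoly" assume \<alpha>: "linear_form \<alpha>" "ker_form \<alpha> \<in> B"
  then have h: "homogeneous 1 \<alpha>" by (simp add: linear_form_def)
  obtain t where "der_apply x \<alpha> = \<alpha> * t" using log_derD[OF assms \<alpha>] by blast
  then have "der_apply (dcomp d x) \<alpha> = \<alpha> * hcomp (d - 1) t"
    using hcomp_der_apply[OF h] hcomp_mult_homogeneous[OF h] by metis
  then show "\<alpha> dvd der_apply (dcomp d x) \<alpha>" by simp
qed

text \<open>Multiplication with \<open>\<alpha>\<close> inserts the condition at the hyperplane of \<open>\<alpha>\<close>, and does not
  affect the conditions at the other hyperplanes, since their forms are prime to \<open>\<alpha>\<close>.\<close>

lemma log_der_remove_iff:
  fixes B :: "('k::field ^ 'n::finite) set set"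
  assumes "linear_form \<alpha>"
  shows "x \<in> log_der (B - {ker_form \<alpha>}) \<longleftrightarrow> \<alpha> *s x \<in> log_der B"
proof
  assume x: "x \<in> log_der (B - {ker_form \<alpha>})"
  show "\<alpha> *s x \<in> log_der B"
  proof (rule log_derI)
    fix \<beta> :: "('k, 'n) mpoly" assume \<beta>: "linear_form \<beta>" "ker_form \<beta> \<in> B"
    show "\<beta> dvd der_apply (\<alpha> *s x) \<beta>"
    proof (cases "ker_form \<beta> = ker_form \<alpha>")
      case True
      then show ?thesis using same_kernel_dvd[OF \<beta>(1) assms] by (simp add: der_apply_smult)
    next
      case False
      then show ?thesis using log_derD[OF x \<beta>(1)] \<beta>(2) by (simp add: der_apply_smult)
    qed
  qed
next
  assume x: "\<alpha> *s x \<in> log_der B"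
  show "x \<in> log_der (B - {ker_form \<alpha>})"
  proof (rule log_derI)
    fix \<beta> :: "('k, 'n) mpoly" assume \<beta>: "linear_form \<beta>" "ker_form \<beta> \<in> B - {ker_form \<alpha>}"
    have "\<beta> dvd \<alpha> * der_apply x \<beta>" using log_derD[OF x \<beta>(1)] \<beta>(2) by (simp add: der_apply_smult)
    moreover have "\<not> \<beta> dvd \<alpha>" using linear_form_dvd_ker_eq[OF \<beta>(1) assms] \<beta>(2) by auto
    ultimately show "\<beta> dvd der_apply x \<beta>" using linear_form_prime[OF \<beta>(1)] by blast
  qed
qed

text \<open>The quotient \<open>D(B - H) / D(B)\<close> embeds into the domain \<open>S/\<alpha>S\<close> by evaluation at \<open>\<alpha>\<close>;
  hence it is torsion-free over \<open>S/\<alpha>S\<close>.\<close>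

lemma log_der_remove_torsion_free:
  fixes B :: "('k::field ^ 'n::finite) set set"
  assumes \<alpha>: "linear_form \<alpha>" and x: "x \<in> log_der (B - {ker_form \<alpha>})" and sx: "s *s x \<in> log_der B"
  shows "\<alpha> dvd s \<or> x \<in> log_der B"
proof (cases "\<alpha> dvd s")
  case False
  have "x \<in> log_der B"
  proof (rule log_derI)
    fix \<beta> :: "('k, 'n) mpoly" assume \<beta>: "linear_form \<beta>" "ker_form \<beta> \<in> B"
    show "\<beta> dvd der_apply x \<beta>"
    proof (cases "ker_form \<beta> = ker_form \<alpha>")
      case True
      then have "\<not> \<beta> dvd s" using same_kernel_dvd[OF \<alpha> \<beta>(1)] False dvd_trans by metis
      moreover have "\<beta> dvd s * der_apply x \<beta>" using log_derD[OF sx \<beta>] by (simp add: der_apply_smult)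
      ultimately show ?thesis using linear_form_prime[OF \<beta>(1)] by blast
    next
      case False
      then show ?thesis using log_derD[OF x \<beta>(1)] \<beta>(2) by simp
    qed
  qed
  then show ?thesis ..
qed simp

lemma residue_add_multiple: "residue \<alpha> (\<alpha> * g) = residue \<alpha> 0"
proof -
  have "\<alpha> * g + \<alpha> * h = 0 + \<alpha> * (g + h)" "0 + \<alpha> * h = \<alpha> * g + \<alpha> * (h - g)" for h
    by (simp_all add: algebra_simps)
  then show ?thesis unfolding residue_def by blast
qed

text \<open>A derivation that reduces to zero modulo \<open>\<alpha>\<close> has all its coefficients, its values at the
  variables, divisible by \<open>\<alpha>\<close>.\<close>

lemma ker_euler_restriction_eq:
  fixes B :: "('k::field ^ 'n::finite) set set"
  assumes \<alpha>: "linear_form \<alpha>"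
  shows "ker_euler_restriction B \<alpha> = {\<alpha> *s x | x. x \<in> log_der (B - {ker_form \<alpha>})}"
proof (intro equalityI subsetI)
  fix y assume y: "y \<in> ker_euler_restriction B \<alpha>"
  have "\<alpha> dvd y $ i" for i
  proof -
    have "euler_restriction \<alpha> y (residue \<alpha> (var i)) = residue \<alpha> 0"
      using y by (simp add: ker_euler_restriction_def)
    moreover have "var i + \<alpha> * 0 \<in> residue \<alpha> (var i)" unfolding residue_def by blast
    moreover have "y $ i + \<alpha> * 0 \<in> residue \<alpha> (der_apply y (var i))"
      unfolding residue_def der_apply_var by blast
    ultimately have "y $ i \<in> residue \<alpha> 0"
      unfolding euler_restriction_def by auto
    then show ?thesis by (auto simp: residue_def)
  qed
  then have "\<forall>i. \<exists>t. y $ i = \<alpha> * t" by (auto elim: dvdE)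
  then obtain t where t: "\<And>i. y $ i = \<alpha> * t i" by metis
  have eq: "y = \<alpha> *s (\<chi> i. t i)" by (simp add: vec_eq_iff t)
  moreover have "y \<in> log_der B" using y by (simp add: ker_euler_restriction_def)
  ultimately have "(\<chi> i. t i) \<in> log_der (B - {ker_form \<alpha>})"
    using log_der_remove_iff[OF \<alpha>] by metis
  then show "y \<in> {\<alpha> *s x | x. x \<in> log_der (B - {ker_form \<alpha>})}" using eq by blast
next
  fix y assume "y \<in> {\<alpha> *s x | x. x \<in> log_der (B - {ker_form \<alpha>})}"
  then obtain x where x: "y = \<alpha> *s x" "x \<in> log_der (B - {ker_form \<alpha>})" by blast
  have "residue \<alpha> (der_apply y g) = residue \<alpha> 0" for g
    unfolding x(1) der_apply_smult by (rule residue_add_multiple)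
  moreover have "f + \<alpha> * 0 \<in> residue \<alpha> f" for f unfolding residue_def by blast
  ultimately have "euler_restriction \<alpha> y (residue \<alpha> f) = residue \<alpha> 0" for f
    unfolding euler_restriction_def by auto
  moreover have "y \<in> log_der B" using x log_der_remove_iff[OF \<alpha>] by metis
  ultimately show "y \<in> ker_euler_restriction B \<alpha>" by (simp add: ker_euler_restriction_def)
qed


section \<open>Combinations of derivations\<close>

text \<open>The coefficients of a combination are given by a function instead of a list, so that they
  can be added and multiplied without regard to lengths.\<close>

definition comb :: "('k::field, 'n::finite) der list \<Rightarrow> (nat \<Rightarrow> ('k, 'n) mpoly) \<Rightarrow> ('k, 'n) der" where
  "comb ts h = (\<Sum>j<length ts. h j *s (ts ! j))"

lemma lin_comb_eq_comb: "lin_comb ts us = comb ts (\<lambda>j. us ! j)"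
  by (simp add: lin_comb_def comb_def)

lemma comb_cong: "(\<And>j. j < length ts \<Longrightarrow> h j = h' j) \<Longrightarrow> comb ts h = comb ts h'"
  by (simp add: comb_def)

lemma comb_Nil [simp]: "comb [] h = 0"
  by (simp add: comb_def)

lemma comb_Cons: "comb (t # ts) h = h 0 *s t + comb ts (\<lambda>j. h (Suc j))"
  unfolding comb_def by (simp only: length_Cons sum.lessThan_Suc_shift) simp

lemma comb_append: "comb (xs @ ys) h = comb xs h + comb ys (\<lambda>j. h (length xs + j))"
  by (induction xs arbitrary: h) (auto simp: comb_Cons add.assoc)

lemma comb_add: "comb ts h + comb ts h' = comb ts (\<lambda>j. h j + h' j)"
  by (simp add: comb_def sum.distrib vector_sadd_rdistrib)

lemma comb_diff: "comb ts h - comb ts h' = comb ts (\<lambda>j. h j - h' j)"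
  by (simp add: comb_def sum_subtractf vector_sub_rdistrib)

lemma comb_uminus: "- comb ts h = comb ts (\<lambda>j. - h j)"
  by (simp add: comb_def sum_negf[symmetric] vector_smult_lneg)

lemma smult_sum: "a *s sum f I = (\<Sum>i\<in>I. a *s (f i :: ('k::field, 'n::finite) der))"
  by (induction I rule: infinite_finite_induct) (auto simp: vector_add_ldistrib)

lemma sum_smult: "sum f I *s x = (\<Sum>i\<in>I. f i *s (x :: ('k::field, 'n::finite) der))"
  by (induction I rule: infinite_finite_induct) (auto simp: vector_sadd_rdistrib)

lemma comb_smult: "a *s comb ts h = comb ts (\<lambda>j. a * h j)"
  by (simp add: comb_def smult_sum vector_smult_assoc)

lemma comb_0 [simp]: "comb ts (\<lambda>j. 0) = 0"
  by (simp add: comb_def)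

lemma comb_delta: "i < length ts \<Longrightarrow> comb ts (\<lambda>j. if j = i then a else 0) = a *s ts ! i"
proof -
  assume i: "i < length ts"
  have "comb ts (\<lambda>j. if j = i then a else 0) = (\<Sum>j<length ts. if j = i then a *s ts ! i else 0)"
    unfolding comb_def by (intro sum.cong) auto
  then show ?thesis using i by simp
qed

lemma comb_sum: "(\<Sum>i\<in>I. comb ts (h i)) = comb ts (\<lambda>j. \<Sum>i\<in>I. h i j)"
  by (induction I rule: infinite_finite_induct) (auto simp: comb_add)

lemma dcomp_comb:
  assumes "list_all2 hom_der ds ts"
  shows "dcomp d (comb ts h) = comb ts (\<lambda>j. hcomp (d - ds ! j) (h j))"
  unfolding comb_def dcomp_sum
  by (intro sum.cong refl dcomp_smult_hom_der) (use assms in \<open>auto simp: list_all2_conv_all_nth\<close>)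

lemma generated_eq: "generated ts = range (comb ts)"
proof (intro equalityI subsetI)
  fix x assume "x \<in> range (comb ts)"
  then obtain h where "x = comb ts h" by blast
  then have "x = lin_comb ts (map h [0..<length ts])"
    unfolding lin_comb_eq_comb by (auto intro: comb_cong)
  then show "x \<in> generated ts" unfolding generated_def
    by (metis (mono_tags, lifting) length_map length_upt mem_Collect_eq minus_nat.diff_0)
qed (auto simp: generated_def lin_comb_eq_comb)

definition submodule :: "('k::field, 'n::finite) der set \<Rightarrow> bool" where
  "submodule M \<longleftrightarrow> 0 \<in> M \<and> (\<forall>x\<in>M. \<forall>y\<in>M. x + y \<in> M) \<and> (\<forall>a. \<forall>x\<in>M. a *s x \<in> M)"

lemma submodule_log_der: "submodule (log_der B)"
  by (simp add: submodule_def log_der_add log_der_smult)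

lemma submodule_comb:
  assumes "submodule M" "set ts \<subseteq> M"
  shows "comb ts h \<in> M"
  using assms(2)
proof (induction ts arbitrary: h)
  case Nil then show ?case using assms(1) by (simp add: submodule_def)
next
  case (Cons t ts) then show ?case using assms(1) by (auto simp: submodule_def comb_Cons)
qed

lemma submodule_generated: "submodule (generated ts)"
proof -
  have "0 \<in> range (comb ts)" using comb_0[of ts] by (metis rangeI)
  then show ?thesis unfolding submodule_def generated_eq by (auto simp: comb_add comb_smult)
qed

lemma set_subset_generated: "set ts \<subseteq> generated ts"
proof
  fix t assume "t \<in> set ts"
  then obtain i where "i < length ts" "t = ts ! i" by (metis in_set_conv_nth)
  then have "t = comb ts (\<lambda>j. if j = i then 1 else 0)" by (simp add: comb_delta)
  then show "t \<in> generated ts" unfolding generated_eq by blast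
qed

lemma generated_subset: "submodule M \<Longrightarrow> set ts \<subseteq> M \<Longrightarrow> generated ts \<subseteq> M"
  unfolding generated_eq using submodule_comb by blast

lemma generated_Cons: "x \<in> generated (t # ts) \<longleftrightarrow> (\<exists>s h. x = s *s t + comb ts h)"
proof
  assume "\<exists>s h. x = s *s t + comb ts h"
  then obtain s h where "x = s *s t + comb ts h" by blast
  then have "x = comb (t # ts) (case_nat s h)" by (simp add: comb_Cons)
  then show "x \<in> generated (t # ts)" unfolding generated_eq by blast
qed (auto simp: generated_eq comb_Cons)


section \<open>Linear algebra over the base field\<close>

lemma exists_nontrivial_solution:
  fixes a :: "'s \<Rightarrow> 't \<Rightarrow> 'k::field"
  assumes "finite T" "finite S" "card T < card S"
  shows "\<exists>c. (\<exists>s\<in>S. c s \<noteq> 0) \<and> (\<forall>t\<in>T. (\<Sum>s\<in>S. c s * a s t) = 0)"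
  using assms
proof (induction T arbitrary: S a rule: finite_induct)
  case empty
  then show ?case by (intro exI[of _ "\<lambda>_. 1"]) (auto simp: card_gt_0_iff)
next
  case (insert t T)
  show ?case
  proof (cases "\<forall>s\<in>S. a s t = 0")
    case True
    then show ?thesis using insert.IH[of S a] insert.prems insert.hyps by (auto simp: card_insert_if)
  next
    case False
    then obtain r where r: "r \<in> S" "a r t \<noteq> 0" by blast
    have "card T < card (S - {r})" using insert.prems insert.hyps r by simp
    then obtain c where c: "\<exists>s\<in>S - {r}. c s \<noteq> 0"
      "\<forall>u\<in>T. (\<Sum>s\<in>S - {r}. c s * (a s u - a s t / a r t * a r u)) = 0"
      using insert.IH[of "S - {r}" "\<lambda>s u. a s u - a s t / a r t * a r u"] insert.prems by auto
    let ?c = "c(r := - (\<Sum>s\<in>S - {r}. c s * a s t) / a r t)"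
    have split: "(\<Sum>s\<in>S. ?c s * a s u)
        = (\<Sum>s\<in>S - {r}. c s * a s u) - (\<Sum>s\<in>S - {r}. c s * a s t) / a r t * a r u" for u
      using insert.prems r by (subst sum.remove[of _ r]) auto
    have "(\<Sum>s\<in>S. ?c s * a s u) = 0" if "u \<in> insert t T" for u
    proof (cases "u = t")
      case True then show ?thesis unfolding split using r by simp
    next
      case False
      have "(\<Sum>s\<in>S - {r}. c s * (a s u - a s t / a r t * a r u))
          = (\<Sum>s\<in>S - {r}. c s * a s u) - (\<Sum>s\<in>S - {r}. c s * a s t) / a r t * a r u"
        by (simp add: right_diff_distrib sum_subtractf sum_distrib_right sum_divide_distrib mult.assoc)
      then show ?thesis unfolding split using c(2) that False by auto
    qed
    moreover have "\<exists>s\<in>S. ?c s \<noteq> 0" using c(1) by auto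
    ultimately show ?thesis by blast
  qed
qed

definition kcomb :: "'s set \<Rightarrow> ('s \<Rightarrow> 'k::field) \<Rightarrow> ('s \<Rightarrow> ('k, 'n::finite) der) \<Rightarrow> ('k, 'n) der" where
  "kcomb S c v = (\<Sum>s\<in>S. const (c s) *s v s)"

lemma const_sum: "const (sum f I) = (\<Sum>i\<in>I. const (f i))"
  by (induction I rule: infinite_finite_induct) (auto simp: single_add)

lemma kcomb_kcomb: "kcomb S c (\<lambda>s. kcomb T (a s) w) = kcomb T (\<lambda>t. \<Sum>s\<in>S. c s * a s t) w"
proof -
  have "kcomb S c (\<lambda>s. kcomb T (a s) w) = (\<Sum>s\<in>S. \<Sum>t\<in>T. const (c s * a s t) *s w t)"
    by (simp add: kcomb_def smult_sum vector_smult_assoc mult_single)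
  also have "\<dots> = (\<Sum>t\<in>T. \<Sum>s\<in>S. const (c s * a s t) *s w t)"
    by (rule sum.swap)
  finally show ?thesis by (simp add: kcomb_def sum_smult const_sum)
qed

lemma exists_linear_dependency:
  fixes v :: "'s \<Rightarrow> ('k::field, 'n::finite) der"
  assumes "finite T" "finite S" "card T < card S" "\<And>s. s \<in> S \<Longrightarrow> \<exists>a. v s = kcomb T a w"
  shows "\<exists>c. (\<exists>s\<in>S. c s \<noteq> 0) \<and> kcomb S c v = 0"
proof -
  obtain a where a: "\<And>s. s \<in> S \<Longrightarrow> v s = kcomb T (a s) w" using assms(4) by metis
  obtain c where c: "\<exists>s\<in>S. c s \<noteq> 0" "\<forall>t\<in>T. (\<Sum>s\<in>S. c s * a s t) = 0"
    using exists_nontrivial_solution[OF assms(1-3), of a] by blast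
  have "kcomb S c v = kcomb S c (\<lambda>s. kcomb T (a s) w)"
    unfolding kcomb_def[of S] by (intro sum.cong refl) (simp add: a)
  also have "\<dots> = 0" unfolding kcomb_kcomb using c(2) by (simp add: kcomb_def)
  finally show ?thesis using c(1) by blast
qed

lemma independent_family_spans:
  fixes v :: "'s \<Rightarrow> ('k::field, 'n::finite) der"
  assumes "finite T" "finite S" "card T \<le> card S"
    and v: "\<And>s. s \<in> S \<Longrightarrow> \<exists>a. v s = kcomb T a w"
    and indep: "\<And>c. kcomb S c v = 0 \<Longrightarrow> \<forall>s\<in>S. c s = 0"
    and x: "\<exists>a. x = kcomb T a w"
  shows "\<exists>c. x = kcomb S c v"
proof -
  let ?S = "insert None (Some ` S)" and ?v = "case_option x v"
  have "card T < card ?S" using assms(1-3) by (simp add: card_image)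
  moreover have "\<exists>a. ?v s = kcomb T a w" if "s \<in> ?S" for s using that v x by auto
  ultimately obtain c where c: "\<exists>s\<in>?S. c s \<noteq> 0" "kcomb ?S c ?v = 0"
    using exists_linear_dependency[of T ?S ?v w] assms(1,2) by auto
  have eq: "kcomb ?S c ?v = const (c None) *s x + kcomb S (c \<circ> Some) v"
    unfolding kcomb_def using assms(2) by (simp add: sum.reindex)
  have "c None \<noteq> 0"
  proof
    assume "c None = 0"
    then have "kcomb S (c \<circ> Some) v = 0" using eq c(2) by simp
    then have "\<forall>s\<in>S. c (Some s) = 0" using indep by fastforce
    then show False using c(1) \<open>c None = 0\<close> by auto
  qed
  have "const (c None) *s x = - kcomb S (c \<circ> Some) v"
    using eq c(2) by (simp add: eq_neg_iff_add_eq_0)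
  then have "const (inverse (c None)) *s (const (c None) *s x)
      = const (- inverse (c None)) *s kcomb S (c \<circ> Some) v"
    by (simp add: single_uminus vector_smult_lneg vector_smult_rneg)
  then have "x = kcomb S (\<lambda>s. - inverse (c None) * c (Some s)) v"
    using \<open>c None \<noteq> 0\<close> by (simp add: kcomb_def smult_sum vector_smult_assoc mult_single)
  then show ?thesis by blast
qed


section \<open>Minimal generators\<close>

text \<open>For generators \<open>xs\<close> of a module \<open>M\<close> this is the submodule \<open>\<mm>M\<close>, where \<open>\<mm>\<close> is the ideal
  of the polynomials without constant term.\<close>

definition mgenerated :: "('k::field, 'n::finite) der list \<Rightarrow> ('k, 'n) der set" where
  "mgenerated xs = {comb xs h | h. \<forall>j<length xs. coef (h j) 0 = 0}"

lemma mgenerated_add: "x \<in> mgenerated xs \<Longrightarrow> y \<in> mgenerated xs \<Longrightarrow> x + y \<in> mgenerated xs"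
proof -
  assume "x \<in> mgenerated xs" "y \<in> mgenerated xs"
  then obtain h h' where "x = comb xs h" "\<forall>j<length xs. coef (h j) 0 = 0"
    "y = comb xs h'" "\<forall>j<length xs. coef (h' j) 0 = 0"
    unfolding mgenerated_def by blast
  then have "x + y = comb xs (\<lambda>j. h j + h' j)" "\<forall>j<length xs. coef (h j + h' j) 0 = 0"
    by (auto simp: comb_add lookup_add)
  then show ?thesis unfolding mgenerated_def by blast
qed

lemma mgenerated_smult:
  assumes "x \<in> generated xs" "coef p 0 = 0"
  shows "p *s x \<in> mgenerated xs"
proof -
  obtain h where "x = comb xs h" using assms(1) unfolding generated_eq by blast
  then have "p *s x = comb xs (\<lambda>j. p * h j)" "\<forall>j<length xs. coef (p * h j) 0 = 0"
    using assms(2) by (auto simp: comb_smult)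
  then show ?thesis unfolding mgenerated_def by blast
qed

lemma mgenerated_smult_mgenerated:
  assumes "x \<in> mgenerated xs"
  shows "p *s x \<in> mgenerated xs"
proof -
  obtain h where "x = comb xs h" "\<forall>j<length xs. coef (h j) 0 = 0" using assms unfolding mgenerated_def by blast
  then have "p *s x = comb xs (\<lambda>j. p * h j)" "\<forall>j<length xs. coef (p * h j) 0 = 0"
    by (auto simp: comb_smult)
  then show ?thesis unfolding mgenerated_def by blast
qed

lemma mgenerated_0: "0 \<in> mgenerated xs"
  unfolding mgenerated_def by (auto intro!: exI[of _ "\<lambda>_. 0"])

lemma mgenerated_sum: "(\<And>i. i \<in> I \<Longrightarrow> f i \<in> mgenerated xs) \<Longrightarrow> sum f I \<in> mgenerated xs"
  by (induction I rule: infinite_finite_induct) (auto intro: mgenerated_add mgenerated_0)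

lemma mgenerated_mono:
  assumes "set xs \<subseteq> generated ts"
  shows "mgenerated xs \<subseteq> mgenerated ts"
proof
  fix x assume "x \<in> mgenerated xs"
  then obtain h where "x = comb xs h" "\<forall>j<length xs. coef (h j) 0 = 0" unfolding mgenerated_def by blast
  then show "x \<in> mgenerated ts"
    unfolding comb_def using assms by (auto intro!: mgenerated_sum mgenerated_smult)
qed

text \<open>The generators \<open>xs\<close> of \<open>M\<close> span the vector space \<open>M/\<mm>M\<close> over the base field, which
  bounds the number of elements that are independent in it.\<close>

lemma independent_mod_length_le:
  fixes ts xs :: "('k::field, 'n::finite) der list"
  assumes indep: "\<And>c. comb ts (\<lambda>j. const (c j)) \<in> mgenerated xs \<Longrightarrow> \<forall>j<length ts. c j = 0"
    and ts: "set ts \<subseteq> generated xs"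
  shows "length ts \<le> length xs"
proof (rule ccontr)
  assume "\<not> length ts \<le> length xs"
  have "\<exists>h. ts ! j = comb xs h" if "j < length ts" for j
    using that ts nth_mem unfolding generated_eq by blast
  then obtain P where P: "\<And>j. j < length ts \<Longrightarrow> ts ! j = comb xs (P j)" by metis
  obtain c where c: "\<exists>j\<in>{..<length ts}. c j \<noteq> 0"
    "\<forall>k\<in>{..<length xs}. (\<Sum>j\<in>{..<length ts}. c j * coef (P j k) 0) = 0"
    using exists_nontrivial_solution[of "{..<length xs}" "{..<length ts}" "\<lambda>j k. coef (P j k) 0"]
      \<open>\<not> length ts \<le> length xs\<close> by auto
  have "comb ts (\<lambda>j. const (c j)) = (\<Sum>j<length ts. comb xs (\<lambda>k. const (c j) * P j k))"
    unfolding comb_def[of ts] by (intro sum.cong refl) (simp add: P comb_smult)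
  also have "\<dots> = comb xs (\<lambda>k. \<Sum>j<length ts. const (c j) * P j k)"
    by (rule comb_sum)
  also have "\<dots> \<in> mgenerated xs"
    unfolding mgenerated_def using c(2) by (auto intro!: exI simp: lookup_sum)
  finally show False using indep c(1) by blast
qed

lemma independent_mod_of_minimal:
  fixes ts xs :: "('k::field, 'n::finite) der list"
  assumes rel: "\<And>h. comb ts h = 0 \<Longrightarrow> \<forall>j<length ts. coef (h j) 0 = 0"
    and xs: "set xs \<subseteq> generated ts"
    and mem: "comb ts (\<lambda>j. const (c j)) \<in> mgenerated xs"
  shows "\<forall>j<length ts. c j = 0"
proof -
  obtain h where h: "comb ts (\<lambda>j. const (c j)) = comb ts h" "\<forall>j<length ts. coef (h j) 0 = 0"
    using mem mgenerated_mono[OF xs] unfolding mgenerated_def by blast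
  then have "comb ts (\<lambda>j. const (c j) - h j) = 0" by (simp add: comb_diff[symmetric])
  from rel[OF this] show ?thesis using h(2) by (simp add: lookup_minus)
qed

lemma minimal_length_le:
  fixes ts xs :: "('k::field, 'n::finite) der list"
  assumes rel: "\<And>h. comb ts h = 0 \<Longrightarrow> \<forall>j<length ts. coef (h j) 0 = 0"
    and "generated xs = generated ts"
  shows "length ts \<le> length xs"
  using independent_mod_length_le independent_mod_of_minimal[OF rel] set_subset_generated assms(2)
  by metis

text \<open>Let a coefficient have a nonzero constant term. In the component of the relation whose
  degree is that of the corresponding generator, this constant is the whole coefficient, and the
  relation can be solved for the generator.\<close>

lemma irredundant_relations:
  fixes ts :: "('k::field, 'n::finite) der list"
  assumes hom: "list_all2 hom_der ds ts"
    and irr: "\<And>j. j < length ts \<Longrightarrow> generated (take j ts @ drop (Suc j) ts) \<noteq> generated ts"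
    and rel: "comb ts h = 0"
  shows "\<forall>i<length ts. coef (h i) 0 = 0"
proof (intro allI impI, rule ccontr)
  fix i assume i: "i < length ts" and c: "coef (h i) 0 \<noteq> 0"
  let ?c = "coef (h i) 0" and ?rest = "take i ts @ drop (Suc i) ts"
  let ?g = "\<lambda>j. hcomp (ds ! i - ds ! j) (h j)"
  have mem: "ts ! j \<in> set ?rest" if "j < length ts" "j \<noteq> i" for j
  proof (cases "j < i")
    case True then show ?thesis using that by (auto simp: in_set_conv_nth intro!: exI[of _ j])
  next
    case False
    then have "drop (Suc i) ts ! (j - Suc i) = ts ! j" "j - Suc i < length (drop (Suc i) ts)"
      using that by auto
    then show ?thesis by (metis UnCI nth_mem set_append)
  qed
  have "comb ts ?g = 0"
    using dcomp_comb[OF hom, of "ds ! i" h] rel by simp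
  moreover have "comb ts ?g = ?g i *s ts ! i + (\<Sum>j\<in>{..<length ts} - {i}. ?g j *s ts ! j)"
    unfolding comb_def using i by (subst sum.remove[of _ i]) auto
  moreover have "?g i = const ?c"
    using homogeneous_deg_0[OF homogeneous_hcomp[of 0 "h i"]] by simp
  ultimately have eq: "const ?c *s ts ! i = - (\<Sum>j\<in>{..<length ts} - {i}. ?g j *s ts ! j)"
    by (simp add: eq_neg_iff_add_eq_0)
  have sub: "submodule (generated ?rest)" by (rule submodule_generated)
  have "(\<Sum>j\<in>J. ?g j *s ts ! j) \<in> generated ?rest" if "finite J" "J \<subseteq> {..<length ts} - {i}" for J
    using that
  proof (induction J)
    case empty then show ?case using sub by (simp add: submodule_def)
  next
    case (insert j J)
    then have "ts ! j \<in> generated ?rest" using mem set_subset_generated by blast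
    then show ?case using insert sub by (simp add: submodule_def)
  qed
  then have "- 1 *s (\<Sum>j\<in>{..<length ts} - {i}. ?g j *s ts ! j) \<in> generated ?rest"
    using sub unfolding submodule_def by blast
  then have "const ?c *s ts ! i \<in> generated ?rest" using eq by (simp add: vector_sneg_minus1[symmetric])
  then have "const (inverse ?c) *s (const ?c *s ts ! i) \<in> generated ?rest"
    using sub unfolding submodule_def by blast
  then have "ts ! i \<in> generated ?rest" using c by (simp add: vector_smult_assoc mult_single)
  then have "ts ! j \<in> generated ?rest" if "j < length ts" for j
    using that mem[of j] set_subset_generated[of ?rest] by (cases "j = i") blast+
  then have "set ts \<subseteq> generated ?rest" by (auto simp: in_set_conv_nth)
  then have "generated ts \<subseteq> generated ?rest" by (intro generated_subset sub)
  moreover have "generated ?rest \<subseteq> generated ts"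
    by (intro generated_subset submodule_generated)
      (use set_subset_generated[of ts] in \<open>auto dest: in_set_takeD in_set_dropD\<close>)
  ultimately show False using irr[OF i] by simp
qed


section \<open>Counting monomials\<close>

definition mons :: "int \<Rightarrow> ('n::finite \<Rightarrow>\<^sub>0 nat) set" where
  "mons d = {m. int (mon_deg m) = d}"

definition mons_free :: "'n \<Rightarrow> int \<Rightarrow> ('n::finite \<Rightarrow>\<^sub>0 nat) set" where
  "mons_free k d = {m \<in> mons d. Poly_Mapping.lookup m k = 0}"

lemma finite_mons [simp]: "finite (mons d :: ('n::finite \<Rightarrow>\<^sub>0 nat) set)"
proof -
  have "finite {m :: 'n \<Rightarrow>\<^sub>0 nat. mon_deg m = e}" for e
  proof (induction e)
    case 0
    then show ?case by (simp add: mon_deg_eq_0_iff)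
  next
    case (Suc e)
    have "{m :: 'n \<Rightarrow>\<^sub>0 nat. mon_deg m = Suc e} \<subseteq> (\<Union>i. (\<lambda>m. var_exp i + m) ` {m. mon_deg m = e})"
    proof
      fix m :: "'n \<Rightarrow>\<^sub>0 nat" assume "m \<in> {m. mon_deg m = Suc e}"
      then have m: "mon_deg m = Suc e" by simp
      then have "m \<noteq> 0" by (metis mon_deg_0 nat.distinct(1))
      then obtain i m' where m': "m = var_exp i + m'" by (rule monomial_eq_prod)
      then have "mon_deg m' = e" using m by (simp add: mon_deg_add)
      then show "m \<in> (\<Union>i. (\<lambda>m. var_exp i + m) ` {m. mon_deg m = e})" using m' by blast
    qed
    then show ?case by (rule finite_subset) (use Suc in auto)
  qed
  moreover have "(mons d :: ('n \<Rightarrow>\<^sub>0 nat) set) \<subseteq> {m. mon_deg m = nat d}" by (auto simp: mons_def)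
  ultimately show ?thesis using finite_subset by blast
qed

lemma finite_mons_free [simp]: "finite (mons_free k d)"
  by (rule finite_subset[of _ "mons d"]) (auto simp: mons_free_def)

lemma card_mons:
  fixes k :: "'n::finite"
  shows "card (mons d :: ('n \<Rightarrow>\<^sub>0 nat) set) = card (mons_free k d) + card (mons (d - 1) :: ('n \<Rightarrow>\<^sub>0 nat) set)"
proof -
  have inj: "inj (\<lambda>m :: 'n \<Rightarrow>\<^sub>0 nat. var_exp k + m)" by (simp add: inj_def)
  have "(mons d :: ('n \<Rightarrow>\<^sub>0 nat) set) = mons_free k d \<union> (\<lambda>m. var_exp k + m) ` mons (d - 1)"
  proof (intro equalityI subsetI)
    fix m :: "'n \<Rightarrow>\<^sub>0 nat" assume m: "m \<in> mons d"
    show "m \<in> mons_free k d \<union> (\<lambda>m. var_exp k + m) ` mons (d - 1)"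
    proof (cases "Poly_Mapping.lookup m k = 0")
      case True then show ?thesis using m by (simp add: mons_free_def)
    next
      case False
      have eq: "m = var_exp k + (m - var_exp k)"
        by (rule poly_mapping_eqI) (use False in \<open>auto simp: lookup_add lookup_minus\<close>)
      then have "mon_deg m = 1 + mon_deg (m - var_exp k)" by (metis mon_deg_add mon_deg_var_exp)
      then have "m - var_exp k \<in> mons (d - 1)" using m by (simp add: mons_def)
      then show ?thesis using eq by blast
    qed
  qed (auto simp: mons_free_def mons_def mon_deg_add)
  moreover have "mons_free k d \<inter> (\<lambda>m. var_exp k + m) ` mons (d - 1) = {}"
    by (auto simp: mons_free_def lookup_add)
  ultimately show ?thesis using card_image[OF inj_on_subset[OF inj subset_UNIV]]
    by (simp add: card_Un_disjoint)
qed

lemma card_mons_free_eq: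
  fixes k k' :: "'n::finite"
  shows "card (mons_free k d) = card (mons_free k' d)"
  using card_mons[of d k] card_mons[of d k'] by simp

lemma mons_0: "mons 0 = {0}"
  by (auto simp: mons_def mon_deg_eq_0_iff)

lemma poly_eq_sum_over:
  assumes "Poly_Mapping.keys p \<subseteq> M" "finite M"
  shows "(\<Sum>m\<in>M. Poly_Mapping.single m (coef p m)) = p"
proof (rule poly_mapping_eqI)
  fix m show "coef (\<Sum>m\<in>M. Poly_Mapping.single m (coef p m)) m = coef p m"
    using assms by (auto simp: lookup_sum lookup_single when_def in_keys_iff)
qed

lemma coef_sum_single: "finite M \<Longrightarrow> coef (\<Sum>m\<in>M. Poly_Mapping.single m (c m)) n = (if n \<in> M then c n else 0)"
  by (simp add: lookup_sum lookup_single when_def)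

lemma keys_homogeneous: "homogeneous d p \<Longrightarrow> Poly_Mapping.keys p \<subseteq> mons d"
  by (auto simp: homogeneous_def mons_def)

lemma keys_free_of: "homogeneous d p \<Longrightarrow> free_of k p \<Longrightarrow> Poly_Mapping.keys p \<subseteq> mons_free k d"
  by (auto simp: homogeneous_def mons_def mons_free_def free_of_def in_keys_iff)


text \<open>To compare dimensions in one degree, a module generated by \<open>ts\<close> and one more derivation
  \<open>x\<close> is spanned by multiples with monomials. The index type is a sum, because \<open>x\<close> will be
  multiplied only with the monomials that avoid one variable.\<close>

definition mon_family ::
    "('k::field, 'n::finite) der list \<Rightarrow> ('k, 'n) der \<Rightarrow> (nat \<times> ('n \<Rightarrow>\<^sub>0 nat)) + ('n \<Rightarrow>\<^sub>0 nat) \<Rightarrow> ('k, 'n) der"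
  where "mon_family ts x = case_sum (\<lambda>(j, m). Poly_Mapping.single m 1 *s ts ! j) (\<lambda>m. Poly_Mapping.single m 1 *s x)"

definition mon_index ::
    "int list \<Rightarrow> int \<Rightarrow> ('n::finite \<Rightarrow>\<^sub>0 nat) set \<Rightarrow> ((nat \<times> ('n \<Rightarrow>\<^sub>0 nat)) + ('n \<Rightarrow>\<^sub>0 nat)) set"
  where "mon_index ds d M = Sigma {..<length ds} (\<lambda>j. mons (d - ds ! j)) <+> M"

lemma finite_mon_index: "finite M \<Longrightarrow> finite (mon_index ds d M)"
  by (simp add: mon_index_def)

lemma card_mon_index:
  fixes M :: "('n::finite \<Rightarrow>\<^sub>0 nat) set"
  shows "finite M \<Longrightarrow> card (mon_index ds d M) = card (Sigma {..<length ds} (\<lambda>j. mons (d - ds ! j) :: ('n \<Rightarrow>\<^sub>0 nat) set)) + card M"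
  by (simp add: mon_index_def card_Plus del: card_SigmaI)

lemma kcomb_mon_family:
  fixes x :: "('k::field, 'n::finite) der"
  assumes "finite M" "length ds = length ts"
  shows "kcomb (mon_index ds d M) c (mon_family ts x)
    = comb ts (\<lambda>j. \<Sum>m\<in>mons (d - ds ! j). Poly_Mapping.single m (c (Inl (j, m))))
      + (\<Sum>m\<in>M. Poly_Mapping.single m (c (Inr m))) *s x"
proof -
  let ?I = "Sigma {..<length ts} (\<lambda>j. mons (d - ds ! j) :: ('n \<Rightarrow>\<^sub>0 nat) set)"
  have "kcomb (mon_index ds d M) c (mon_family ts x)
      = (\<Sum>s\<in>?I. const (c (Inl s)) *s mon_family ts x (Inl s)) + (\<Sum>m\<in>M. const (c (Inr m)) *s mon_family ts x (Inr m))"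
    unfolding kcomb_def mon_index_def using assms by (simp add: sum.Plus)
  also have "(\<Sum>s\<in>?I. const (c (Inl s)) *s mon_family ts x (Inl s))
      = (\<Sum>(j, m)\<in>?I. Poly_Mapping.single m (c (Inl (j, m))) *s ts ! j)"
    by (intro sum.cong refl) (auto simp: mon_family_def vector_smult_assoc mult_single)
  also have "\<dots> = (\<Sum>j<length ts. \<Sum>m\<in>mons (d - ds ! j). Poly_Mapping.single m (c (Inl (j, m))) *s ts ! j)"
    by (rule sum.Sigma[symmetric]) auto
  finally show ?thesis
    by (simp add: comb_def mon_family_def vector_smult_assoc mult_single sum_smult)
qed

lemma comb_eq_kcomb:
  assumes "finite M" "length ds = length ts"
    and "\<And>j. j < length ts \<Longrightarrow> homogeneous (d - ds ! j) (h j)" "Poly_Mapping.keys r \<subseteq> M"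
  shows "\<exists>c. comb ts h + r *s x = kcomb (mon_index ds d M) c (mon_family ts x)"
proof -
  let ?c = "case_sum (\<lambda>(j, m). coef (h j) m) (coef r)"
  have "kcomb (mon_index ds d M) ?c (mon_family ts x) = comb ts h + r *s x"
    unfolding kcomb_mon_family[OF assms(1,2)]
    using poly_eq_sum_over[OF assms(4,1)] poly_eq_sum_over[OF keys_homogeneous[OF assms(3)] finite_mons]
    by (auto intro!: arg_cong2[of _ _ _ _ "(+)"] comb_cong)
  then show ?thesis by metis
qed


section \<open>Deleting one hyperplane from a free arrangement\<close>

lemma free_relations_trivial:
  assumes "\<forall>us. length us = length ts \<and> lin_comb ts us = 0 \<longrightarrow> (\<forall>u\<in>set us. u = 0)"
    and "comb ts h = 0" "j < length ts"
  shows "h j = 0"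
proof -
  have "lin_comb ts (map h [0..<length ts]) = 0"
    using assms(2) unfolding lin_comb_eq_comb by (metis (no_types, lifting) add_cancel_left_left comb_cong diff_zero nth_map_upt)
  moreover have "length (map h [0..<length ts]) = length ts" by simp
  ultimately have "\<forall>u\<in>set (map h [0..<length ts]). u = 0" using assms(1) by blast
  then show ?thesis using assms(3) by simp
qed

lemma row_mult_single: "row_mult q [v] [r] = map (\<lambda>j. v * r ! j) [0..<q]"
  by (simp add: row_mult_def)

lemma SPOG_withE:
  fixes B :: "('k::field ^ 'n::finite) set set"
  assumes "SPOG_with B ps c"
  obtains \<phi> \<psi>s \<alpha> f where "linear_form \<alpha>" "hom_der c \<phi>" "list_all2 hom_der ps \<psi>s"
    "generated (\<phi> # \<psi>s) = log_der B"
    "\<And>j. j < length ps \<Longrightarrow> homogeneous (c + 1 - ps ! j) (f j)"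
    "\<And>j. j < length ps \<Longrightarrow> coef (f j) 0 = 0"
    "\<alpha> *s \<phi> + comb \<psi>s f = 0"
    "\<And>a h. a *s \<phi> + comb \<psi>s h = 0 \<Longrightarrow> \<exists>v. a = v * \<alpha> \<and> (\<forall>j<length ps. h j = v * f j)"
proof -
  obtain \<alpha> fs where \<alpha>: "\<alpha> \<noteq> 0" "length ps = CARD('n)" "length fs = CARD('n)"
    and res: "min_free_res [c + 1] [\<alpha> # fs] (c # ps) (log_der B)"
    using assms unfolding SPOG_with_def by blast
  note res' = res[unfolded min_free_res_def]
  obtain ts where ts: "list_all2 hom_der (c # ps) ts" "generated ts = log_der B"
    and rels: "{us. length us = length (c # ps) \<and> lin_comb ts us = 0}
       = {row_mult (length (c # ps)) vs [\<alpha> # fs] | vs. length vs = length [c + 1]}"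
    using res'[THEN conjunct2, THEN conjunct2, THEN conjunct2, THEN conjunct2] by (elim exE conjE) (rule that)
  obtain \<phi> \<psi>s where ts_eq: "ts = \<phi> # \<psi>s" and hom: "hom_der c \<phi>" "list_all2 hom_der ps \<psi>s"
    using ts(1) by (auto simp: list_all2_Cons1)
  have len: "length \<psi>s = length ps" using hom(2) by (simp add: list_all2_lengthD)
  have entries: "homogeneous (c + 1 - (c # ps) ! j) ((\<alpha> # fs) ! j)" "coef ((\<alpha> # fs) ! j) 0 = 0"
    if "j < Suc (length ps)" for j
    using res'[THEN conjunct2, THEN conjunct1] res'[THEN conjunct2, THEN conjunct2, THEN conjunct1] that
    by simp_all
  have "row_mult (length (c # ps)) [1] [\<alpha> # fs] = \<alpha> # fs"
    unfolding row_mult_single using \<alpha> by (intro nth_equalityI) (auto simp del: upt_Suc)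
  then have "\<alpha> # fs \<in> {row_mult (length (c # ps)) vs [\<alpha> # fs] | vs. length vs = length [c + 1]}"
    by (intro CollectI exI[of _ "[1]"]) simp
  then have "lin_comb ts (\<alpha> # fs) = 0" unfolding rels[symmetric] by blast
  then have rel: "\<alpha> *s \<phi> + comb \<psi>s (\<lambda>j. fs ! j) = 0"
    unfolding lin_comb_eq_comb ts_eq comb_Cons by simp
  have mult: "\<exists>v. a = v * \<alpha> \<and> (\<forall>j<length ps. h j = v * fs ! j)" if "a *s \<phi> + comb \<psi>s h = 0" for a h
  proof -
    have "comb \<psi>s (\<lambda>j. map h [0..<length ps] ! j) = comb \<psi>s h"
      by (rule comb_cong) (simp add: len)
    then have "lin_comb ts (a # map h [0..<length ps]) = 0"
      unfolding lin_comb_eq_comb ts_eq comb_Cons using that by simp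
    then have "a # map h [0..<length ps] \<in> {us. length us = length (c # ps) \<and> lin_comb ts us = 0}"
      by simp
    then obtain vs where vs: "length vs = 1" "a # map h [0..<length ps] = row_mult (length (c # ps)) vs [\<alpha> # fs]"
      unfolding rels by auto
    then obtain v where "vs = [v]" by (auto simp: length_Suc_conv)
    then have eq: "a # map h [0..<length ps] = map (\<lambda>j. v * (\<alpha> # fs) ! j) [0..<Suc (length ps)]"
      using vs(2) by (simp only: row_mult_single length_Cons)
    have "(a # map h [0..<length ps]) ! j = v * (\<alpha> # fs) ! j" if "j < Suc (length ps)" for j
      unfolding eq using that by (simp del: upt_Suc)
    from this[of 0] this[of "Suc j" for j] show ?thesis by auto
  qed
  show ?thesis
    by (rule that[of \<alpha> \<phi> \<psi>s "\<lambda>j. fs ! j"])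
      (use \<alpha> hom ts ts_eq entries[of 0] entries[of "Suc j" for j] rel mult in \<open>auto simp: linear_form_def\<close>)
qed

lemma shortest_relations:
  fixes ts :: "('k::field, 'n::finite) der list"
  assumes hom: "list_all2 hom_der ds ts"
    and short: "\<And>xs. generated xs = generated ts \<Longrightarrow> length ts \<le> length xs"
    and rel: "comb ts h = 0"
  shows "\<forall>i<length ts. coef (h i) 0 = 0"
proof (rule irredundant_relations[OF hom _ rel])
  fix j assume "j < length ts"
  then show "generated (take j ts @ drop (Suc j) ts) \<noteq> generated ts"
    using short[of "take j ts @ drop (Suc j) ts"] by auto
qed

text \<open>Let \<open>B\<close> be the free arrangement. Then \<open>D(B - H)\<close> and \<open>D(B)\<close> have Hilbert functions that
  differ by the one of \<open>S/\<alpha>S\<close>, shifted by the level. So some \<open>\<phi>\<close> of this degree lies only in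
  \<open>D(B - H)\<close>; as \<open>D(B) + S\<phi>\<close> has the same Hilbert function as \<open>D(B - H)\<close>, they coincide.
  In each degree the comparison of dimensions is done with a spanning family of \<open>D(B - H)\<close> and
  an independent family in \<open>D(B) + S\<phi>\<close> of the same size.\<close>

lemma SPOG_deletion:
  fixes B :: "('k::field ^ 'n::finite) set set"
  assumes \<alpha>: "linear_form \<alpha>"
    and hom: "list_all2 hom_der ds \<theta>s" and gen: "generated \<theta>s = log_der B"
    and free: "\<And>h j. comb \<theta>s h = 0 \<Longrightarrow> j < length \<theta>s \<Longrightarrow> h j = 0"
    and spog: "SPOG_with (B - {ker_form \<alpha>}) ds c"
  obtains \<phi> f where "hom_der c \<phi>" "\<phi> \<in> log_der (B - {ker_form \<alpha>})" "\<phi> \<notin> log_der B"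
    "\<And>x. x \<in> log_der (B - {ker_form \<alpha>}) \<Longrightarrow> \<exists>s h. x = s *s \<phi> + comb \<theta>s h"
    "\<alpha> *s \<phi> = comb \<theta>s f" "\<And>j. j < length \<theta>s \<Longrightarrow> coef (f j) 0 = 0"
    "\<And>j. j < length \<theta>s \<Longrightarrow> homogeneous (c + 1 - ds ! j) (f j)"
proof -
  let ?D = "log_der B" and ?D1 = "log_der (B - {ker_form \<alpha>})"
  have sub: "?D \<subseteq> ?D1" by (rule log_der_mono) auto
  have len: "length \<theta>s = length ds" using hom by (simp add: list_all2_lengthD)
  have \<theta>: "\<theta>s ! j \<in> ?D" "hom_der (ds ! j) (\<theta>s ! j)" if "j < length ds" for j
    using that hom gen set_subset_generated[of \<theta>s] len by (auto simp: list_all2_conv_all_nth)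
  have combD: "comb \<theta>s h \<in> ?D" for h using gen unfolding generated_eq by blast
  obtain \<eta> \<psi>s \<gamma> g where \<gamma>: "linear_form \<gamma>" and \<eta>: "hom_der c \<eta>" and \<psi>: "list_all2 hom_der ds \<psi>s"
    and gen1: "generated (\<eta> # \<psi>s) = ?D1"
    and g: "\<And>j. j < length ds \<Longrightarrow> homogeneous (c + 1 - ds ! j) (g j)"
      "\<And>j. j < length ds \<Longrightarrow> coef (g j) 0 = 0"
    and rel: "\<gamma> *s \<eta> + comb \<psi>s g = 0"
    and rels: "\<And>a h. a *s \<eta> + comb \<psi>s h = 0 \<Longrightarrow> \<exists>v. a = v * \<gamma> \<and> (\<forall>j<length ds. h j = v * g j)"
    using SPOG_withE[OF spog] by metis
  have len1: "length \<psi>s = length ds" using \<psi> by (simp add: list_all2_lengthD)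
  have \<gamma>h: "homogeneous 1 \<gamma>" using \<gamma> by (simp add: linear_form_def)
  obtain k where k: "coef \<gamma> (var_exp k) \<noteq> 0" using linear_form_coef[OF \<gamma>] by blast
  have \<alpha>h: "homogeneous 1 \<alpha>" using \<alpha> by (simp add: linear_form_def)
  obtain k' where k': "coef \<alpha> (var_exp k') \<noteq> 0" using linear_form_coef[OF \<alpha>] by blast
  have \<psi>D: "\<eta> \<in> ?D1" "j < length ds \<Longrightarrow> \<psi>s ! j \<in> ?D1" for j
    using set_subset_generated[of "\<eta> # \<psi>s"] gen1 len1 by auto
  have hom_mon: "hom_der d (Poly_Mapping.single m 1 *s x)"
    if "hom_der e x" "m \<in> mons (d - e)" for d e m and x :: "('k, 'n) der"
    using hom_der_smult[OF homogeneous_single that(1), of m 1] that(2) by (simp add: mons_def)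
  have components: "\<exists>s h. x = s *s \<eta> + comb \<psi>s h \<and> homogeneous (d - c) s \<and>
      (\<forall>j<length ds. homogeneous (d - ds ! j) (h j))"
    if x: "x \<in> ?D1" "hom_der d x" for d x
  proof -
    obtain s h where "x = s *s \<eta> + comb \<psi>s h" using x(1) gen1 unfolding generated_eq comb_Cons by blast
    then have "dcomp d x = hcomp (d - c) s *s \<eta> + comb \<psi>s (\<lambda>j. hcomp (d - ds ! j) (h j))"
      by (simp add: dcomp_add dcomp_smult_hom_der[OF \<eta>] dcomp_comb[OF \<psi>])
    then show ?thesis using x(2) by (auto simp: dcomp_hom_der intro: homogeneous_hcomp)
  qed
  \<comment> \<open>the relation makes the multiples of \<open>\<eta>\<close> by monomials that involve \<open>k\<close> superfluous\<close>
  have span1: "\<exists>a. x = kcomb (mon_index ds d (mons_free k (d - c))) a (mon_family \<psi>s \<eta>)"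
    if x: "x \<in> ?D1" "hom_der d x" for d x
  proof -
    obtain s h where s: "x = s *s \<eta> + comb \<psi>s h" "homogeneous (d - c) s"
      and h: "\<And>j. j < length ds \<Longrightarrow> homogeneous (d - ds ! j) (h j)"
      using components[OF x] by blast
    obtain r t where r: "free_of k r" "s = r + \<gamma> * t" using division_by_linear_form[OF \<gamma>h k] by blast
    let ?r = "hcomp (d - c) r" and ?t = "hcomp (d - c - 1) t"
    have "s = ?r + \<gamma> * ?t"
      using hcomp_homogeneous[OF s(2), of "d - c"] hcomp_add hcomp_mult_homogeneous[OF \<gamma>h] r(2) by metis
    then have "x = ?r *s \<eta> + ?t *s (\<gamma> *s \<eta>) + comb \<psi>s h"
      using s(1) by (simp add: vector_sadd_rdistrib vector_smult_assoc mult.commute)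
    also have "\<gamma> *s \<eta> = - comb \<psi>s g" using rel by (simp add: eq_neg_iff_add_eq_0)
    also have "?r *s \<eta> + ?t *s (- comb \<psi>s g) + comb \<psi>s h = comb \<psi>s (\<lambda>j. h j - ?t * g j) + ?r *s \<eta>"
      by (simp add: vector_smult_rneg comb_smult comb_diff[symmetric])
    finally have eq: "x = comb \<psi>s (\<lambda>j. h j - ?t * g j) + ?r *s \<eta>" .
    have "homogeneous (d - ds ! j) (h j - ?t * g j)" if "j < length \<psi>s" for j
    proof -
      have "homogeneous ((d - c - 1) + (c + 1 - ds ! j)) (?t * g j)"
        using that len1 by (intro homogeneous_mult homogeneous_hcomp g) auto
      then show ?thesis using h that len1 by (intro homogeneous_diff) auto
    qed
    then show ?thesis unfolding eq
      using keys_free_of[OF homogeneous_hcomp free_of_hcomp[OF r(1)]] len1 by (intro comb_eq_kcomb) auto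
  qed
  \<comment> \<open>in degree \<open>c\<close> the multiples of the \<open>\<psi>s\<close> are as many as those of the \<open>\<theta>s\<close>, and \<open>\<eta>\<close> is one more\<close>
  have "\<exists>\<phi>\<in>?D1. hom_der c \<phi> \<and> \<phi> \<notin> ?D"
  proof (rule ccontr)
    assume "\<not> ?thesis"
    then have inD: "x \<in> ?D" if "x \<in> ?D1" "hom_der c x" for x using that by blast
    let ?T = "mon_index ds c ({} :: ('n \<Rightarrow>\<^sub>0 nat) set)" and ?S = "mon_index ds c (mons 0 :: ('n \<Rightarrow>\<^sub>0 nat) set)"
    have "\<exists>a. mon_family \<psi>s \<eta> s = kcomb ?T a (mon_family \<theta>s 0)" if "s \<in> ?S" for s
    proof -
      have "mon_family \<psi>s \<eta> s \<in> ?D1 \<and> hom_der c (mon_family \<psi>s \<eta> s)"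
        using that \<psi>D \<eta> \<psi> len1 hom_mon[of c \<eta> _ c]
        by (auto simp: mon_index_def mon_family_def list_all2_conv_all_nth intro!: log_der_smult hom_mon)
      then obtain h where h: "mon_family \<psi>s \<eta> s = comb \<theta>s h" and hc: "hom_der c (mon_family \<psi>s \<eta> s)"
        using inD gen unfolding generated_eq by blast
      have "mon_family \<psi>s \<eta> s = comb \<theta>s (\<lambda>j. hcomp (c - ds ! j) (h j)) + 0 *s 0"
        using dcomp_comb[OF hom, of c h] dcomp_hom_der[OF hc, of c] h by simp
      then show ?thesis using comb_eq_kcomb[of "{}" ds \<theta>s c _ 0 0] len homogeneous_hcomp by fastforce
    qed
    moreover have "card ?T < card ?S" by (simp add: card_mon_index mons_0 del: card_SigmaI)
    ultimately obtain a where a: "\<exists>s\<in>?S. a s \<noteq> 0" "kcomb ?S a (mon_family \<psi>s \<eta>) = 0"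
      using exists_linear_dependency[of ?T ?S "mon_family \<psi>s \<eta>"] finite_mon_index[of "{}"] finite_mon_index[of "mons 0"]
      by (metis finite.emptyI finite_mons)
    let ?h = "\<lambda>j. \<Sum>m\<in>mons (c - ds ! j). Poly_Mapping.single m (a (Inl (j, m)))"
      and ?r = "\<Sum>m\<in>mons 0. Poly_Mapping.single m (a (Inr m))"
    have "?r *s \<eta> + comb \<psi>s ?h = 0"
      using a(2) kcomb_mon_family[of "mons 0" ds \<psi>s c a \<eta>] len1 by (simp add: add.commute)
    then obtain v where v: "?r = v * \<gamma>" "\<forall>j<length ds. ?h j = v * g j" using rels by blast
    have "coef ?r 0 = coef v 0 * coef \<gamma> 0" unfolding v(1) by simp
    then have r0: "a (Inr 0) = 0" using homogeneous_coef_0[OF \<gamma>h] by (simp add: mons_0)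
    then have "v * \<gamma> = 0" unfolding v(1)[symmetric] by (simp add: mons_0)
    then have "v = 0" using \<gamma> by (simp add: poly_mult_eq_0_iff linear_form_def)
    then have "a (Inl (j, m)) = 0" if "j < length ds" "m \<in> mons (c - ds ! j)" for j m
      using v(2) that coef_sum_single[OF finite_mons[of "c - ds ! j"], where c = "\<lambda>m. a (Inl (j, m))" and n = m] by auto
    then show False using a(1) r0 by (auto simp: mon_index_def mons_0)
  qed
  then obtain \<phi> where \<phi>: "\<phi> \<in> ?D1" "hom_der c \<phi>" "\<phi> \<notin> ?D" by blast
  have span: "\<exists>s h. x = s *s \<phi> + comb \<theta>s h" if x: "x \<in> ?D1" "hom_der d x" for d x
  proof -
    let ?T = "mon_index ds d (mons_free k (d - c))"
      and ?S = "mon_index ds d (mons_free k' (d - c))"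
    have "\<exists>a. mon_family \<theta>s \<phi> s = kcomb ?T a (mon_family \<psi>s \<eta>)" if "s \<in> ?S" for s
      using that \<phi> \<theta>(2) subsetD[OF sub \<theta>(1)]
      by (intro span1) (auto simp: mon_index_def mon_family_def mons_free_def intro!: log_der_smult hom_mon)
    moreover have "\<forall>s\<in>?S. a s = 0" if "kcomb ?S a (mon_family \<theta>s \<phi>) = 0" for a
    proof -
      let ?h = "\<lambda>j. \<Sum>m\<in>mons (d - ds ! j). Poly_Mapping.single m (a (Inl (j, m)))"
        and ?r = "\<Sum>m\<in>mons_free k' (d - c). Poly_Mapping.single m (a (Inr m))"
      have eq: "comb \<theta>s ?h + ?r *s \<phi> = 0"
        using that kcomb_mon_family[of "mons_free k' (d - c)" ds \<theta>s d a \<phi>] len by simp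
      then have "?r *s \<phi> = - comb \<theta>s ?h" by (simp add: eq_neg_iff_add_eq_0 add.commute)
      then have "?r *s \<phi> \<in> ?D" using log_der_uminus[OF combD] by (simp only:)
      then have "\<alpha> dvd ?r" using log_der_remove_torsion_free[OF \<alpha> \<phi>(1)] \<phi>(3) by blast
      moreover have "free_of k' ?r"
        by (intro free_of_sum free_of_single) (simp add: mons_free_def)
      ultimately have r: "?r = 0" using linear_form_dvd_free_of_eq_0[OF \<alpha>h k'] by blast
      have a1: "a (Inr m) = 0" if "m \<in> mons_free k' (d - c)" for m
        using that coef_sum_single[OF finite_mons_free[of k' "d - c"], where c = "\<lambda>m. a (Inr m)" and n = m] unfolding r by simp
      have "?h j = 0" if "j < length ds" for j using free[of ?h j] eq r that len by simp
      then have "a (Inl (j, m)) = 0" if "j < length ds" "m \<in> mons (d - ds ! j)" for j m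
        using that coef_sum_single[OF finite_mons[of "d - ds ! j"], where c = "\<lambda>m. a (Inl (j, m))" and n = m] by simp
      then show ?thesis using a1 by (auto simp: mon_index_def)
    qed
    moreover have "card ?T \<le> card ?S"
      using card_mons_free_eq[of k "d - c" k'] by (simp add: card_mon_index del: card_SigmaI)
    ultimately obtain a where "x = kcomb ?S a (mon_family \<theta>s \<phi>)"
      using independent_family_spans[of ?T ?S "mon_family \<theta>s \<phi>" "mon_family \<psi>s \<eta>" x]
        finite_mon_index span1[OF x] finite_mons_free by blast
    then have "x = (\<Sum>m\<in>mons_free k' (d - c). Poly_Mapping.single m (a (Inr m))) *s \<phi>
        + comb \<theta>s (\<lambda>j. \<Sum>m\<in>mons (d - ds ! j). Poly_Mapping.single m (a (Inl (j, m))))"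
      using kcomb_mon_family[OF finite_mons_free[of k' "d - c"], of ds \<theta>s d a \<phi>] len by (simp only: add.commute)
    then show ?thesis by blast
  qed
  have span': "\<exists>s h. x = s *s \<phi> + comb \<theta>s h" if x: "x \<in> ?D1" for x
  proof -
    have sm: "submodule (generated (\<phi> # \<theta>s))" by (rule submodule_generated)
    have "dcomp d x \<in> generated (\<phi> # \<theta>s)" for d
      using span[OF log_der_dcomp[OF x] hom_der_dcomp, of d] unfolding generated_Cons by blast
    then have "x \<in> generated (\<phi> # \<theta>s)"
      by (rule mem_of_dcomp_mem) (use sm in \<open>auto simp: submodule_def\<close>)
    then show ?thesis unfolding generated_Cons by blast
  qed
  have "\<alpha> *s \<phi> \<in> ?D" using \<phi>(1) log_der_remove_iff[OF \<alpha>] by blast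
  then obtain f where f: "\<alpha> *s \<phi> = comb \<theta>s f" using gen unfolding generated_eq by blast
  let ?f = "\<lambda>j. hcomp (c + 1 - ds ! j) (f j)"
  have f': "\<alpha> *s \<phi> = comb \<theta>s ?f"
    using dcomp_hom_der[OF hom_der_smult[OF \<alpha>h \<phi>(2)], of "c + 1"] dcomp_comb[OF hom, of "c + 1" f] f
    by (simp add: add.commute)
  have gen2: "generated (\<phi> # \<theta>s) = ?D1"
  proof
    show "generated (\<phi> # \<theta>s) \<subseteq> ?D1"
      by (intro generated_subset submodule_log_der) (use \<phi> sub gen set_subset_generated[of \<theta>s] in auto)
    show "?D1 \<subseteq> generated (\<phi> # \<theta>s)"
      by (rule subsetI) (simp only: generated_Cons span')
  qed
  \<comment> \<open>\<open>\<eta> # \<psi>s\<close> is minimal, hence shortest; as \<open>\<phi> # \<theta>s\<close> has the same length, it is minimal, too\<close>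
  have min1: "\<forall>j<length (\<eta> # \<psi>s). coef (h j) 0 = 0" if "comb (\<eta> # \<psi>s) h = 0" for h
  proof -
    have "h 0 *s \<eta> + comb \<psi>s (\<lambda>j. h (Suc j)) = 0" using that unfolding comb_Cons .
    then obtain v where "h 0 = v * \<gamma>" "\<forall>j<length ds. h (Suc j) = v * g j" using rels by blast
    then show ?thesis using g(2) homogeneous_coef_0[OF \<gamma>h] len1 by (auto simp: less_Suc_eq_0_disj)
  qed
  have "length (\<phi> # \<theta>s) \<le> length xs" if "generated xs = generated (\<phi> # \<theta>s)" for xs
    using minimal_length_le[OF min1, of xs] that gen1 gen2 len len1 by simp
  then have "\<forall>i<length (\<phi> # \<theta>s). coef (case_nat (- \<alpha>) ?f i) 0 = 0"
    using shortest_relations[of "c # ds" "\<phi> # \<theta>s" "case_nat (- \<alpha>) ?f"] \<phi>(2) hom f'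
    by (simp add: comb_Cons vector_smult_lneg)
  from this[rule_format, of "Suc j" for j] have "coef (?f j) 0 = 0" if "j < length \<theta>s" for j
    using that by simp
  then show ?thesis using that[of \<phi> ?f] \<phi> span' f' homogeneous_hcomp by blast
qed


section \<open>Resolutions with one and with two relations\<close>

lemma min_free_res_one_relation:
  fixes ts :: "('k::field, 'n::finite) der list"
  assumes hom: "list_all2 hom_der bs ts" and gen: "generated ts = D" and len: "length r = length bs"
    and deg: "\<And>j. j < length bs \<Longrightarrow> homogeneous (a - bs ! j) (r ! j)"
    and min: "\<And>j. j < length bs \<Longrightarrow> coef (r ! j) 0 = 0"
    and rel: "comb ts (\<lambda>j. r ! j) = 0"
    and rels: "\<And>h. comb ts h = 0 \<Longrightarrow> \<exists>v. \<forall>j<length bs. h j = v * r ! j"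
    and ne: "j0 < length bs" "r ! j0 \<noteq> 0"
  shows "min_free_res [a] [r] bs D"
proof -
  have lts: "length ts = length bs" using hom by (simp add: list_all2_lengthD)
  have "v = 0" if "\<forall>u\<in>set (row_mult (length bs) [v] [r]). u = 0" for v
    using that ne by (auto simp: row_mult_single poly_mult_eq_0_iff)
  then have inj: "\<forall>vs. length vs = length [a] \<and> (\<forall>u\<in>set (row_mult (length bs) vs [r]). u = 0)
        \<longrightarrow> (\<forall>v\<in>set vs. v = 0)"
    by (auto simp: length_Suc_conv)
  have "{us. length us = length bs \<and> lin_comb ts us = 0}
      = {row_mult (length bs) vs [r] | vs. length vs = length [a]}"
  proof (intro equalityI subsetI)
    fix us assume "us \<in> {us. length us = length bs \<and> lin_comb ts us = 0}"
    then have us: "length us = length bs" "comb ts (\<lambda>j. us ! j) = 0" by (auto simp: lin_comb_eq_comb)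
    then obtain v where "\<forall>j<length bs. us ! j = v * r ! j" using rels by blast
    then have "us = row_mult (length bs) [v] [r]"
      using us(1) by (intro nth_equalityI) (auto simp: row_mult_single)
    then show "us \<in> {row_mult (length bs) vs [r] | vs. length vs = length [a]}"
      by (intro CollectI exI[of _ "[v]"]) simp
  next
    fix us assume "us \<in> {row_mult (length bs) vs [r] | vs. length vs = length [a]}"
    then obtain v where us: "us = row_mult (length bs) [v] [r]" by (auto simp: length_Suc_conv)
    have "lin_comb ts us = v *s comb ts (\<lambda>j. r ! j)"
      unfolding lin_comb_eq_comb comb_smult by (rule comb_cong) (simp add: us row_mult_single lts)
    then show "us \<in> {us. length us = length bs \<and> lin_comb ts us = 0}"
      using rel by (simp add: us row_mult_single)
  qed
  then show ?thesis
    unfolding min_free_res_def using hom gen inj len deg min by (intro conjI exI[of _ ts]) auto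
qed

lemma row_mult_pair: "row_mult q [v, w] [r, s] = map (\<lambda>j. v * r ! j + w * s ! j) [0..<q]"
  by (simp add: row_mult_def lessThan_Suc add.commute)

lemma min_free_res_two_relations:
  fixes ts :: "('k::field, 'n::finite) der list"
  assumes hom: "list_all2 hom_der bs ts" and gen: "generated ts = D"
    and len: "length r = length bs" "length s = length bs"
    and deg: "\<And>j. j < length bs \<Longrightarrow> homogeneous (a - bs ! j) (r ! j)"
      "\<And>j. j < length bs \<Longrightarrow> homogeneous (b - bs ! j) (s ! j)"
    and min: "\<And>j. j < length bs \<Longrightarrow> coef (r ! j) 0 = 0" "\<And>j. j < length bs \<Longrightarrow> coef (s ! j) 0 = 0"
    and rel: "comb ts (\<lambda>j. r ! j) = 0" "comb ts (\<lambda>j. s ! j) = 0"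
    and rels: "\<And>h. comb ts h = 0 \<Longrightarrow> \<exists>v w. \<forall>j<length bs. h j = v * r ! j + w * s ! j"
    and indep: "\<And>v w. (\<And>j. j < length bs \<Longrightarrow> v * r ! j + w * s ! j = 0) \<Longrightarrow> v = 0 \<and> w = 0"
  shows "min_free_res [a, b] [r, s] bs D"
proof -
  have lts: "length ts = length bs" using hom by (simp add: list_all2_lengthD)
  have pair: "\<exists>v w. vs = [v, w]" if "length vs = length [a, b]" for vs :: "('k, 'n) mpoly list"
    using that by (auto simp: length_Suc_conv)
  have inj': "v = 0 \<and> w = 0" if "\<forall>u\<in>set (row_mult (length bs) [v, w] [r, s]). u = 0" for v w
    using that by (intro indep) (auto simp: row_mult_pair)
  have inj: "\<forall>vs. length vs = length [a, b] \<and> (\<forall>u\<in>set (row_mult (length bs) vs [r, s]). u = 0)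
        \<longrightarrow> (\<forall>v\<in>set vs. v = 0)"
  proof (intro allI impI, elim conjE)
    fix vs :: "('k, 'n) mpoly list"
    assume l: "length vs = length [a, b]" and z: "\<forall>u\<in>set (row_mult (length bs) vs [r, s]). u = 0"
    obtain v w where vs: "vs = [v, w]" using pair[OF l] by blast
    show "\<forall>v\<in>set vs. v = 0" using inj'[OF z[unfolded vs]] by (simp add: vs)
  qed
  have "{us. length us = length bs \<and> lin_comb ts us = 0}
      = {row_mult (length bs) vs [r, s] | vs. length vs = length [a, b]}"
  proof (intro equalityI subsetI)
    fix us assume "us \<in> {us. length us = length bs \<and> lin_comb ts us = 0}"
    then have us: "length us = length bs" "comb ts (\<lambda>j. us ! j) = 0" by (auto simp: lin_comb_eq_comb)
    then obtain v w where "\<forall>j<length bs. us ! j = v * r ! j + w * s ! j" using rels by blast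
    then have "us = row_mult (length bs) [v, w] [r, s]"
      using us(1) by (intro nth_equalityI) (auto simp: row_mult_pair)
    then show "us \<in> {row_mult (length bs) vs [r, s] | vs. length vs = length [a, b]}"
      by (intro CollectI exI[of _ "[v, w]"]) simp
  next
    fix us assume "us \<in> {row_mult (length bs) vs [r, s] | vs. length vs = length [a, b]}"
    then obtain v w where us: "us = row_mult (length bs) [v, w] [r, s]" using pair by blast
    have "lin_comb ts us = v *s comb ts (\<lambda>j. r ! j) + w *s comb ts (\<lambda>j. s ! j)"
      unfolding lin_comb_eq_comb comb_smult comb_add by (rule comb_cong) (simp add: us row_mult_pair lts)
    then show "us \<in> {us. length us = length bs \<and> lin_comb ts us = 0}"
      using rel by (simp add: us row_mult_pair)
  qed
  moreover have "\<forall>i<length [a, b]. length ([r, s] ! i) = length bs \<and>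
        (\<forall>j<length bs. homogeneous ([a, b] ! i - bs ! j) ([r, s] ! i ! j))"
    "\<forall>i<length [a, b]. \<forall>j<length bs. coef ([r, s] ! i ! j) 0 = 0"
    using len deg min by (simp_all add: less_Suc_eq)
  ultimately show ?thesis
    unfolding min_free_res_def using hom gen inj by (intro conjI exI[of _ ts]) simp_all
qed


subsection \<open>Omitting one generator\<close>

lemma comb_omit_nth:
  assumes "i < length ts"
  shows "comb (take i ts @ drop (Suc i) ts) h
    = comb ts (\<lambda>j. if j < i then h j else if j = i then 0 else h (j - 1))"
proof -
  obtain xs t ys where ts: "ts = xs @ t # ys" "length xs = i"
    using assms id_take_nth_drop[of i ts] by (metis length_take min.absorb4)
  have "comb xs (\<lambda>j. if j < i then h j else if j = i then 0 else h (j - 1)) = comb xs h"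
    by (rule comb_cong) (simp add: ts(2))
  then show ?thesis by (simp add: ts comb_append comb_Cons)
qed

lemma nth_omit_nth:
  assumes "i < length xs" "j < length xs - 1"
  shows "(take i xs @ drop (Suc i) xs) ! j = xs ! (if j < i then j else Suc j)"
  using assms by (auto simp: nth_append min_def)

lemma list_all2_omit_nth:
  "list_all2 P xs ys \<Longrightarrow> list_all2 P (take i xs @ drop (Suc i) xs) (take i ys @ drop (Suc i) ys)"
  by (intro list_all2_appendI list_all2_takeI list_all2_dropI)

lemma set_subset_insert_omit_nth: "set xs \<subseteq> insert (xs ! i) (set (take i xs @ drop (Suc i) xs))"
proof (cases "i < length xs")
  case True
  then have "set xs = set (take i xs @ xs ! i # drop (Suc i) xs)" using id_take_nth_drop by metis
  then show ?thesis by auto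
qed auto


section \<open>Nakayama's lemma for graded modules\<close>

lemma submodule_sum: "submodule M \<Longrightarrow> (\<And>i. i \<in> I \<Longrightarrow> f i \<in> M) \<Longrightarrow> sum f I \<in> M"
  by (induction I rule: infinite_finite_induct) (auto simp: submodule_def)

text \<open>A generator of minimal degree outside \<open>N\<close> cannot lie in \<open>N + \<mm>M\<close>: in its degree, only
  generators of smaller degree contribute to \<open>\<mm>M\<close>.\<close>

lemma graded_nakayama:
  fixes xs :: "('k::field, 'n::finite) der list"
  assumes hom: "list_all2 hom_der es xs" and N: "submodule N" "\<And>x d. x \<in> N \<Longrightarrow> dcomp d x \<in> N"
    and le: "\<And>x. x \<in> set xs \<Longrightarrow> \<exists>y\<in>N. \<exists>z\<in>mgenerated xs. x = y + z"
  shows "set xs \<subseteq> N"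
proof (rule ccontr)
  assume "\<not> set xs \<subseteq> N"
  define I where "I = {i. i < length xs \<and> xs ! i \<notin> N}"
  have "finite I" "I \<noteq> {}" using \<open>\<not> set xs \<subseteq> N\<close> by (auto simp: I_def in_set_conv_nth)
  then obtain k where k: "k \<in> I" "\<And>i. i \<in> I \<Longrightarrow> es ! k \<le> es ! i"
    using ex_is_arg_min_if_finite[of I "\<lambda>i. es ! i"] by (auto simp: is_arg_min_linorder)
  then have "xs ! k \<in> set xs" by (simp add: I_def)
  then obtain y z where yz: "y \<in> N" "z \<in> mgenerated xs" "xs ! k = y + z" using le by blast
  obtain p where p: "z = comb xs p" "\<forall>j<length xs. coef (p j) 0 = 0" using yz(2) unfolding mgenerated_def by blast
  have "hom_der (es ! k) (xs ! k)" using hom k(1) by (auto simp: list_all2_conv_all_nth I_def)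
  then have "xs ! k = dcomp (es ! k) y + dcomp (es ! k) z"
    using dcomp_hom_der[of "es ! k" "xs ! k" "es ! k"] yz(3) by (simp add: dcomp_add)
  moreover have "dcomp (es ! k) z \<in> N"
  proof -
    have "hcomp (es ! k - es ! j) (p j) *s xs ! j \<in> N" if "j < length xs" for j
    proof (cases "xs ! j \<in> N")
      case True then show ?thesis using N(1) by (simp add: submodule_def)
    next
      case False
      then have "es ! k - es ! j \<le> 0" using k(2)[of j] that by (simp add: I_def)
      then have "hcomp (es ! k - es ! j) (p j) = 0"
        using p(2) that by (intro homogeneous_nonpositive[OF homogeneous_hcomp]) auto
      then show ?thesis using N(1) by (simp add: submodule_def)
    qed
    then show ?thesis unfolding p(1) dcomp_comb[OF hom] unfolding comb_def by (intro submodule_sum[OF N(1)]) auto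
  qed
  ultimately have "xs ! k \<in> N" using N yz(1) by (simp add: submodule_def)
  then show False using k(1) by (simp add: I_def)
qed

text \<open>Membership in the square of the ideal \<open>\<mm>\<close>.\<close>

definition order2 :: "('k::field, 'n::finite) mpoly \<Rightarrow> bool" where
  "order2 p \<longleftrightarrow> coef p 0 = 0 \<and> (\<forall>i. coef p (var_exp i) = 0)"

lemma order2_mult: "coef p 0 = 0 \<Longrightarrow> coef q 0 = 0 \<Longrightarrow> order2 (p * q)"
  by (simp add: order2_def coef_var_exp_mult)

lemma order2_sum: "(\<And>i. i \<in> I \<Longrightarrow> order2 (f i)) \<Longrightarrow> order2 (sum f I)"
  by (simp add: order2_def lookup_sum)


section \<open>Deleting two hyperplanes\<close>

text \<open>The locale keeps what is needed of the modules of \<open>\<A>\<close> (\<open>D\<close>), of the two deletions (\<open>D1\<close>,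
  \<open>D2\<close>) and of the double deletion (\<open>D12\<close>): how the linear forms lead from one to the other,
  that the quotients are torsion-free, and the generators \<open>\<phi>1\<close>, \<open>\<phi>2\<close> of \<open>D1\<close> and \<open>D2\<close> over
  \<open>D\<close>. These assumptions are symmetric in the two hyperplanes, so each consequence can
  also be read with their roles exchanged; \<open>c1 \<le> c2\<close> is therefore left out.\<close>

locale two_deletions =
  fixes \<alpha>1 \<alpha>2 :: "('k::field, 'n::finite) mpoly"
    and D D1 D2 D12 :: "('k, 'n) der set"
    and \<theta>s :: "('k, 'n) der list" and ds :: "int list"
    and \<phi>1 :: "('k, 'n) der" and c1 :: int and f1 :: "nat \<Rightarrow> ('k, 'n) mpoly"
    and \<phi>2 :: "('k, 'n) der" and c2 :: int and f2 :: "nat \<Rightarrow> ('k, 'n) mpoly"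
  assumes lin1: "linear_form \<alpha>1" and lin2: "linear_form \<alpha>2" and distinct: "ker_form \<alpha>1 \<noteq> ker_form \<alpha>2"
    and hom: "list_all2 hom_der ds \<theta>s" and gen: "generated \<theta>s = D"
    and free: "comb \<theta>s h = 0 \<Longrightarrow> j < length \<theta>s \<Longrightarrow> h j = 0"
    and D1_iff: "x \<in> D1 \<longleftrightarrow> \<alpha>1 *s x \<in> D" and D2_iff: "x \<in> D2 \<longleftrightarrow> \<alpha>2 *s x \<in> D"
    and D12_iff1: "x \<in> D12 \<longleftrightarrow> \<alpha>1 *s x \<in> D2" and D12_iff2: "x \<in> D12 \<longleftrightarrow> \<alpha>2 *s x \<in> D1"
    and tf1: "x \<in> D1 \<Longrightarrow> s *s x \<in> D \<Longrightarrow> \<alpha>1 dvd s \<or> x \<in> D"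
    and tf2: "x \<in> D2 \<Longrightarrow> s *s x \<in> D \<Longrightarrow> \<alpha>2 dvd s \<or> x \<in> D"
    and tf12_1: "x \<in> D12 \<Longrightarrow> s *s x \<in> D2 \<Longrightarrow> \<alpha>1 dvd s \<or> x \<in> D2"
    and tf12_2: "x \<in> D12 \<Longrightarrow> s *s x \<in> D1 \<Longrightarrow> \<alpha>2 dvd s \<or> x \<in> D1"
    and \<phi>1_hom: "hom_der c1 \<phi>1" and \<phi>1_mem: "\<phi>1 \<in> D1" and \<phi>1_notin: "\<phi>1 \<notin> D"
    and \<phi>1_span: "x \<in> D1 \<Longrightarrow> \<exists>s h. x = s *s \<phi>1 + comb \<theta>s h"
    and \<phi>1_rel: "\<alpha>1 *s \<phi>1 = comb \<theta>s f1"
    and f1_0: "j < length \<theta>s \<Longrightarrow> coef (f1 j) 0 = 0"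
    and f1_hom: "j < length \<theta>s \<Longrightarrow> homogeneous (c1 + 1 - ds ! j) (f1 j)"
    and \<phi>2_hom: "hom_der c2 \<phi>2" and \<phi>2_mem: "\<phi>2 \<in> D2" and \<phi>2_notin: "\<phi>2 \<notin> D"
    and \<phi>2_span: "x \<in> D2 \<Longrightarrow> \<exists>s h. x = s *s \<phi>2 + comb \<theta>s h"
    and \<phi>2_rel: "\<alpha>2 *s \<phi>2 = comb \<theta>s f2"
    and f2_0: "j < length \<theta>s \<Longrightarrow> coef (f2 j) 0 = 0"
    and f2_hom: "j < length \<theta>s \<Longrightarrow> homogeneous (c2 + 1 - ds ! j) (f2 j)"
begin

lemma swap: "two_deletions \<alpha>2 \<alpha>1 D D2 D1 D12 \<theta>s ds \<phi>2 c2 f2 \<phi>1 c1 f1"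
  by unfold_locales
    (fact lin1 lin2 distinct[symmetric] hom gen free D1_iff D2_iff D12_iff1 D12_iff2 tf1 tf2 tf12_1 tf12_2
      \<phi>1_hom \<phi>1_mem \<phi>1_notin \<phi>1_span \<phi>1_rel f1_0 f1_hom \<phi>2_hom \<phi>2_mem \<phi>2_notin \<phi>2_span \<phi>2_rel f2_0 f2_hom)+

lemma h1: "homogeneous 1 \<alpha>1" and h2: "homogeneous 1 \<alpha>2"
  using lin1 lin2 by (auto simp: linear_form_def)

lemma nz1: "\<alpha>1 \<noteq> 0" and nz2: "\<alpha>2 \<noteq> 0"
  using lin1 lin2 by (auto simp: linear_form_def)

lemma coef_\<alpha>1_0: "coef \<alpha>1 0 = 0" and coef_\<alpha>2_0: "coef \<alpha>2 0 = 0"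
  using homogeneous_coef_0[OF h1] homogeneous_coef_0[OF h2] by auto

lemma length_ds: "length ds = length \<theta>s"
  using hom by (simp add: list_all2_lengthD)

lemma combD: "comb \<theta>s h \<in> D"
  using gen unfolding generated_eq by blast

lemma DE: "x \<in> D \<Longrightarrow> \<exists>h. x = comb \<theta>s h"
  using gen unfolding generated_eq by blast

lemma submodule_D: "submodule D"
  using submodule_generated gen by metis

lemma D_add: "x \<in> D \<Longrightarrow> y \<in> D \<Longrightarrow> x + y \<in> D" and D_smult: "x \<in> D \<Longrightarrow> s *s x \<in> D"
  using submodule_D by (auto simp: submodule_def)

lemma D_dcomp: "x \<in> D \<Longrightarrow> dcomp d x \<in> D"
  using DE[of x] combD by (auto simp: dcomp_comb[OF hom])

lemma submodule_D1: "submodule D1"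
  using submodule_D by (simp add: submodule_def D1_iff vector_add_ldistrib smult_smult_commute[of \<alpha>1])

lemma D1_smult: "x \<in> D1 \<Longrightarrow> s *s x \<in> D1" and D1_add: "x \<in> D1 \<Longrightarrow> y \<in> D1 \<Longrightarrow> x + y \<in> D1"
  using submodule_D1 by (auto simp: submodule_def)

lemma submodule_D12: "submodule D12"
  using submodule_D1 by (simp add: submodule_def D12_iff2 vector_add_ldistrib smult_smult_commute[of \<alpha>2])

lemma D_sub_D1: "x \<in> D \<Longrightarrow> x \<in> D1"
  by (simp add: D1_iff D_smult)

lemma D1_sub_D12: "x \<in> D1 \<Longrightarrow> x \<in> D12"
  by (simp add: D12_iff2 D1_smult)

lemma D1_dcomp: "x \<in> D1 \<Longrightarrow> dcomp d x \<in> D1"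
  using D_dcomp[of "\<alpha>1 *s x" "d + 1"] by (simp add: D1_iff dcomp_smult_homogeneous[OF h1])

lemma D12_dcomp: "x \<in> D12 \<Longrightarrow> dcomp d x \<in> D12"
  using D1_dcomp[of "\<alpha>2 *s x" "d + 1"] by (simp add: D12_iff2 dcomp_smult_homogeneous[OF h2])

lemma not_dvd: "\<not> \<alpha>1 dvd \<alpha>2"
  using linear_form_dvd_ker_eq[OF lin1 lin2] distinct by blast

lemma D1_Int_D2: "x \<in> D1 \<Longrightarrow> x \<in> D2 \<Longrightarrow> x \<in> D"
  using tf1[of x \<alpha>2] not_dvd by (auto simp: D2_iff)

lemma smult_\<phi>1: "s *s \<phi>1 \<in> D \<Longrightarrow> \<alpha>1 dvd s"
  using tf1 \<phi>1_mem \<phi>1_notin by blast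

lemma \<phi>1_span_homogeneous:
  assumes "x \<in> D1" "hom_der d x"
  obtains s h where "x = s *s \<phi>1 + comb \<theta>s h" "homogeneous (d - c1) s"
    "\<And>j. j < length \<theta>s \<Longrightarrow> homogeneous (d - ds ! j) (h j)"
proof -
  obtain s h where "x = s *s \<phi>1 + comb \<theta>s h" using \<phi>1_span assms(1) by blast
  then have "dcomp d x = hcomp (d - c1) s *s \<phi>1 + comb \<theta>s (\<lambda>j. hcomp (d - ds ! j) (h j))"
    by (simp add: dcomp_add dcomp_smult_hom_der[OF \<phi>1_hom] dcomp_comb[OF hom])
  then have "x = hcomp (d - c1) s *s \<phi>1 + comb \<theta>s (\<lambda>j. hcomp (d - ds ! j) (h j))"
    by (simp add: dcomp_hom_der[OF assms(2)])
  then show ?thesis by (rule that) (rule homogeneous_hcomp)+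
qed

lemma low_degree_D1:
  assumes "x \<in> D1" "hom_der d x" "d < c1"
  shows "x \<in> D"
proof -
  obtain s h where "x = s *s \<phi>1 + comb \<theta>s h" "homogeneous (d - c1) s"
    using \<phi>1_span_homogeneous[OF assms(1,2)] by blast
  then show ?thesis using homogeneous_negative[of "d - c1" s] assms(3) combD by simp
qed

text \<open>If \<open>\<phi>1\<close> were constant, comparing the coefficients of a variable in \<open>\<alpha>1 \<phi>1 = \<Sum> f1 j \<theta>s ! j\<close>
  would express it by constant parts of the \<open>\<theta>s ! j\<close>, which lie in \<open>D\<close>.\<close>

lemma c1_pos: "1 \<le> c1"
proof (rule ccontr)
  assume "\<not> 1 \<le> c1"
  have "c1 = 0"
  proof (rule ccontr)
    assume "c1 \<noteq> 0"
    then have "\<phi>1 = 0" using \<open>\<not> 1 \<le> c1\<close> by (intro hom_der_negative[OF \<phi>1_hom]) simp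
    then show False using \<phi>1_notin submodule_D by (simp add: submodule_def)
  qed
  obtain i where i: "coef \<alpha>1 (var_exp i) \<noteq> 0" using linear_form_coef[OF lin1] by blast
  let ?a = "coef \<alpha>1 (var_exp i)" and ?b = "\<lambda>j. coef (f1 j) (var_exp i)"
  have "const ?a *s \<phi>1 = (\<Sum>j<length \<theta>s. const (?b j) *s dcomp 0 (\<theta>s ! j))"
  proof (subst vec_eq_iff, rule allI)
    fix m
    have hc: "hcomp 0 p = const (coef p 0)" for p :: "('k, 'n) mpoly"
      using homogeneous_deg_0[OF homogeneous_hcomp[of 0 p]] by simp
    have "homogeneous 0 (\<phi>1 $ m)"
      using \<phi>1_hom by (simp add: hom_der_def \<open>c1 = 0\<close>)
    from homogeneous_deg_0[OF homogeneous_const_mult[OF this, of ?a]]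
    have l: "(const ?a *s \<phi>1) $ m = const (?a * coef (\<phi>1 $ m) 0)" by simp
    have "?a * coef (\<phi>1 $ m) 0 = coef ((\<alpha>1 *s \<phi>1) $ m) (var_exp i)"
      by (simp add: coef_var_exp_mult coef_\<alpha>1_0)
    also have "\<dots> = (\<Sum>j<length \<theta>s. ?b j * coef (\<theta>s ! j $ m) 0)"
      unfolding \<phi>1_rel comb_def sum_component lookup_sum
      by (intro sum.cong refl) (simp add: coef_var_exp_mult f1_0)
    finally show "(const ?a *s \<phi>1) $ m = (\<Sum>j<length \<theta>s. const (?b j) *s dcomp 0 (\<theta>s ! j)) $ m"
      unfolding l by (simp add: sum_component hc mult_single const_sum)
  qed
  also have "\<dots> \<in> D"
  proof -
    have "\<theta>s ! j \<in> D" if "j < length \<theta>s" for j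
      using set_subset_generated[of \<theta>s] gen that by auto
    then show ?thesis by (intro submodule_sum[OF submodule_D] D_smult D_dcomp) auto
  qed
  finally have "\<alpha>1 dvd const ?a" by (rule smult_\<phi>1)
  then obtain t where "const ?a = \<alpha>1 * t" by (rule dvdE)
  then have "?a = coef (\<alpha>1 * t) 0" by (metis lookup_single_eq)
  then show False using i coef_\<alpha>1_0 by simp
qed


subsection \<open>When the Euler restriction adds nothing to D\<close>

text \<open>The kernel of the Euler restriction \<open>\<rho>\<close> of \<open>D1\<close> is \<open>\<alpha>2 D12\<close>, and \<open>D1 = D + S\<phi>1\<close>.
  So this says \<open>D + ker \<rho> = D1\<close>.\<close>

definition reach1 :: bool where
  "reach1 \<longleftrightarrow> (\<exists>h. \<exists>x\<in>D12. \<phi>1 = comb \<theta>s h + \<alpha>2 *s x)"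

definition reach2 :: bool where
  "reach2 \<longleftrightarrow> (\<exists>h. \<exists>x\<in>D12. \<phi>2 = comb \<theta>s h + \<alpha>1 *s x)"

lemma swap_reach: "two_deletions.reach1 \<alpha>1 D12 \<theta>s \<phi>2 \<longleftrightarrow> reach2" "two_deletions.reach2 \<alpha>2 D12 \<theta>s \<phi>1 \<longleftrightarrow> reach1"
  by (simp_all add: two_deletions.reach1_def[OF swap] two_deletions.reach2_def[OF swap] reach1_def reach2_def)

lemma plus_kernel_subset: "D + {\<alpha>2 *s x | x. x \<in> D12} \<subseteq> D1"
proof
  fix y assume "y \<in> D + {\<alpha>2 *s x | x. x \<in> D12}"
  then obtain z x where "y = z + \<alpha>2 *s x" "z \<in> D" "x \<in> D12" by (auto elim!: set_plus_elim)
  then show "y \<in> D1" by (simp add: D1_add D_sub_D1 D12_iff2)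
qed

lemma plus_kernel_eq_iff: "D + {\<alpha>2 *s x | x. x \<in> D12} = D1 \<longleftrightarrow> reach1"
proof
  assume "D + {\<alpha>2 *s x | x. x \<in> D12} = D1"
  then have "\<phi>1 \<in> D + {\<alpha>2 *s x | x. x \<in> D12}" using \<phi>1_mem by simp
  then obtain y x where "\<phi>1 = y + \<alpha>2 *s x" "y \<in> D" "x \<in> D12" by (auto elim!: set_plus_elim)
  then show reach1 unfolding reach1_def using DE by blast
next
  assume reach1
  then obtain h x where x: "x \<in> D12" "\<phi>1 = comb \<theta>s h + \<alpha>2 *s x" unfolding reach1_def by blast
  have "D1 \<subseteq> D + {\<alpha>2 *s x | x. x \<in> D12}"
  proof
    fix y assume "y \<in> D1"
    then obtain s g where "y = s *s \<phi>1 + comb \<theta>s g" using \<phi>1_span by blast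
    then have eq: "y = (s *s comb \<theta>s h + comb \<theta>s g) + \<alpha>2 *s (s *s x)"
      by (simp add: x(2) vector_add_ldistrib smult_smult_commute[of s] algebra_simps)
    have "s *s x \<in> D12" using x(1) submodule_D12 by (simp add: submodule_def)
    then have "\<alpha>2 *s (s *s x) \<in> {\<alpha>2 *s x | x. x \<in> D12}" by blast
    then show "y \<in> D + {\<alpha>2 *s x | x. x \<in> D12}"
      unfolding eq by (intro set_plus_intro D_add D_smult combD)
  qed
  then show "D + {\<alpha>2 *s x | x. x \<in> D12} = D1" using plus_kernel_subset by blast
qed

lemma reach1_homogeneous:
  assumes reach1
  obtains k \<psi> where "\<psi> \<in> D12" "hom_der (c1 - 1) \<psi>" "\<phi>1 = comb \<theta>s k + \<alpha>2 *s \<psi>"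
    "\<And>j. j < length \<theta>s \<Longrightarrow> homogeneous (c1 - ds ! j) (k j)"
proof -
  obtain h x where x: "x \<in> D12" "\<phi>1 = comb \<theta>s h + \<alpha>2 *s x" using assms unfolding reach1_def by blast
  have "dcomp c1 \<phi>1 = comb \<theta>s (\<lambda>j. hcomp (c1 - ds ! j) (h j)) + \<alpha>2 *s dcomp (c1 - 1) x"
    unfolding x(2) by (simp add: dcomp_add dcomp_comb[OF hom] dcomp_smult_homogeneous[OF h2])
  then have "\<phi>1 = comb \<theta>s (\<lambda>j. hcomp (c1 - ds ! j) (h j)) + \<alpha>2 *s dcomp (c1 - 1) x"
    by (simp add: dcomp_hom_der[OF \<phi>1_hom])
  then show ?thesis
    by (rule that[OF D12_dcomp[OF x(1)] hom_der_dcomp]) (rule homogeneous_hcomp)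
qed

text \<open>The component of degree \<open>c1\<close> of the equation has a nonzero constant multiple of \<open>\<phi>1\<close> and
  can be solved for it.\<close>

lemma reach1_if_coef:
  assumes x: "x \<in> D12" "\<alpha>2 *s x = q *s \<phi>1 + comb \<theta>s h" and q: "coef q 0 \<noteq> 0"
  shows reach1
proof -
  let ?q = "coef q 0"
  have "\<alpha>2 *s dcomp (c1 - 1) x = hcomp 0 q *s \<phi>1 + comb \<theta>s (\<lambda>j. hcomp (c1 - ds ! j) (h j))"
    using arg_cong[OF x(2), of "dcomp c1"]
    by (simp add: dcomp_add dcomp_smult_homogeneous[OF h2] dcomp_smult_hom_der[OF \<phi>1_hom] dcomp_comb[OF hom])
  also have "hcomp 0 q = const ?q"
    using homogeneous_deg_0[OF homogeneous_hcomp[of 0 q]] by simp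
  finally have "const ?q *s \<phi>1 = comb \<theta>s (\<lambda>j. - hcomp (c1 - ds ! j) (h j)) + \<alpha>2 *s dcomp (c1 - 1) x"
    by (simp add: comb_uminus[symmetric])
  then have "const (inverse ?q) *s (const ?q *s \<phi>1)
      = const (inverse ?q) *s comb \<theta>s (\<lambda>j. - hcomp (c1 - ds ! j) (h j)) + \<alpha>2 *s (const (inverse ?q) *s dcomp (c1 - 1) x)"
    by (simp only: vector_add_ldistrib smult_smult_commute[of \<alpha>2])
  then have "\<phi>1 = comb \<theta>s (\<lambda>j. const (inverse ?q) * - hcomp (c1 - ds ! j) (h j)) + \<alpha>2 *s (const (inverse ?q) *s dcomp (c1 - 1) x)"
    using q by (simp add: vector_smult_assoc mult_single comb_smult)
  moreover have "const (inverse ?q) *s dcomp (c1 - 1) x \<in> D12"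
    using D12_dcomp[OF x(1)] submodule_D12 by (simp add: submodule_def)
  ultimately show ?thesis unfolding reach1_def by blast
qed

text \<open>Multiplication with \<open>\<alpha>2\<close> leads from \<open>D12\<close> to \<open>D1 = D + S\<phi>1\<close>, where \<open>\<phi>1\<close> is \<open>\<alpha>2 \<psi>\<close>
  modulo \<open>D\<close>. Division by \<open>\<alpha>2\<close> leads back and turns \<open>D\<close> into \<open>D2\<close>.\<close>

lemma D12_generated_over_D2:
  assumes \<psi>: "\<psi> \<in> D12" "\<phi>1 = comb \<theta>s k + \<alpha>2 *s \<psi>" and x: "x \<in> D12"
  shows "\<exists>s. x - s *s \<psi> \<in> D2"
proof -
  obtain s h where "\<alpha>2 *s x = s *s \<phi>1 + comb \<theta>s h" using x \<phi>1_span[of "\<alpha>2 *s x"] by (auto simp: D12_iff2)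
  then have "\<alpha>2 *s (x - s *s \<psi>) = s *s comb \<theta>s k + comb \<theta>s h"
    by (simp add: \<psi>(2) vector_ssub_ldistrib vector_add_ldistrib smult_smult_commute[of \<alpha>2])
  also have "\<dots> \<in> D" by (intro D_add D_smult combD)
  finally show ?thesis by (auto simp: D2_iff)
qed

lemma smult_\<psi>:
  assumes \<psi>: "\<psi> \<in> D12" "\<phi>1 = comb \<theta>s k + \<alpha>2 *s \<psi>" and s: "s *s \<psi> \<in> D2"
  shows "\<alpha>1 dvd s"
proof -
  have "\<psi> \<notin> D2" using \<phi>1_notin \<psi>(2) D_add[OF combD] by (auto simp: D2_iff)
  then show ?thesis using tf12_1[OF \<psi>(1) s] by blast
qed

lemma \<psi>_notin_D1:
  assumes \<psi>: "hom_der (c1 - 1) \<psi>" "\<phi>1 = comb \<theta>s k + \<alpha>2 *s \<psi>"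
  shows "\<psi> \<notin> D1"
proof
  assume "\<psi> \<in> D1"
  then have "\<psi> \<in> D" using low_degree_D1[OF _ \<psi>(1)] by simp
  then show False using \<phi>1_notin \<psi>(2) D_add[OF combD] D_smult by simp
qed


lemma \<theta>s_D12: "set \<theta>s \<subseteq> D12"
  using set_subset_generated[of \<theta>s] D_sub_D1 D1_sub_D12 by (auto simp: gen)

subsection \<open>The first case\<close>

text \<open>The derivation \<open>\<alpha>1 \<psi>\<close> of degree \<open>c1 \<le> c2\<close> lies in \<open>D2 = D + S\<phi>2\<close>. If \<open>\<phi>2\<close> did not
  occur in it, \<open>\<alpha>1 \<psi>\<close> would be in \<open>D\<close> and \<open>\<psi>\<close> in \<open>D1\<close>; so the degrees are equal and \<open>\<phi>2\<close>
  occurs with a constant coefficient.\<close>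

lemma \<phi>2_reached:
  assumes "c1 \<le> c2" and \<psi>: "\<psi> \<in> D12" "hom_der (c1 - 1) \<psi>" "\<phi>1 = comb \<theta>s k + \<alpha>2 *s \<psi>"
  shows "\<exists>e h. \<phi>2 = const e *s (\<alpha>1 *s \<psi>) + comb \<theta>s h"
proof -
  interpret sw: two_deletions \<alpha>2 \<alpha>1 D D2 D1 D12 \<theta>s ds \<phi>2 c2 f2 \<phi>1 c1 f1 by (rule swap)
  have "\<alpha>1 *s \<psi> \<in> D2" using \<psi>(1) by (simp add: D12_iff1)
  moreover have "hom_der c1 (\<alpha>1 *s \<psi>)" using hom_der_smult[OF h1 \<psi>(2)] by simp
  ultimately obtain s h where s: "\<alpha>1 *s \<psi> = s *s \<phi>2 + comb \<theta>s h" "homogeneous (c1 - c2) s"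
    by (rule sw.\<phi>1_span_homogeneous) blast
  have "coef s 0 \<noteq> 0"
  proof
    assume "coef s 0 = 0"
    then have "s = 0" using homogeneous_nonpositive[OF s(2)] assms(1) by simp
    then have "\<psi> \<in> D1" using s(1) combD by (simp add: D1_iff)
    then show False using \<psi>_notin_D1[OF \<psi>(2,3)] by blast
  qed
  then have "c1 - c2 = 0" using homogeneous_coef_0[OF s(2)] by blast
  then obtain e where e: "s = const e" "e \<noteq> 0" using homogeneous_deg_0[of s] s(2) \<open>coef s 0 \<noteq> 0\<close> by metis
  have "const e *s \<phi>2 = \<alpha>1 *s \<psi> - comb \<theta>s h" using s(1) e(1) by simp
  then have "const (inverse e) *s (const e *s \<phi>2) = const (inverse e) *s (\<alpha>1 *s \<psi>) - const (inverse e) *s comb \<theta>s h"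
    by (simp only: vector_ssub_ldistrib)
  then have "\<phi>2 = const (inverse e) *s (\<alpha>1 *s \<psi>) + comb \<theta>s (\<lambda>j. - (const (inverse e) * h j))"
    using e(2) by (simp add: vector_smult_assoc mult_single comb_smult comb_uminus[symmetric])
  then show ?thesis by blast
qed

lemma reach1_imp_reach2:
  assumes reach1 "c1 \<le> c2"
  shows reach2
proof -
  obtain k \<psi> where \<psi>: "\<psi> \<in> D12" "hom_der (c1 - 1) \<psi>" "\<phi>1 = comb \<theta>s k + \<alpha>2 *s \<psi>"
    using reach1_homogeneous[OF assms(1)] by blast
  obtain e h where "\<phi>2 = const e *s (\<alpha>1 *s \<psi>) + comb \<theta>s h" using \<phi>2_reached[OF assms(2) \<psi>] by blast
  then have "\<phi>2 = comb \<theta>s h + \<alpha>1 *s (const e *s \<psi>)" by (simp add: smult_smult_commute[of \<alpha>1] add.commute)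
  moreover have "const e *s \<psi> \<in> D12" using \<psi>(1) submodule_D12 by (simp add: submodule_def)
  ultimately show ?thesis unfolding reach2_def by blast
qed

text \<open>Now both \<open>\<phi>1\<close> and \<open>\<phi>2\<close> lie in \<open>D + S\<psi>\<close>, and \<open>\<psi>\<close> is outside \<open>D1\<close> and \<open>D2\<close>; hence
  \<open>a \<psi> \<in> D\<close> exactly if both \<open>\<alpha>1\<close> and \<open>\<alpha>2\<close> divide \<open>a\<close>.\<close>

lemma resolution_case1:
  assumes reach1 "c1 \<le> c2"
  shows "\<exists>fs. length fs = length \<theta>s \<and> min_free_res [c1 + 1] [(\<alpha>1 * \<alpha>2) # fs] ((c1 - 1) # ds) D12"
proof -
  interpret sw: two_deletions \<alpha>2 \<alpha>1 D D2 D1 D12 \<theta>s ds \<phi>2 c2 f2 \<phi>1 c1 f1 by (rule swap)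
  obtain k \<psi> where \<psi>: "\<psi> \<in> D12" "hom_der (c1 - 1) \<psi>" "\<phi>1 = comb \<theta>s k + \<alpha>2 *s \<psi>"
    and k: "\<And>j. j < length \<theta>s \<Longrightarrow> homogeneous (c1 - ds ! j) (k j)"
    using reach1_homogeneous[OF assms(1)] by blast
  obtain e h where e: "\<phi>2 = const e *s (\<alpha>1 *s \<psi>) + comb \<theta>s h" using \<phi>2_reached[OF assms(2) \<psi>] by blast
  let ?r = "\<lambda>j. \<alpha>1 * k j - f1 j"
  have gen12: "generated (\<psi> # \<theta>s) = D12"
  proof
    show "generated (\<psi> # \<theta>s) \<subseteq> D12"
      using \<psi>(1) \<theta>s_D12 by (intro generated_subset submodule_D12) auto
    show "D12 \<subseteq> generated (\<psi> # \<theta>s)"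
    proof
      fix x assume "x \<in> D12"
      then obtain s where "x - s *s \<psi> \<in> D2" using D12_generated_over_D2[OF \<psi>(1,3)] by blast
      then obtain t h' where t: "x - s *s \<psi> = t *s \<phi>2 + comb \<theta>s h'" using \<phi>2_span by blast
      have "x = s *s \<psi> + (x - s *s \<psi>)" by simp
      also have "\<dots> = (s + t * (const e * \<alpha>1)) *s \<psi> + comb \<theta>s (\<lambda>j. t * h j + h' j)"
        unfolding t e comb_add[symmetric] comb_smult[symmetric]
        by (simp add: vector_add_ldistrib vector_sadd_rdistrib vector_smult_assoc add.assoc)
      finally show "x \<in> generated (\<psi> # \<theta>s)" unfolding generated_Cons by blast
    qed
  qed
  have rel: "(\<alpha>1 * \<alpha>2) *s \<psi> + comb \<theta>s ?r = 0"
  proof -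
    have "(\<alpha>1 * \<alpha>2) *s \<psi> = \<alpha>1 *s (\<phi>1 - comb \<theta>s k)" by (simp add: \<psi>(3) vector_smult_assoc)
    also have "\<dots> = - comb \<theta>s ?r"
      by (simp add: vector_ssub_ldistrib \<phi>1_rel comb_smult comb_diff comb_uminus)
    finally show ?thesis by simp
  qed
  have rels: "\<exists>w. a = w * (\<alpha>1 * \<alpha>2) \<and> (\<forall>j<length \<theta>s. h j = w * ?r j)" if "a *s \<psi> + comb \<theta>s h = 0" for a h
  proof -
    have "a *s \<psi> = comb \<theta>s (\<lambda>j. - h j)" using that by (simp add: comb_uminus[symmetric] eq_neg_iff_add_eq_0)
    then have "a *s \<psi> \<in> D" using combD by (simp only:)
    then have "\<alpha>1 dvd a" "\<alpha>2 dvd a"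
      using smult_\<psi>[OF \<psi>(1,3)] tf12_2[OF \<psi>(1)] \<psi>_notin_D1[OF \<psi>(2,3)] D_sub_D1 sw.D_sub_D1 by blast+
    obtain t where t: "a = \<alpha>1 * t" using \<open>\<alpha>1 dvd a\<close> by blast
    then have "\<alpha>2 dvd t" using \<open>\<alpha>2 dvd a\<close> linear_form_prime[OF lin2] sw.not_dvd by blast
    then obtain w where "t = \<alpha>2 * w" by blast
    then have w: "a = w * (\<alpha>1 * \<alpha>2)" using t by (simp add: mult_ac)
    have "comb \<theta>s (\<lambda>j. h j - w * ?r j) = (a *s \<psi> + comb \<theta>s h) - w *s ((\<alpha>1 * \<alpha>2) *s \<psi> + comb \<theta>s ?r)"
      by (simp add: w vector_add_ldistrib vector_smult_assoc comb_smult comb_diff)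
    then have "h j - w * ?r j = 0" if "j < length \<theta>s" for j
      using free[of "\<lambda>j. h j - w * ?r j"] that \<open>a *s \<psi> + comb \<theta>s h = 0\<close> rel by simp
    then show ?thesis using w by auto
  qed
  let ?fs = "map ?r [0..<length \<theta>s]"
  have "min_free_res [c1 + 1] [(\<alpha>1 * \<alpha>2) # ?fs] ((c1 - 1) # ds) D12"
  proof (rule min_free_res_one_relation[where ts = "\<psi> # \<theta>s" and ?j0.0 = 0])
    show "list_all2 hom_der ((c1 - 1) # ds) (\<psi> # \<theta>s)" using hom \<psi>(2) by simp
    show "comb (\<psi> # \<theta>s) (\<lambda>j. ((\<alpha>1 * \<alpha>2) # ?fs) ! j) = 0"
      using rel comb_cong[of \<theta>s "\<lambda>j. ?fs ! j" ?r] by (simp add: comb_Cons)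
    show "\<exists>v. \<forall>j<length ((c1 - 1) # ds). h j = v * ((\<alpha>1 * \<alpha>2) # ?fs) ! j" if rel: "comb (\<psi> # \<theta>s) h = 0" for h
    proof -
      obtain w where "h 0 = w * (\<alpha>1 * \<alpha>2)" "\<forall>j<length \<theta>s. h (Suc j) = w * ?r j"
        using rel rels[of "h 0" "\<lambda>j. h (Suc j)"] unfolding comb_Cons by blast
      then show ?thesis by (intro exI[of _ w]) (auto simp: less_Suc_eq_0_disj length_ds)
    qed
    fix j assume j: "j < length ((c1 - 1) # ds)"
    have "homogeneous 2 (\<alpha>1 * \<alpha>2)" using homogeneous_mult[OF h1 h2] by simp
    moreover have "homogeneous (c1 + 1 - ds ! i) (?r i)" if "i < length \<theta>s" for i
      using homogeneous_mult[OF h1 k[OF that]] f1_hom[OF that] by (intro homogeneous_diff) (simp_all add: algebra_simps)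
    ultimately show "homogeneous (c1 + 1 - ((c1 - 1) # ds) ! j) (((\<alpha>1 * \<alpha>2) # ?fs) ! j)"
      using j by (cases j) (auto simp: length_ds)
    show "coef (((\<alpha>1 * \<alpha>2) # ?fs) ! j) 0 = 0"
      using j by (cases j) (auto simp: length_ds coef_\<alpha>1_0 f1_0 lookup_minus)
  qed (use gen12 length_ds nz1 nz2 in \<open>auto simp: poly_mult_eq_0_iff\<close>)
  then show ?thesis by (intro exI[of _ ?fs]) simp
qed


subsection \<open>The second and the third case\<close>

text \<open>Here \<open>\<phi>2\<close> is reached by a \<open>\<psi>\<close> of degree \<open>c2 - 1\<close>, and \<open>D12 = D + S\<phi>1 + S\<psi>\<close>. The second
  relation expands \<open>\<alpha>2 \<psi>\<close> in \<open>D1 = D + S\<phi>1\<close>. Whether the generators are minimal depends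
  only on the coefficients \<open>g'\<close>, since the other ones have no constant term.\<close>

context
  fixes \<psi> :: "('k, 'n) der" and k g' :: "nat \<Rightarrow> ('k, 'n) mpoly" and g :: "('k, 'n) mpoly"
  assumes not_reach1: "\<not> reach1"
    and \<psi>: "\<psi> \<in> D12" "hom_der (c2 - 1) \<psi>" "\<phi>2 = comb \<theta>s k + \<alpha>1 *s \<psi>"
    and g_rel: "\<alpha>2 *s \<psi> = g *s \<phi>1 + comb \<theta>s g'"
    and g_hom: "homogeneous (c2 - c1) g"
    and g'_hom: "\<And>j. j < length \<theta>s \<Longrightarrow> homogeneous (c2 - ds ! j) (g' j)"
begin

lemma g_ne_0: "g \<noteq> 0"
proof
  interpret sw: two_deletions \<alpha>2 \<alpha>1 D D2 D1 D12 \<theta>s ds \<phi>2 c2 f2 \<phi>1 c1 f1 by (rule swap)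
  assume "g = 0"
  then have "\<psi> \<in> D2" using g_rel combD by (simp add: D2_iff)
  then show False using sw.\<psi>_notin_D1[OF \<psi>(2,3)] by blast
qed

lemma g_coef_0: "coef g 0 = 0"
  using reach1_if_coef[OF \<psi>(1) g_rel] not_reach1 by blast

lemma c1_less_c2: "c1 < c2"
  using homogeneous_nonpositive[OF g_hom] g_coef_0 g_ne_0 by force

lemma generated_case23: "generated (\<phi>1 # \<psi> # \<theta>s) = D12"
proof
  interpret sw: two_deletions \<alpha>2 \<alpha>1 D D2 D1 D12 \<theta>s ds \<phi>2 c2 f2 \<phi>1 c1 f1 by (rule swap)
  show "generated (\<phi>1 # \<psi> # \<theta>s) \<subseteq> D12"
    using \<psi>(1) D1_sub_D12[OF \<phi>1_mem] \<theta>s_D12 by (intro generated_subset submodule_D12) auto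
  show "D12 \<subseteq> generated (\<phi>1 # \<psi> # \<theta>s)"
  proof
    fix x assume "x \<in> D12"
    then obtain s where "x - s *s \<psi> \<in> D1" using sw.D12_generated_over_D2[OF \<psi>(1,3)] by blast
    then obtain t h where t: "x - s *s \<psi> = t *s \<phi>1 + comb \<theta>s h" using \<phi>1_span by blast
    have "x = t *s \<phi>1 + comb (\<psi> # \<theta>s) (case_nat s h)"
      using t by (simp add: comb_Cons algebra_simps)
    then show "x \<in> generated (\<phi>1 # \<psi> # \<theta>s)" unfolding generated_Cons by blast
  qed
qed

text \<open>The second relation clears the coefficient of \<open>\<psi>\<close>, the first one that of \<open>\<phi>1\<close>, and the
  \<open>\<theta>s\<close> are independent.\<close>

lemma relations_case23:
  assumes eq: "a *s \<phi>1 + (b *s \<psi> + comb \<theta>s h) = 0"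
  shows "\<exists>v w. a = v * \<alpha>1 + w * g \<and> b = - (w * \<alpha>2) \<and> (\<forall>j<length \<theta>s. h j = w * g' j - v * f1 j)"
proof -
  interpret sw: two_deletions \<alpha>2 \<alpha>1 D D2 D1 D12 \<theta>s ds \<phi>2 c2 f2 \<phi>1 c1 f1 by (rule swap)
  have "b *s \<psi> = (- a) *s \<phi>1 + comb \<theta>s (\<lambda>j. - h j)"
    using eq by (simp add: comb_uminus[symmetric] vector_smult_lneg eq_neg_iff_add_eq_0 algebra_simps)
  also have "\<dots> \<in> D1" by (intro D1_add D1_smult \<phi>1_mem D_sub_D1 combD)
  finally have "\<alpha>2 dvd b" by (rule sw.smult_\<psi>[OF \<psi>(1,3)])
  then obtain w' where "b = \<alpha>2 * w'" by blast
  then obtain w where w: "b = - (w * \<alpha>2)" by (metis minus_mult_left minus_minus mult.commute)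
  have "(a - w * g) *s \<phi>1 + comb \<theta>s (\<lambda>j. h j - w * g' j)
      = (a *s \<phi>1 + (b *s \<psi> + comb \<theta>s h)) + w *s (\<alpha>2 *s \<psi> - (g *s \<phi>1 + comb \<theta>s g'))"
    by (simp add: w vector_add_ldistrib vector_ssub_ldistrib vector_sub_rdistrib vector_smult_assoc
        vector_smult_lneg comb_smult comb_diff[symmetric] algebra_simps)
  then have 1: "(a - w * g) *s \<phi>1 + comb \<theta>s (\<lambda>j. h j - w * g' j) = 0" using eq g_rel by simp
  then have "(a - w * g) *s \<phi>1 = comb \<theta>s (\<lambda>j. - (h j - w * g' j))"
    by (simp only: comb_uminus[symmetric] eq_neg_iff_add_eq_0)
  then have "(a - w * g) *s \<phi>1 \<in> D" using combD by (simp only:)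
  then have "\<alpha>1 dvd a - w * g" by (rule smult_\<phi>1)
  then obtain v where v: "a - w * g = v * \<alpha>1" by (metis dvdE mult.commute)
  have "comb \<theta>s (\<lambda>j. h j - w * g' j + v * f1 j) = (a - w * g) *s \<phi>1 + comb \<theta>s (\<lambda>j. h j - w * g' j)"
    unfolding v vector_smult_assoc[symmetric] \<phi>1_rel by (simp add: comb_smult comb_add add.commute)
  then have "comb \<theta>s (\<lambda>j. h j - w * g' j + v * f1 j) = 0" using 1 by simp
  then have h: "h j - w * g' j + v * f1 j = 0" if "j < length \<theta>s" for j using free that by blast
  have "h j = w * g' j - v * f1 j" if "j < length \<theta>s" for j
    using h[OF that] by (simp add: algebra_simps)
  moreover have "a = v * \<alpha>1 + w * g" using v by (simp add: algebra_simps)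
  ultimately show ?thesis using w by blast
qed

lemma relations_case23_list:
  assumes "comb (\<phi>1 # \<psi> # \<theta>s) h = 0"
  shows "\<exists>v w. h 0 = v * \<alpha>1 + w * g \<and> h (Suc 0) = - (w * \<alpha>2) \<and>
    (\<forall>j<length \<theta>s. h (Suc (Suc j)) = w * g' j - v * f1 j)"
  using relations_case23[of "h 0" "h (Suc 0)" "\<lambda>j. h (Suc (Suc j))"] assms by (simp add: comb_Cons)

lemma length_case2:
  assumes g'_0: "\<And>j. j < length \<theta>s \<Longrightarrow> coef (g' j) 0 = 0" and xs: "generated xs = D12"
  shows "length \<theta>s + 2 \<le> length xs"
proof -
  have "\<forall>j<length (\<phi>1 # \<psi> # \<theta>s). coef (h j) 0 = 0" if rel: "comb (\<phi>1 # \<psi> # \<theta>s) h = 0" for h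
  proof -
    obtain v w where vw: "h 0 = v * \<alpha>1 + w * g" "h (Suc 0) = - (w * \<alpha>2)"
      "\<forall>j<length \<theta>s. h (Suc (Suc j)) = w * g' j - v * f1 j"
      using relations_case23_list[OF rel] by blast
    have "coef (h 0) 0 = 0" "coef (h (Suc 0)) 0 = 0"
      by (simp_all add: vw(1,2) lookup_add g_coef_0 coef_\<alpha>1_0 coef_\<alpha>2_0)
    moreover have "coef (h (Suc (Suc j))) 0 = 0" if "j < length \<theta>s" for j
      using vw(3) that by (simp add: lookup_minus g'_0 f1_0)
    ultimately show ?thesis by (auto simp: less_Suc_eq_0_disj)
  qed
  from minimal_length_le[OF this, of xs] show ?thesis using xs generated_case23 by simp
qed

lemma resolution_case2:
  assumes g'_0: "\<And>j. j < length \<theta>s \<Longrightarrow> coef (g' j) 0 = 0"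
  shows "\<exists>fs gs g. length fs = length \<theta>s \<and> length gs = length \<theta>s \<and> g \<noteq> 0 \<and>
    min_free_res [c1 + 1, c2] [\<alpha>1 # 0 # fs, g # \<alpha>2 # gs] (c1 # (c2 - 1) # ds) D12"
proof -
  let ?fs = "map (\<lambda>j. - f1 j) [0..<length \<theta>s]" and ?gs = "map (\<lambda>j. - g' j) [0..<length \<theta>s]"
  let ?ts = "\<phi>1 # \<psi> # \<theta>s" and ?bs = "c1 # (c2 - 1) # ds"
  have c: "comb \<theta>s (\<lambda>j. ?fs ! j) = - comb \<theta>s f1" "comb \<theta>s (\<lambda>j. ?gs ! j) = - comb \<theta>s g'"
    unfolding comb_uminus by (rule comb_cong, simp)+
  have "min_free_res [c1 + 1, c2] [\<alpha>1 # 0 # ?fs, (- g) # \<alpha>2 # ?gs] ?bs D12"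
  proof (rule min_free_res_two_relations[where ts = ?ts])
    show "list_all2 hom_der ?bs ?ts" using hom \<psi>(2) \<phi>1_hom by simp
    show "comb ?ts (\<lambda>j. (\<alpha>1 # 0 # ?fs) ! j) = 0"
      using c(1) by (simp add: comb_Cons \<phi>1_rel)
    show "comb ?ts (\<lambda>j. (- g # \<alpha>2 # ?gs) ! j) = 0"
      using c(2) by (simp add: comb_Cons g_rel vector_smult_lneg)
    show "\<exists>v w. \<forall>j<length ?bs. h j = v * (\<alpha>1 # 0 # ?fs) ! j + w * (- g # \<alpha>2 # ?gs) ! j"
      if rel: "comb ?ts h = 0" for h
    proof -
      obtain v w where "h 0 = v * \<alpha>1 + w * g" "h (Suc 0) = - (w * \<alpha>2)"
        "\<forall>j<length \<theta>s. h (Suc (Suc j)) = w * g' j - v * f1 j"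
        using relations_case23_list[OF rel] by blast
      then show ?thesis
        by (intro exI[of _ v] exI[of _ "- w"]) (auto simp: less_Suc_eq_0_disj length_ds)
    qed
    show "v = 0 \<and> w = 0"
      if *: "\<And>j. j < length ?bs \<Longrightarrow> v * (\<alpha>1 # 0 # ?fs) ! j + w * (- g # \<alpha>2 # ?gs) ! j = 0" for v w
      using *[of 0] *[of 1] nz1 nz2 by (auto simp: poly_mult_eq_0_iff)
    fix j assume j: "j < length ?bs"
    then consider "j = 0" | "j = 1" | i where "j = Suc (Suc i)" "i < length \<theta>s"
      by (cases j; cases "j - 1") (auto simp: length_ds)
    note j_cases = this
    show "homogeneous (c1 + 1 - ?bs ! j) ((\<alpha>1 # 0 # ?fs) ! j)"
      by (cases rule: j_cases) (simp_all add: h1 homogeneous_uminus f1_hom)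
    show "homogeneous (c2 - ?bs ! j) ((- g # \<alpha>2 # ?gs) ! j)"
      by (cases rule: j_cases) (simp_all add: h2 homogeneous_uminus g_hom g'_hom)
    show "coef ((\<alpha>1 # 0 # ?fs) ! j) 0 = 0"
      by (cases rule: j_cases) (simp_all add: coef_\<alpha>1_0 f1_0)
    show "coef ((- g # \<alpha>2 # ?gs) ! j) 0 = 0"
      by (cases rule: j_cases) (simp_all add: coef_\<alpha>2_0 g_coef_0 g'_0)
  qed (use generated_case23 length_ds in auto)
  then show ?thesis using g_ne_0 by (intro exI[of _ ?fs] exI[of _ ?gs] exI[of _ "- g"]) simp
qed

text \<open>A constant coefficient of the second relation removes a generator \<open>\<theta>s ! i\<close> of degree \<open>c2\<close>.
  By its degree \<open>c1 + 1 - c2\<close>, the coefficient of this generator in the first relation is zero,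
  so that this relation survives without change.\<close>

lemma resolution_case3:
  assumes i: "i < length \<theta>s" and g'_i: "coef (g' i) 0 \<noteq> 0"
  shows "ds ! i = c2"
    and "\<exists>fs. length fs = length \<theta>s - 1 \<and>
      min_free_res [c1 + 1] [\<alpha>1 # 0 # fs] (c1 # (c2 - 1) # take i ds @ drop (Suc i) ds) D12"
    and "generated xs = D12 \<Longrightarrow> length \<theta>s + 1 \<le> length xs"
proof -
  show dsi: "ds ! i = c2" using homogeneous_coef_0[OF g'_hom[OF i]] g'_i by force
  let ?rs = "take i \<theta>s @ drop (Suc i) \<theta>s" and ?es = "take i ds @ drop (Suc i) ds"
  let ?ts = "\<phi>1 # \<psi> # ?rs" and ?bs = "c1 # (c2 - 1) # ?es"
  let ?skip = "\<lambda>j. if j < i then j else Suc j"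
  let ?fs = "map (\<lambda>j. - f1 (?skip j)) [0..<length \<theta>s - 1]"
  have len_rs: "length ?rs = length \<theta>s - 1" and len_es: "length ?es = length \<theta>s - 1"
    using i length_ds by auto
  have skip: "?skip j < length \<theta>s" if "j < length \<theta>s - 1" for j using that by auto
  have f1_i: "f1 i = 0"
    using homogeneous_nonpositive[OF f1_hom[OF i] _ f1_0[OF i]] c1_less_c2 dsi by simp
  have comb_rs: "comb ?rs h = comb \<theta>s (\<lambda>j. if j < i then h j else if j = i then 0 else h (j - 1))" for h
    by (rule comb_omit_nth[OF i])
  have gen: "generated ?ts = D12"
  proof
    have rs: "set ?rs \<subseteq> set \<theta>s" by (auto dest: in_set_takeD in_set_dropD)
    then have "set ?ts \<subseteq> D12"
      using set_subset_generated[of "\<phi>1 # \<psi> # \<theta>s"] generated_case23 by auto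
    then show "generated ?ts \<subseteq> D12" by (intro generated_subset submodule_D12)
    have sub: "submodule (generated ?ts)" by (rule submodule_generated)
    have mem: "\<phi>1 \<in> generated ?ts" "\<psi> \<in> generated ?ts" "set ?rs \<subseteq> generated ?ts"
      using set_subset_generated[of ?ts] by auto
    obtain e where e: "g' i = const e" "e \<noteq> 0"
      using homogeneous_deg_0[of "g' i"] g'_hom[OF i] g'_i dsi by (metis diff_self)
    let ?h = "\<lambda>j. g' (?skip j)"
    have "comb \<theta>s g' = const e *s \<theta>s ! i + comb ?rs ?h"
    proof -
      have "comb \<theta>s g' = comb \<theta>s (\<lambda>j. (if j = i then const e else 0)
          + (if j < i then ?h j else if j = i then 0 else ?h (j - 1)))"
        by (rule comb_cong) (auto simp: e)
      then show ?thesis unfolding comb_add[symmetric] comb_delta[OF i] comb_rs .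
    qed
    then have "const e *s \<theta>s ! i = \<alpha>2 *s \<psi> + ((- g) *s \<phi>1 + comb ?rs (\<lambda>j. - ?h j))"
      by (simp add: g_rel vector_smult_lneg comb_uminus[symmetric])
    also have "\<dots> \<in> generated ?ts"
      using sub mem submodule_comb[OF sub mem(3)] by (simp add: submodule_def)
    finally have "const (inverse e) *s (const e *s \<theta>s ! i) \<in> generated ?ts"
      using sub by (simp add: submodule_def)
    then have "\<theta>s ! i \<in> generated ?ts" using e(2) by (simp add: vector_smult_assoc mult_single)
    then have "set (\<phi>1 # \<psi> # \<theta>s) \<subseteq> generated ?ts"
      using mem set_subset_insert_omit_nth[of \<theta>s i] by auto
    then show "D12 \<subseteq> generated ?ts" unfolding generated_case23[symmetric] by (intro generated_subset sub)
  qed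
  have rels: "\<exists>v. h 0 = v * \<alpha>1 \<and> h (Suc 0) = 0 \<and> (\<forall>j<length \<theta>s - 1. h (Suc (Suc j)) = v * - f1 (?skip j))"
    if "comb ?ts h = 0" for h
  proof -
    \<comment> \<open>as a relation of all generators, it has the coefficient \<open>0\<close> at \<open>i\<close>\<close>
    let ?H = "\<lambda>j. if j < i then h (Suc (Suc j)) else if j = i then 0 else h (Suc (Suc (j - 1)))"
    have "h 0 *s \<phi>1 + (h (Suc 0) *s \<psi> + comb \<theta>s ?H) = 0"
      using that by (simp only: comb_Cons comb_rs)
    then obtain v w where vw: "h 0 = v * \<alpha>1 + w * g" "h (Suc 0) = - (w * \<alpha>2)"
      "\<forall>j<length \<theta>s. ?H j = w * g' j - v * f1 j"
      using relations_case23 by blast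
    have "g' i \<noteq> 0" using g'_i by auto
    moreover have "w * g' i = 0" using vw(3)[rule_format, OF i] f1_i by simp
    ultimately have "w = 0" by (simp add: poly_mult_eq_0_iff)
    moreover have "h (Suc (Suc j)) = v * - f1 (?skip j)" if "j < length \<theta>s - 1" for j
      using vw(3)[rule_format, OF skip[OF that]] \<open>w = 0\<close> by (auto split: if_splits)
    ultimately show ?thesis using vw(1,2) by (intro exI[of _ v]) auto
  qed
  have "\<forall>j<length ?ts. coef (h j) 0 = 0" if rel: "comb ?ts h = 0" for h
  proof -
    obtain v where "h 0 = v * \<alpha>1" "h (Suc 0) = 0" "\<forall>j<length \<theta>s - 1. h (Suc (Suc j)) = v * - f1 (?skip j)"
      using rels[OF rel] by blast
    then show ?thesis using f1_0 skip coef_\<alpha>1_0 len_rs by (auto simp: less_Suc_eq_0_disj simp del: length_append)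
  qed
  from minimal_length_le[OF this, of xs] show "generated xs = D12 \<Longrightarrow> length \<theta>s + 1 \<le> length xs"
    using gen i by simp
  have c: "comb ?rs (\<lambda>j. ?fs ! j) = - comb \<theta>s f1"
    unfolding comb_rs comb_uminus by (rule comb_cong) (use i in \<open>auto simp: f1_i\<close>)
  have "min_free_res [c1 + 1] [\<alpha>1 # 0 # ?fs] ?bs D12"
  proof (rule min_free_res_one_relation[where ts = ?ts and ?j0.0 = 0])
    show "list_all2 hom_der ?bs ?ts" using list_all2_omit_nth[OF hom] \<psi>(2) \<phi>1_hom by simp
    show "comb ?ts (\<lambda>j. (\<alpha>1 # 0 # ?fs) ! j) = 0"
      using c by (simp add: comb_Cons \<phi>1_rel)
    show "\<exists>v. \<forall>j<length ?bs. h j = v * (\<alpha>1 # 0 # ?fs) ! j" if rel: "comb ?ts h = 0" for h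
    proof -
      obtain v where "h 0 = v * \<alpha>1" "h (Suc 0) = 0" "\<forall>j<length \<theta>s - 1. h (Suc (Suc j)) = v * - f1 (?skip j)"
        using rels[OF rel] by blast
      then show ?thesis
        using len_es by (intro exI[of _ v]) (auto simp: less_Suc_eq_0_disj simp del: length_append)
    qed
    fix j assume j: "j < length ?bs"
    then consider "j = 0" | "j = 1" | i' where "j = Suc (Suc i')" "i' < length \<theta>s - 1"
      using len_es by (cases j; cases "j - 1") (auto simp del: length_append)
    note j_cases = this
    have "homogeneous (c1 + 1 - ?es ! i') (- f1 (?skip i'))" if "i' < length \<theta>s - 1" for i'
      using f1_hom[OF skip[OF that]] nth_omit_nth[of i ds i'] i that length_ds by (simp add: homogeneous_uminus)
    then show "homogeneous (c1 + 1 - ?bs ! j) ((\<alpha>1 # 0 # ?fs) ! j)"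
      by (cases rule: j_cases) (simp_all add: h1 cong: if_cong split del: if_split)
    show "coef ((\<alpha>1 # 0 # ?fs) ! j) 0 = 0"
      using f1_0 skip by (cases rule: j_cases) (simp_all add: coef_\<alpha>1_0)
  qed (use gen len_es nz1 in auto)
  then show "\<exists>fs. length fs = length \<theta>s - 1 \<and> min_free_res [c1 + 1] [\<alpha>1 # 0 # fs] ?bs D12"
    by (intro exI[of _ ?fs]) simp
qed

end

lemma reach2_data:
  assumes reach2
  obtains \<psi> k g g' where "\<psi> \<in> D12" "hom_der (c2 - 1) \<psi>" "\<phi>2 = comb \<theta>s k + \<alpha>1 *s \<psi>"
    "\<alpha>2 *s \<psi> = g *s \<phi>1 + comb \<theta>s g'" "homogeneous (c2 - c1) g"
    "\<And>j. j < length \<theta>s \<Longrightarrow> homogeneous (c2 - ds ! j) (g' j)"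
proof -
  interpret sw: two_deletions \<alpha>2 \<alpha>1 D D2 D1 D12 \<theta>s ds \<phi>2 c2 f2 \<phi>1 c1 f1 by (rule swap)
  have "sw.reach1" using assms swap_reach by blast
  then obtain k \<psi> where \<psi>: "\<psi> \<in> D12" "hom_der (c2 - 1) \<psi>" "\<phi>2 = comb \<theta>s k + \<alpha>1 *s \<psi>"
    by (rule sw.reach1_homogeneous) blast
  have "\<alpha>2 *s \<psi> \<in> D1" using \<psi>(1) by (simp add: D12_iff2)
  moreover have "hom_der c2 (\<alpha>2 *s \<psi>)" using hom_der_smult[OF h2 \<psi>(2)] by simp
  ultimately obtain g g' where "\<alpha>2 *s \<psi> = g *s \<phi>1 + comb \<theta>s g'" "homogeneous (c2 - c1) g"
    "\<And>j. j < length \<theta>s \<Longrightarrow> homogeneous (c2 - ds ! j) (g' j)"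
    by (rule \<phi>1_span_homogeneous) blast
  then show ?thesis using that \<psi> by blast
qed


subsection \<open>The fourth case\<close>

text \<open>Both multiples of \<open>x\<close> are expanded. The coefficients of \<open>\<phi>1\<close> and \<open>\<phi>2\<close> have no constant
  term, since otherwise \<open>x\<close> would show that these are reached. The two expansions of \<open>\<alpha>1 \<alpha>2 x\<close>
  over \<open>\<theta>s\<close> agree; their linear parts are multiples of \<open>\<alpha>1\<close> and of \<open>\<alpha>2\<close>, which are independent,
  so that the remaining coefficients have no constant term either.\<close>

lemma expansion_no_constants:
  assumes nr: "\<not> reach1" "\<not> reach2" and x: "x \<in> D12"
  obtains q h where "\<alpha>2 *s x = q *s \<phi>1 + comb \<theta>s h" "coef q 0 = 0" "\<And>j. j < length \<theta>s \<Longrightarrow> coef (h j) 0 = 0"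
proof -
  interpret sw: two_deletions \<alpha>2 \<alpha>1 D D2 D1 D12 \<theta>s ds \<phi>2 c2 f2 \<phi>1 c1 f1 by (rule swap)
  obtain q h where q: "\<alpha>2 *s x = q *s \<phi>1 + comb \<theta>s h" using x \<phi>1_span[of "\<alpha>2 *s x"] by (auto simp: D12_iff2)
  obtain q' h' where q': "\<alpha>1 *s x = q' *s \<phi>2 + comb \<theta>s h'" using x \<phi>2_span[of "\<alpha>1 *s x"] by (auto simp: D12_iff1)
  have q0: "coef q 0 = 0" using reach1_if_coef[OF x q] nr(1) by blast
  have q'0: "coef q' 0 = 0" using sw.reach1_if_coef[OF x q'] nr(2) swap_reach by blast
  have "comb \<theta>s (\<lambda>j. (q * f1 j + \<alpha>1 * h j) - (q' * f2 j + \<alpha>2 * h' j))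
      = (q *s (\<alpha>1 *s \<phi>1) + \<alpha>1 *s comb \<theta>s h) - (q' *s (\<alpha>2 *s \<phi>2) + \<alpha>2 *s comb \<theta>s h')"
    unfolding \<phi>1_rel \<phi>2_rel by (simp only: comb_smult comb_add comb_diff)
  also have "\<dots> = \<alpha>1 *s (\<alpha>2 *s x) - \<alpha>2 *s (\<alpha>1 *s x)"
    unfolding q q' by (simp add: vector_add_ldistrib smult_smult_commute[of q] smult_smult_commute[of q'])
  also have "\<dots> = 0" by (simp add: smult_smult_commute[of \<alpha>1])
  finally have eq: "q * f1 j + \<alpha>1 * h j = q' * f2 j + \<alpha>2 * h' j" if "j < length \<theta>s" for j
    using free that by fastforce
  have "coef (h j) 0 = 0" if j: "j < length \<theta>s" for j
  proof -
    have "coef (h j) 0 * coef \<alpha>1 (var_exp i) = coef (h' j) 0 * coef \<alpha>2 (var_exp i)" for i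
      using arg_cong[OF eq[OF j], of "\<lambda>p. coef p (var_exp i)"]
      by (simp add: lookup_add coef_var_exp_mult q0 q'0 f1_0[OF j] f2_0[OF j] coef_\<alpha>1_0 coef_\<alpha>2_0 mult.commute)
    then show ?thesis using linear_forms_independent[OF lin1 lin2 distinct] by blast
  qed
  then show ?thesis using that q q0 by blast
qed

lemma expansion_order2:
  assumes nr: "\<not> reach1" "\<not> reach2" and xs: "generated xs = D12" and x: "x \<in> mgenerated xs"
  obtains q h where "\<alpha>2 *s x = q *s \<phi>1 + comb \<theta>s h" "order2 q" "\<And>j. j < length \<theta>s \<Longrightarrow> order2 (h j)"
proof -
  obtain p where p: "x = comb xs p" "\<forall>i<length xs. coef (p i) 0 = 0" using x unfolding mgenerated_def by blast
  have "xs ! i \<in> D12" if "i < length xs" for i using set_subset_generated[of xs] xs that by auto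
  then have "\<exists>q h. \<alpha>2 *s xs ! i = q *s \<phi>1 + comb \<theta>s h \<and> coef q 0 = 0 \<and> (\<forall>j<length \<theta>s. coef (h j) 0 = 0)"
    if "i < length xs" for i
    using expansion_no_constants[OF nr] that by metis
  then obtain q h where qh: "\<alpha>2 *s xs ! i = q i *s \<phi>1 + comb \<theta>s (h i)" "coef (q i) 0 = 0"
    "\<forall>j<length \<theta>s. coef (h i j) 0 = 0" if "i < length xs" for i
    by metis
  let ?q = "\<Sum>i<length xs. p i * q i" and ?h = "\<lambda>j. \<Sum>i<length xs. p i * h i j"
  have "\<alpha>2 *s x = (\<Sum>i<length xs. p i *s (\<alpha>2 *s xs ! i))"
    unfolding p(1) comb_def smult_sum by (simp add: smult_smult_commute[of \<alpha>2])
  also have "\<dots> = (\<Sum>i<length xs. (p i * q i) *s \<phi>1 + comb \<theta>s (\<lambda>j. p i * h i j))"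
    by (intro sum.cong refl) (simp add: qh(1) vector_add_ldistrib vector_smult_assoc comb_smult)
  also have "\<dots> = ?q *s \<phi>1 + comb \<theta>s ?h"
    by (simp add: sum.distrib sum_smult comb_sum)
  finally have "\<alpha>2 *s x = ?q *s \<phi>1 + comb \<theta>s ?h" .
  moreover have "order2 ?q" using p(2) qh(2) by (intro order2_sum order2_mult) auto
  moreover have "order2 (?h j)" if "j < length \<theta>s" for j
    using p(2) qh(3) that by (intro order2_sum order2_mult) auto
  ultimately show ?thesis by (rule that)
qed

text \<open>In the expansion of \<open>\<alpha>2\<close> times the element all linear parts vanish. Comparing it with the
  direct expansion, in which the constants \<open>a\<close> and \<open>c j\<close> appear multiplied with \<open>\<alpha>2\<close>, gives
  \<open>a = 0\<close>, as \<open>\<alpha>2\<close> is independent of \<open>\<alpha>1\<close>, and then \<open>c j = 0\<close>. The constant \<open>b\<close> is not seen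
  by \<open>\<alpha>2\<close>; it vanishes by the same argument with the hyperplanes exchanged.\<close>

lemma independent_mod_aux:
  assumes nr: "\<not> reach1" "\<not> reach2" and xs: "generated xs = D12"
    and mem: "const a *s \<phi>1 + (const b *s \<phi>2 + comb \<theta>s (\<lambda>j. const (c j))) \<in> mgenerated xs"
  shows "a = 0 \<and> (b = 0 \<longrightarrow> (\<forall>j<length \<theta>s. c j = 0))"
proof -
  let ?x = "const a *s \<phi>1 + (const b *s \<phi>2 + comb \<theta>s (\<lambda>j. const (c j)))"
  obtain q h where q: "\<alpha>2 *s ?x = q *s \<phi>1 + comb \<theta>s h" "order2 q" "\<And>j. j < length \<theta>s \<Longrightarrow> order2 (h j)"
    using expansion_order2[OF nr xs mem] by blast
  let ?g = "\<lambda>j. const b * f2 j + \<alpha>2 * const (c j) - h j"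
  have "\<alpha>2 *s ?x = (\<alpha>2 * const a) *s \<phi>1 + (const b *s (\<alpha>2 *s \<phi>2) + \<alpha>2 *s comb \<theta>s (\<lambda>j. const (c j)))"
    by (simp add: vector_add_ldistrib vector_smult_assoc mult.commute)
  then have "q *s \<phi>1 - (\<alpha>2 * const a) *s \<phi>1
      = const b *s (\<alpha>2 *s \<phi>2) + \<alpha>2 *s comb \<theta>s (\<lambda>j. const (c j)) - comb \<theta>s h"
    using q(1) by (simp add: algebra_simps)
  also have "\<dots> = comb \<theta>s ?g"
    unfolding \<phi>2_rel by (simp only: comb_smult comb_add comb_diff)
  finally have eq: "(q - \<alpha>2 * const a) *s \<phi>1 = comb \<theta>s ?g" by (simp add: vector_sub_rdistrib)
  then have "(q - \<alpha>2 * const a) *s \<phi>1 \<in> D" using combD by (simp only:)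
  then have "\<alpha>1 dvd q - \<alpha>2 * const a" by (rule smult_\<phi>1)
  then obtain t where t: "q - \<alpha>2 * const a = \<alpha>1 * t" by blast
  have "coef t 0 * coef \<alpha>1 (var_exp i) = (- a) * coef \<alpha>2 (var_exp i)" for i
  proof -
    have "- (coef \<alpha>2 (var_exp i) * a) = coef \<alpha>1 (var_exp i) * coef t 0"
      using arg_cong[OF t, of "\<lambda>p. coef p (var_exp i)"] q(2)
      by (simp add: lookup_minus coef_var_exp_mult order2_def coef_\<alpha>1_0 coef_\<alpha>2_0)
    then show ?thesis by (simp add: mult.commute)
  qed
  from linear_forms_independent[OF lin1 lin2 distinct this] have t0: "coef t 0 = 0" and a: "a = 0" by auto
  have "comb \<theta>s (\<lambda>j. t * f1 j - ?g j) = (q - \<alpha>2 * const a) *s \<phi>1 - comb \<theta>s ?g"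
    unfolding t vector_smult_assoc[symmetric] smult_smult_commute[of \<alpha>1] \<phi>1_rel comb_smult comb_diff ..
  then have zero: "t * f1 j - ?g j = 0" if "j < length \<theta>s" for j
    using free[of "\<lambda>j. t * f1 j - ?g j" j] that eq by simp
  have "c j = 0" if b: "b = 0" and j: "j < length \<theta>s" for j
  proof -
    obtain i where i: "coef \<alpha>2 (var_exp i) \<noteq> 0" using linear_form_coef[OF lin2] by blast
    have "t * f1 j = \<alpha>2 * const (c j) - h j" using zero[OF j] b by simp
    from arg_cong[OF this, of "\<lambda>p. coef p (var_exp i)"] have "coef \<alpha>2 (var_exp i) * c j = 0"
      using q(3)[OF j] by (simp add: lookup_minus coef_var_exp_mult order2_def t0 f1_0[OF j] coef_\<alpha>2_0)
    then show ?thesis using i by simp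
  qed
  then show ?thesis using a by blast
qed

lemma independent_mod:
  assumes nr: "\<not> reach1" "\<not> reach2" and xs: "generated xs = D12"
    and mem: "const a *s \<phi>1 + (const b *s \<phi>2 + comb \<theta>s (\<lambda>j. const (c j))) \<in> mgenerated xs"
  shows "a = 0 \<and> b = 0 \<and> (\<forall>j<length \<theta>s. c j = 0)"
proof -
  interpret sw: two_deletions \<alpha>2 \<alpha>1 D D2 D1 D12 \<theta>s ds \<phi>2 c2 f2 \<phi>1 c1 f1 by (rule swap)
  have "const b *s \<phi>2 + (const a *s \<phi>1 + comb \<theta>s (\<lambda>j. const (c j))) \<in> mgenerated xs"
    using mem by (simp add: add.left_commute)
  then have "b = 0" using sw.independent_mod_aux[OF _ _ xs] nr swap_reach by blast
  then show ?thesis using independent_mod_aux[OF nr xs mem] by blast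
qed

text \<open>By independence \<open>\<phi>1, \<phi>2, \<theta>s\<close> belong to a minimal system of generators of \<open>D12\<close>, and
  a further generator outside of their span would raise its length above the bound.\<close>

lemma generated_case4:
  assumes nr: "\<not> reach1" "\<not> reach2" and xs: "generated xs = D12" "list_all2 hom_der es xs"
    and le: "length xs \<le> length \<theta>s + 2"
  shows "generated (\<phi>1 # \<phi>2 # \<theta>s) = D12"
proof
  interpret sw: two_deletions \<alpha>2 \<alpha>1 D D2 D1 D12 \<theta>s ds \<phi>2 c2 f2 \<phi>1 c1 f1 by (rule swap)
  let ?N = "generated (\<phi>1 # \<phi>2 # \<theta>s)"
  have sub: "submodule ?N" by (rule submodule_generated)
  show "?N \<subseteq> D12"
    using D1_sub_D12[OF \<phi>1_mem] sw.D1_sub_D12[OF \<phi>2_mem] \<theta>s_D12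
    by (intro generated_subset submodule_D12) auto
  have "set xs \<subseteq> ?N"
  proof (rule graded_nakayama[OF xs(2) sub])
    fix y d assume "y \<in> ?N"
    then obtain h where h: "y = comb (\<phi>1 # \<phi>2 # \<theta>s) h" unfolding generated_eq by blast
    have "list_all2 hom_der (c1 # c2 # ds) (\<phi>1 # \<phi>2 # \<theta>s)" using \<phi>1_hom \<phi>2_hom hom by simp
    from dcomp_comb[OF this] show "dcomp d y \<in> ?N" unfolding h generated_eq by blast
  next
    fix \<xi> assume \<xi>: "\<xi> \<in> set xs"
    show "\<exists>y\<in>?N. \<exists>z\<in>mgenerated xs. \<xi> = y + z"
    proof (rule ccontr)
      assume no: "\<not> ?thesis"
      let ?ts = "\<xi> # \<phi>1 # \<phi>2 # \<theta>s"
      have "\<forall>j<length ?ts. c j = 0" if mem: "comb ?ts (\<lambda>j. const (c j)) \<in> mgenerated xs" for c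
      proof -
        let ?y = "comb (\<phi>1 # \<phi>2 # \<theta>s) (\<lambda>j. const (c (Suc j)))"
        have mem': "const (c 0) *s \<xi> + ?y \<in> mgenerated xs" using mem by (simp add: comb_Cons)
        have "c 0 = 0"
        proof (rule ccontr)
          assume c: "c 0 \<noteq> 0"
          let ?u = "const (inverse (c 0)) :: ('k, 'n) mpoly"
          have "?u *s (const (c 0) *s \<xi> + ?y) \<in> mgenerated xs"
            by (rule mgenerated_smult_mgenerated[OF mem'])
          moreover have "(- ?u) *s ?y \<in> ?N"
            using sub unfolding submodule_def generated_eq by blast
          moreover have "\<xi> = (- ?u) *s ?y + ?u *s (const (c 0) *s \<xi> + ?y)"
            using c by (simp add: vector_add_ldistrib vector_smult_lneg vector_smult_assoc mult_single)
          ultimately show False using no by blast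
        qed
        then have "?y \<in> mgenerated xs" using mem' by simp
        then have "c (Suc 0) = 0 \<and> c (Suc (Suc 0)) = 0 \<and> (\<forall>j<length \<theta>s. c (Suc (Suc (Suc j))) = 0)"
          unfolding comb_Cons by (rule independent_mod[OF nr xs(1)])
        then show ?thesis using \<open>c 0 = 0\<close> by (auto simp: less_Suc_eq_0_disj)
      qed
      moreover have "set ?ts \<subseteq> generated xs"
        using \<xi> set_subset_generated[of xs] \<open>?N \<subseteq> D12\<close> set_subset_generated[of "\<phi>1 # \<phi>2 # \<theta>s"] xs(1) by auto
      ultimately have "length ?ts \<le> length xs" by (rule independent_mod_length_le)
      then show False using le by simp
    qed
  qed
  then show "D12 \<subseteq> ?N" unfolding xs(1)[symmetric] by (intro generated_subset sub)
qed

text \<open>Both \<open>a \<phi>1\<close> and \<open>b \<phi>2\<close> lie in \<open>D1 \<inter> D2 = D\<close>.\<close>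

lemma relations_case4:
  assumes eq: "a *s \<phi>1 + (b *s \<phi>2 + comb \<theta>s h) = 0"
  shows "\<exists>v w. a = v * \<alpha>1 \<and> b = w * \<alpha>2 \<and> (\<forall>j<length \<theta>s. h j = v * - f1 j + w * - f2 j)"
proof -
  interpret sw: two_deletions \<alpha>2 \<alpha>1 D D2 D1 D12 \<theta>s ds \<phi>2 c2 f2 \<phi>1 c1 f1 by (rule swap)
  have neg: "comb \<theta>s (\<lambda>j. - h j) \<in> D" by (rule combD)
  have "a *s \<phi>1 = (- b) *s \<phi>2 + comb \<theta>s (\<lambda>j. - h j)"
    using eq by (simp add: comb_uminus[symmetric] vector_smult_lneg eq_neg_iff_add_eq_0 algebra_simps)
  also have "\<dots> \<in> D2" by (intro sw.D1_add sw.D1_smult \<phi>2_mem sw.D_sub_D1 neg)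
  finally have aD: "a *s \<phi>1 \<in> D" using D1_Int_D2 D1_smult \<phi>1_mem by blast
  have "b *s \<phi>2 = (- a) *s \<phi>1 + comb \<theta>s (\<lambda>j. - h j)"
    using eq by (simp add: comb_uminus[symmetric] vector_smult_lneg eq_neg_iff_add_eq_0 algebra_simps)
  also have "\<dots> \<in> D1" by (intro D1_add D1_smult \<phi>1_mem D_sub_D1 neg)
  finally have bD: "b *s \<phi>2 \<in> D" using D1_Int_D2 sw.D1_smult \<phi>2_mem by blast
  obtain v where v: "a = v * \<alpha>1" using smult_\<phi>1[OF aD] by (metis dvdE mult.commute)
  obtain w where w: "b = w * \<alpha>2" using sw.smult_\<phi>1[OF bD] by (metis dvdE mult.commute)
  have "comb \<theta>s (\<lambda>j. v * f1 j + (w * f2 j + h j)) = a *s \<phi>1 + (b *s \<phi>2 + comb \<theta>s h)"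
    unfolding v w vector_smult_assoc[symmetric] \<phi>1_rel \<phi>2_rel comb_smult comb_add ..
  then have zero: "v * f1 j + (w * f2 j + h j) = 0" if "j < length \<theta>s" for j
    using free[of "\<lambda>j. v * f1 j + (w * f2 j + h j)" j] that eq by simp
  have "h j = v * - f1 j + w * - f2 j" if "j < length \<theta>s" for j
  proof -
    have "h j = (v * - f1 j + w * - f2 j) + (v * f1 j + (w * f2 j + h j))" by simp
    then show ?thesis using zero[OF that] by simp
  qed
  then show ?thesis using v w by blast
qed

lemma resolution_case4:
  assumes gen12: "generated (\<phi>1 # \<phi>2 # \<theta>s) = D12"
  shows "\<exists>fs gs. length fs = length \<theta>s \<and> length gs = length \<theta>s \<and>
    min_free_res [c1 + 1, c2 + 1] [\<alpha>1 # 0 # fs, 0 # \<alpha>2 # gs] (c1 # c2 # ds) D12"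
proof -
  let ?fs = "map (\<lambda>j. - f1 j) [0..<length \<theta>s]" and ?gs = "map (\<lambda>j. - f2 j) [0..<length \<theta>s]"
  let ?ts = "\<phi>1 # \<phi>2 # \<theta>s" and ?bs = "c1 # c2 # ds"
  have c: "comb \<theta>s (\<lambda>j. ?fs ! j) = - comb \<theta>s f1" "comb \<theta>s (\<lambda>j. ?gs ! j) = - comb \<theta>s f2"
    unfolding comb_uminus by (rule comb_cong, simp)+
  have "min_free_res [c1 + 1, c2 + 1] [\<alpha>1 # 0 # ?fs, 0 # \<alpha>2 # ?gs] ?bs D12"
  proof (rule min_free_res_two_relations[where ts = ?ts])
    show "list_all2 hom_der ?bs ?ts" using hom \<phi>1_hom \<phi>2_hom by simp
    show "comb ?ts (\<lambda>j. (\<alpha>1 # 0 # ?fs) ! j) = 0"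
      using c(1) by (simp add: comb_Cons \<phi>1_rel)
    show "comb ?ts (\<lambda>j. (0 # \<alpha>2 # ?gs) ! j) = 0"
      using c(2) by (simp add: comb_Cons \<phi>2_rel)
    show "\<exists>v w. \<forall>j<length ?bs. h j = v * (\<alpha>1 # 0 # ?fs) ! j + w * (0 # \<alpha>2 # ?gs) ! j"
      if rel: "comb ?ts h = 0" for h
    proof -
      have "h 0 *s \<phi>1 + (h (Suc 0) *s \<phi>2 + comb \<theta>s (\<lambda>j. h (Suc (Suc j)))) = 0"
        using rel by (simp add: comb_Cons)
      then obtain v w where "h 0 = v * \<alpha>1" "h (Suc 0) = w * \<alpha>2"
        "\<forall>j<length \<theta>s. h (Suc (Suc j)) = v * - f1 j + w * - f2 j"
        using relations_case4 by blast
      then show ?thesis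
        by (intro exI[of _ v] exI[of _ w]) (auto simp: less_Suc_eq_0_disj length_ds)
    qed
    show "v = 0 \<and> w = 0"
      if *: "\<And>j. j < length ?bs \<Longrightarrow> v * (\<alpha>1 # 0 # ?fs) ! j + w * (0 # \<alpha>2 # ?gs) ! j = 0" for v w
      using *[of 0] *[of 1] nz1 nz2 by (auto simp: poly_mult_eq_0_iff)
    fix j assume j: "j < length ?bs"
    then consider "j = 0" | "j = 1" | i where "j = Suc (Suc i)" "i < length \<theta>s"
      by (cases j; cases "j - 1") (auto simp: length_ds)
    note j_cases = this
    show "homogeneous (c1 + 1 - ?bs ! j) ((\<alpha>1 # 0 # ?fs) ! j)"
      by (cases rule: j_cases) (simp_all add: h1 homogeneous_uminus f1_hom)
    show "homogeneous (c2 + 1 - ?bs ! j) ((0 # \<alpha>2 # ?gs) ! j)"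
      by (cases rule: j_cases) (simp_all add: h2 homogeneous_uminus f2_hom)
    show "coef ((\<alpha>1 # 0 # ?fs) ! j) 0 = 0"
      by (cases rule: j_cases) (simp_all add: coef_\<alpha>1_0 f1_0)
    show "coef ((0 # \<alpha>2 # ?gs) ! j) 0 = 0"
      by (cases rule: j_cases) (simp_all add: coef_\<alpha>2_0 f2_0)
  qed (use gen12 length_ds in auto)
  then show ?thesis by (intro exI[of _ ?fs] exI[of _ ?gs]) simp
qed

end


section \<open>The resolutions of the double deletion\<close>

theorem theorem3p8:
  fixes A :: "('k::field ^ 'n::finite) set set"
    and H1 H2 :: "('k ^ 'n) set"
    and \<alpha>1 \<alpha>2 :: "('k, 'n) mpoly"
    and ds :: "int list"
    and c1 c2 :: int
    and dsB :: "int multiset"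
  assumes "arrangement A"
    and "free_with_exp A ds"
    and "hd ds = 1"
    and "H1 \<in> A" "H2 \<in> A" "H1 \<noteq> H2"
    and "linear_form \<alpha>1" "H1 = ker_form \<alpha>1"
    and "linear_form \<alpha>2" "H2 = ker_form \<alpha>2"
    and "SPOG_with (A - {H1}) ds c1"
    and "SPOG_with (A - {H2}) ds c2"
    and "c1 \<le> c2"
    and "DS (A - {H1, H2}) dsB"
    and "size dsB \<le> CARD('n) + 2"
  shows
    "let D = log_der A; D1 = log_der (A - {H1}); D2 = log_der (A - {H2});
         D12 = log_der (A - {H1, H2});
         K12 = ker_euler_restriction (A - {H1}) \<alpha>2;
         K21 = ker_euler_restriction (A - {H2}) \<alpha>1;
         case1 = (D + K12 = D1);
         case2 = (D + K12 \<subset> D1 \<and> D + K21 = D2 \<and> size dsB = CARD('n) + 2);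
         case3 = (D + K12 \<subset> D1 \<and> D + K21 = D2 \<and> size dsB = CARD('n) + 1);
         case4 = (D + K21 \<subset> D2)
     in
       (case1 \<or> case2 \<or> case3 \<or> case4) \<and>
       (case1 \<longrightarrow>
          (\<exists>fs. length fs = CARD('n) \<and>
             min_free_res [c1 + 1] [(\<alpha>1 * \<alpha>2) # fs] ((c1 - 1) # ds) D12)) \<and>
       (case2 \<longrightarrow>
          (\<exists>fs gs g. length fs = CARD('n) \<and> length gs = CARD('n) \<and> g \<noteq> 0 \<and>
             min_free_res [c1 + 1, c2]
               [\<alpha>1 # 0 # fs,
                g # \<alpha>2 # gs]
               (c1 # (c2 - 1) # ds) D12)) \<and>
       (case3 \<longrightarrow>
          (\<exists>es fs. mset es = mset (tl ds) \<and> length fs = CARD('n) - 1 \<and>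
             min_free_res [c1 + 1] [\<alpha>1 # 0 # fs]
               (c1 # (c2 - 1) # butlast (hd ds # es)) D12) \<and>
          SPOG (A - {H1, H2})) \<and>
       (case4 \<longrightarrow>
          (\<exists>fs gs. length fs = CARD('n) \<and> length gs = CARD('n) \<and>
             min_free_res [c1 + 1, c2 + 1]
               [\<alpha>1 # 0 # fs,
                0 # \<alpha>2 # gs]
               (c1 # c2 # ds) D12))"
proof -
  note lin = assms(7,9) and H = assms(8,10)
  have distinct: "ker_form \<alpha>1 \<noteq> ker_form \<alpha>2" using assms(6) H by simp
  let ?D = "log_der A" and ?D1 = "log_der (A - {H1})" and ?D2 = "log_der (A - {H2})"
    and ?D12 = "log_der (A - {H1, H2})"
  have sets: "A - {H1, H2} = A - {H2} - {ker_form \<alpha>1}" "A - {H1, H2} = A - {H1} - {ker_form \<alpha>2}"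
    using H by auto
  obtain \<theta>s where len_ds: "length ds = CARD('n)" and \<theta>: "list_all2 hom_der ds \<theta>s" "generated \<theta>s = ?D"
    and free': "\<forall>us. length us = length \<theta>s \<and> lin_comb \<theta>s us = 0 \<longrightarrow> (\<forall>u\<in>set us. u = 0)"
    using assms(2) unfolding free_with_exp_def by blast
  have free: "h j = 0" if "comb \<theta>s h = 0" "j < length \<theta>s" for h j
    by (rule free_relations_trivial[OF free' that])
  obtain \<phi>1 f1 where 1: "hom_der c1 \<phi>1" "\<phi>1 \<in> ?D1" "\<phi>1 \<notin> ?D"
    "\<And>x. x \<in> ?D1 \<Longrightarrow> \<exists>s h. x = s *s \<phi>1 + comb \<theta>s h"
    "\<alpha>1 *s \<phi>1 = comb \<theta>s f1" "\<And>j. j < length \<theta>s \<Longrightarrow> coef (f1 j) 0 = 0"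
    "\<And>j. j < length \<theta>s \<Longrightarrow> homogeneous (c1 + 1 - ds ! j) (f1 j)"
  proof (rule SPOG_deletion[OF lin(1) \<theta> _ assms(11)[unfolded H(1)]])
    show "h j = 0" if "comb \<theta>s h = 0" "j < length \<theta>s" for h j using that by (rule free)
  qed (rule that[unfolded H(1)])
  obtain \<phi>2 f2 where 2: "hom_der c2 \<phi>2" "\<phi>2 \<in> ?D2" "\<phi>2 \<notin> ?D"
    "\<And>x. x \<in> ?D2 \<Longrightarrow> \<exists>s h. x = s *s \<phi>2 + comb \<theta>s h"
    "\<alpha>2 *s \<phi>2 = comb \<theta>s f2" "\<And>j. j < length \<theta>s \<Longrightarrow> coef (f2 j) 0 = 0"
    "\<And>j. j < length \<theta>s \<Longrightarrow> homogeneous (c2 + 1 - ds ! j) (f2 j)"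
  proof (rule SPOG_deletion[OF lin(2) \<theta> _ assms(12)[unfolded H(2)]])
    show "h j = 0" if "comb \<theta>s h = 0" "j < length \<theta>s" for h j using that by (rule free)
  qed (rule that[unfolded H(2)])
  interpret two_deletions \<alpha>1 \<alpha>2 ?D ?D1 ?D2 ?D12 \<theta>s ds \<phi>1 c1 f1 \<phi>2 c2 f2
  proof unfold_locales
    show "x \<in> ?D1 \<longleftrightarrow> \<alpha>1 *s x \<in> ?D" "x \<in> ?D2 \<longleftrightarrow> \<alpha>2 *s x \<in> ?D" for x
      unfolding H by (rule log_der_remove_iff lin)+
    show "x \<in> ?D12 \<longleftrightarrow> \<alpha>1 *s x \<in> ?D2" for x
      unfolding sets(1) by (rule log_der_remove_iff lin)+
    show "x \<in> ?D12 \<longleftrightarrow> \<alpha>2 *s x \<in> ?D1" for x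
      unfolding sets(2) by (rule log_der_remove_iff lin)+
    show "\<alpha>1 dvd s \<or> x \<in> ?D" if "x \<in> ?D1" "s *s x \<in> ?D" for x s
      using log_der_remove_torsion_free[OF lin(1)] that unfolding H by blast
    show "\<alpha>2 dvd s \<or> x \<in> ?D" if "x \<in> ?D2" "s *s x \<in> ?D" for x s
      using log_der_remove_torsion_free[OF lin(2)] that unfolding H by blast
    show "\<alpha>1 dvd s \<or> x \<in> ?D2" if "x \<in> ?D12" "s *s x \<in> ?D2" for x s
      using log_der_remove_torsion_free[OF lin(1)] that unfolding sets(1) by blast
    show "\<alpha>2 dvd s \<or> x \<in> ?D1" if "x \<in> ?D12" "s *s x \<in> ?D1" for x s
      using log_der_remove_torsion_free[OF lin(2)] that unfolding sets(2) by blast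
  qed (fact lin distinct \<theta> free 1 2)+
  interpret sw: two_deletions \<alpha>2 \<alpha>1 ?D ?D2 ?D1 ?D12 \<theta>s ds \<phi>2 c2 f2 \<phi>1 c1 f1 by (rule swap)
  have len: "length \<theta>s = CARD('n)" using length_ds len_ds by simp
  have K: "ker_euler_restriction (A - {H1}) \<alpha>2 = {\<alpha>2 *s x | x. x \<in> ?D12}"
    "ker_euler_restriction (A - {H2}) \<alpha>1 = {\<alpha>1 *s x | x. x \<in> ?D12}"
    unfolding ker_euler_restriction_eq[OF lin(1)] ker_euler_restriction_eq[OF lin(2)] sets[symmetric] by simp_all
  have reach1_eqs: "?D + ker_euler_restriction (A - {H1}) \<alpha>2 = ?D1 \<longleftrightarrow> reach1"
    "?D + ker_euler_restriction (A - {H1}) \<alpha>2 \<subset> ?D1 \<longleftrightarrow> \<not> reach1"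
    unfolding K using plus_kernel_eq_iff plus_kernel_subset by blast+
  have reach2_eqs: "?D + ker_euler_restriction (A - {H2}) \<alpha>1 = ?D2 \<longleftrightarrow> reach2"
    "?D + ker_euler_restriction (A - {H2}) \<alpha>1 \<subset> ?D2 \<longleftrightarrow> \<not> reach2"
    unfolding K swap_reach[symmetric] using sw.plus_kernel_eq_iff sw.plus_kernel_subset by blast+
  obtain xs es where dsB: "dsB = mset es" and xs: "list_all2 hom_der es xs" "generated xs = ?D12"
    and irr: "\<forall>j<length xs. generated (take j xs @ drop (Suc j) xs) \<noteq> ?D12"
    using assms(14) unfolding DS_def by blast
  have size: "size dsB = length xs" using xs(1) by (simp add: dsB list_all2_lengthD)
  have shortest: "length xs \<le> length ys" if "generated ys = ?D12" for ys
    using minimal_length_le[of xs ys] irredundant_relations[OF xs(1)] irr that xs(2) by metis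
  have case23: "(size dsB = CARD('n) + 2 \<longrightarrow>
        (\<exists>fs gs g. length fs = CARD('n) \<and> length gs = CARD('n) \<and> g \<noteq> 0 \<and>
          min_free_res [c1 + 1, c2] [\<alpha>1 # 0 # fs, g # \<alpha>2 # gs] (c1 # (c2 - 1) # ds) ?D12)) \<and>
      (size dsB = CARD('n) + 1 \<longrightarrow>
        (\<exists>es fs. mset es = mset (tl ds) \<and> length fs = CARD('n) - 1 \<and>
          min_free_res [c1 + 1] [\<alpha>1 # 0 # fs] (c1 # (c2 - 1) # butlast (hd ds # es)) ?D12) \<and>
        SPOG (A - {H1, H2})) \<and>
      (size dsB = CARD('n) + 2 \<or> size dsB = CARD('n) + 1)"
    if nr: "\<not> reach1" and r: reach2
  proof -
    obtain \<psi> k g g' where \<psi>: "\<psi> \<in> ?D12" "hom_der (c2 - 1) \<psi>" "\<phi>2 = comb \<theta>s k + \<alpha>1 *s \<psi>"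
      "\<alpha>2 *s \<psi> = g *s \<phi>1 + comb \<theta>s g'" "homogeneous (c2 - c1) g"
      "\<And>j. j < length \<theta>s \<Longrightarrow> homogeneous (c2 - ds ! j) (g' j)"
      by (rule reach2_data[OF r]) blast
    note data = nr \<psi>
    have gen23: "generated (\<phi>1 # \<psi> # \<theta>s) = ?D12" by (rule generated_case23[OF data])
    show ?thesis
    proof (cases "\<exists>i<length \<theta>s. coef (g' i) 0 \<noteq> 0")
      case False
      then have g'_0: "coef (g' j) 0 = 0" if "j < length \<theta>s" for j using that by blast
      have "size dsB = CARD('n) + 2"
        using length_case2[OF data g'_0 xs(2)] shortest[OF gen23] size len by simp
      then show ?thesis using resolution_case2[OF data g'_0] unfolding len by simp
    next
      case True
      then obtain i where i: "i < length \<theta>s" "coef (g' i) 0 \<noteq> 0" by blast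
      note dsi = resolution_case3(1)[OF data i]
      obtain fs where fs: "length fs = length \<theta>s - 1"
        "min_free_res [c1 + 1] [\<alpha>1 # 0 # fs] (c1 # (c2 - 1) # take i ds @ drop (Suc i) ds) ?D12"
        using resolution_case3(2)[OF data i] by blast
      obtain ts where ts: "generated ts = ?D12" "length ts = length \<theta>s + 1"
        using fs(2) i(1) length_ds unfolding min_free_res_def
        by (elim conjE exE) (auto dest!: list_all2_lengthD)
      have sz: "size dsB = CARD('n) + 1"
        using shortest[OF ts(1)] resolution_case3(3)[OF data i xs(2)] ts(2) size len by simp
      obtain d ds' where ds: "ds = d # ds'" using i(1) length_ds by (cases ds) auto
      \<comment> \<open>the generator in degree \<open>hd ds = 1\<close> stays\<close>
      have "c2 \<noteq> 1" using c1_pos c1_less_c2[OF data] by simp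
      then have "i \<noteq> 0" using dsi assms(3) ds by (cases i) auto
      then obtain i' where i': "i = Suc i'" by (cases i) auto
      have i'_less: "i' < length ds'" using i(1) length_ds ds i' by simp
      \<comment> \<open>the exponent of the superfluous generator is moved to the end, where \<open>butlast\<close> drops it\<close>
      let ?es = "(take i' ds' @ drop (Suc i') ds') @ [ds' ! i']"
      have "mset ?es = mset (take i' ds' @ ds' ! i' # drop (Suc i') ds')" by simp
      then have "mset ?es = mset (tl ds)" using id_take_nth_drop[OF i'_less] ds by simp
      moreover have "butlast (hd ds # ?es) = take i ds @ drop (Suc i) ds" by (simp add: ds i' butlast_append)
      ultimately have "\<exists>es fs. mset es = mset (tl ds) \<and> length fs = CARD('n) - 1 \<and>
          min_free_res [c1 + 1] [\<alpha>1 # 0 # fs] (c1 # (c2 - 1) # butlast (hd ds # es)) ?D12"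
        using fs len by metis
      moreover have "SPOG (A - {H1, H2})"
        unfolding SPOG_def SPOG_with_def
      proof (intro exI conjI)
        show "min_free_res [c1 + 1] [\<alpha>1 # 0 # fs] (c1 # (c2 - 1) # take i ds @ drop (Suc i) ds) ?D12"
          by (rule fs(2))
      qed (use nz1 fs(1) i(1) len length_ds in auto)
      ultimately show ?thesis using sz by simp
    qed
  qed
  have case4: "\<exists>fs gs. length fs = CARD('n) \<and> length gs = CARD('n) \<and>
      min_free_res [c1 + 1, c2 + 1] [\<alpha>1 # 0 # fs, 0 # \<alpha>2 # gs] (c1 # c2 # ds) ?D12"
    if nr: "\<not> reach2"
  proof -
    have "\<not> reach1" using reach1_imp_reach2 assms(13) nr by blast
    then have "generated (\<phi>1 # \<phi>2 # \<theta>s) = ?D12"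
      using generated_case4[OF _ nr xs(2,1)] assms(15) size len by simp
    then show ?thesis using resolution_case4 len by simp
  qed
  have case1: "\<exists>fs. length fs = CARD('n) \<and> min_free_res [c1 + 1] [(\<alpha>1 * \<alpha>2) # fs] ((c1 - 1) # ds) ?D12"
    if reach1
    using resolution_case1[OF that assms(13)] len by simp
  show ?thesis unfolding Let_def reach1_eqs reach2_eqs using case1 case23 case4 by blast
qed

end
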